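(* Let $0<k<n$ be integers and let $a,b\in\mathbb{R}$ be distinct. Let $\operatorname{SO}_n(\mathbb{R})/\operatorname{S}(\operatorname{O}_k(\mathbb{R})\times\operatorname{O}_{n-k}(\mathbb{R}))$ and $\operatorname{Gr}_{a,b}(k,n)$ be equipped with the Riemannian metrics $\mathsf{g}_{a,b}$ and $\mathsf{g}'$ respectively. Then the map $$\varphi_5^{-1}:\operatorname{SO}_n(\mathbb{R})/\operatorname{S}(\operatorname{O}_k(\mathbb{R})\times\operatorname{O}_{n-k}(\mathbb{R}))\to\operatorname{Gr}_{a,b}(k,n),\qquad [\![Q]\!]\mapsto Q\begin{bmatrix}aI_k&0\\0&bI_{n-k}\end{bmatrix}Q^{\mathsf T},$$ is an isometric $\operatorname{SO}_n(\mathbb{R})$-equivariant diffeomorphism.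
   Context: $H:=\operatorname{S}(\operatorname{O}_k(\mathbb{R})\times\operatorname{O}_{n-k}(\mathbb{R}))$ is the group of block diagonal matrices $\operatorname{diag}(X_1,X_2)$ with $X_1\in\operatorname{O}_k(\mathbb{R})$, $X_2\in\operatorname{O}_{n-k}(\mathbb{R})$, $\det(X_1)\det(X_2)=1$; $[\![Q]\!]$ is the coset $QH$. The quadratic model is $\operatorname{Gr}_{a,b}(k,n):=\bigl\{Q\begin{bmatrix}aI_k&0\\0&bI_{n-k}\end{bmatrix}Q^{\mathsf T}:Q\in\operatorname{SO}_n(\mathbb{R})\bigr\}$, a submanifold of the space $\mathsf{S}^2(\mathbb{R}^n)$ of real symmetric matrices, with action $Q\cdot X:=QXQ^{\mathsf T}$; $\operatorname{SO}_n(\mathbb{R})$ acts on the quotient by left translation. Metric $\mathsf{g}'$: the restriction to $\operatorname{Gr}_{a,b}(k,n)$ of the Euclidean inner product $\operatorname{tr}(XY)$ on $\mathsf{S}^2(\mathbb{R}^n)$. Metric $\mathsf{g}_{a,b}$: the space $$\mathfrak{m}=\Bigl\{B=\begin{bmatrix}0&B_0\\-B_0^{\mathsf T}&0\end{bmatrix}:B_0\in\mathbb{R}^{k\times(n-k)}\Bigr\}$$ is a complement of the Lie algebra of $H$ in the skew-symmetric matrices, invariant under conjugation by $H$, and is identified with the tangent space of the quotient at $[\![I]\!]$ via $B\mapsto\frac{d}{ds}\big|_{s=0}[\![\exp(sB)]\!]$. $\mathsf{g}_{a,b}$ is the $\operatorname{SO}_n(\mathbb{R})$-invariant Riemannian metric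 on the quotient whose value at $[\![I]\!]$ is the $H$-invariant inner product on $\mathfrak{m}$ $$\langle B,C\rangle:=(a-b)^2\operatorname{tr}(B^{\mathsf T}C)=2(a-b)^2\operatorname{tr}(B_0^{\mathsf T}C_0).$$ *)

theory Defs
  imports "HOL-Analysis.Analysis"
begin

section \<open>Smooth maps between subsets of Euclidean spaces\<close>

text \<open>
  On an open set \<open>S\<close>, \<open>Ck_on m f S\<close> is the usual class \<open>C\<^sup>m\<close>: in finite dimension, continuity of
  all directional derivatives of order \<open>m\<close> is continuity of the \<open>m\<close>-th Frechet derivative.
\<close>

fun Ck_on :: "nat \<Rightarrow> ('a::euclidean_space \<Rightarrow> 'b::euclidean_space) \<Rightarrow> 'a set \<Rightarrow> bool" where
  "Ck_on 0 f S \<longleftrightarrow> continuous_on S f"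
| "Ck_on (Suc m) f S \<longleftrightarrow>
     (\<forall>x\<in>S. f differentiable (at x)) \<and>
     (\<forall>v. Ck_on m (\<lambda>x. frechet_derivative f (at x) v) S)"

text \<open>
  For an arbitrary set \<open>S\<close>, smoothness means local extendability to a \<open>C\<^sup>\<infinity>\<close> map on an open subset
  of the ambient space; for open \<open>S\<close> this is ordinary \<open>C\<^sup>\<infinity>\<close>.
\<close>

definition smooth_on :: "'a::euclidean_space set \<Rightarrow> ('a \<Rightarrow> 'b::euclidean_space) \<Rightarrow> bool" where
  "smooth_on S f \<longleftrightarrow>
     (\<forall>x\<in>S. \<exists>W F. open W \<and> x \<in> W \<and> (\<forall>m. Ck_on m F W) \<and> (\<forall>y\<in>S \<inter> W. F y = f y))"


section \<open>Manifolds, tangent vectors and Riemannian metrics\<close>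

text \<open>
  A chart is a pair \<open>(U, \<phi>)\<close>; only the values of \<open>\<phi>\<close> on \<open>U\<close> matter. The type \<open>'e\<close> is the model
  space.
\<close>

record ('a, 'e) manifold =
  mtop :: "'a topology"
  atlas :: "('a set \<times> ('a \<Rightarrow> 'e)) set"

abbreviation points :: "('a, 'e) manifold \<Rightarrow> 'a set" where
  "points M \<equiv> topspace (mtop M)"

definition smooth_map ::
  "('a, 'e::euclidean_space) manifold \<Rightarrow> ('b, 'f::euclidean_space) manifold \<Rightarrow> ('a \<Rightarrow> 'b) \<Rightarrow> bool"
where
  "smooth_map M N f \<longleftrightarrow>
     f ` points M \<subseteq> points N \<and>
     (\<forall>p\<in>points M. \<exists>(U, \<phi>)\<in>atlas M. \<exists>(V, \<psi>)\<in>atlas N.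
        p \<in> U \<and> f ` U \<subseteq> V \<and> smooth_on (\<phi> ` U) (\<psi> \<circ> f \<circ> inv_into U \<phi>))"

definition diffeomorphism ::
  "('a, 'e::euclidean_space) manifold \<Rightarrow> ('b, 'f::euclidean_space) manifold \<Rightarrow> ('a \<Rightarrow> 'b) \<Rightarrow> bool"
where
  "diffeomorphism M N f \<longleftrightarrow>
     bij_betw f (points M) (points N) \<and> smooth_map M N f \<and>
     smooth_map N M (inv_into (points M) f)"

text \<open>Curves are only relevant near the parameter value \<open>0\<close>.\<close>

definition smooth_curve :: "('a, 'e::euclidean_space) manifold \<Rightarrow> (real \<Rightarrow> 'a) \<Rightarrow> bool" where
  "smooth_curve M \<gamma> \<longleftrightarrow>
     (\<exists>(U, \<phi>)\<in>atlas M. \<exists>\<epsilon>>0. \<gamma> ` {-\<epsilon><..<\<epsilon>} \<subseteq> U \<and> smooth_on {-\<epsilon><..<\<epsilon>} (\<phi> \<circ> \<gamma>))"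

text \<open>
  A tangent vector is an equivalence class of curves, two curves being equivalent if they pass
  through the same point at \<open>0\<close> and have the same derivative at \<open>0\<close> in charts; \<open>velocity M \<gamma>\<close> is the
  class of \<open>\<gamma>\<close>, that is, \<open>d/ds \<gamma>(s)\<close> at \<open>s = 0\<close>.
\<close>

definition velocity ::
  "('a, 'e::euclidean_space) manifold \<Rightarrow> (real \<Rightarrow> 'a) \<Rightarrow> (real \<Rightarrow> 'a) set" where
  "velocity M \<gamma> =
     {\<delta>. smooth_curve M \<delta> \<and> \<delta> 0 = \<gamma> 0 \<and>
         (\<forall>(U, \<phi>)\<in>atlas M. \<gamma> 0 \<in> U \<longrightarrow>
            vector_derivative (\<phi> \<circ> \<delta>) (at 0) = vector_derivative (\<phi> \<circ> \<gamma>) (at 0))}"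

definition tangent_space ::
  "('a, 'e::euclidean_space) manifold \<Rightarrow> 'a \<Rightarrow> (real \<Rightarrow> 'a) set set" where
  "tangent_space M p = {velocity M \<gamma> | \<gamma>. smooth_curve M \<gamma> \<and> \<gamma> 0 = p}"

definition differential ::
  "('b, 'f::euclidean_space) manifold \<Rightarrow> ('a \<Rightarrow> 'b) \<Rightarrow> (real \<Rightarrow> 'a) set \<Rightarrow> (real \<Rightarrow> 'b) set" where
  "differential N f u = the_elem ((\<lambda>\<gamma>. velocity N (f \<circ> \<gamma>)) ` u)"

type_synonym 'a metric_field = "'a \<Rightarrow> (real \<Rightarrow> 'a) set \<Rightarrow> (real \<Rightarrow> 'a) set \<Rightarrow> real"

text \<open>
  In a chart \<open>(U, \<phi>)\<close>, the map \<open>w \<mapsto> d/ds \<phi>\<^sup>-\<^sup>1(x + s w)\<close> is the linear isomorphism from the model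
  space to the tangent space at \<open>\<phi>\<^sup>-\<^sup>1(x)\<close>; \<open>chart_metric\<close> is the coordinate expression of \<open>g\<close>.
\<close>

definition chart_metric ::
  "('a, 'e::euclidean_space) manifold \<Rightarrow> 'a metric_field \<Rightarrow> 'a set \<Rightarrow> ('a \<Rightarrow> 'e) \<Rightarrow>
    'e \<Rightarrow> 'e \<Rightarrow> 'e \<Rightarrow> real" where
  "chart_metric M g U \<phi> x w w' =
     g (inv_into U \<phi> x)
       (velocity M (\<lambda>s. inv_into U \<phi> (x + s *\<^sub>R w)))
       (velocity M (\<lambda>s. inv_into U \<phi> (x + s *\<^sub>R w')))"

definition riemannian_metric :: "('a, 'e::euclidean_space) manifold \<Rightarrow> 'a metric_field \<Rightarrow> bool"
where
  "riemannian_metric M g \<longleftrightarrow>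
     (\<forall>(U, \<phi>)\<in>atlas M.
        (\<forall>x\<in>\<phi> ` U.
           bilinear (chart_metric M g U \<phi> x) \<and>
           (\<forall>w w'. chart_metric M g U \<phi> x w w' = chart_metric M g U \<phi> x w' w) \<and>
           (\<forall>w. w \<noteq> 0 \<longrightarrow> chart_metric M g U \<phi> x w w > 0)) \<and>
        (\<forall>w w'. smooth_on (\<phi> ` U) (\<lambda>x. chart_metric M g U \<phi> x w w')))"

definition isometric ::
  "('a, 'e::euclidean_space) manifold \<Rightarrow> 'a metric_field \<Rightarrow>
   ('b, 'f::euclidean_space) manifold \<Rightarrow> 'b metric_field \<Rightarrow> ('a \<Rightarrow> 'b) \<Rightarrow> bool" where
  "isometric M g N g' f \<longleftrightarrow>
     (\<forall>p\<in>points M. \<forall>u\<in>tangent_space M p. \<forall>v\<in>tangent_space M p.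
        g' (f p) (differential N f u) (differential N f v) = g p u v)"


section \<open>Submanifolds of Euclidean spaces and quotients of them\<close>

text \<open>
  The charts of an embedded submanifold are the diffeomorphisms from its relatively open subsets
  onto open subsets of the model space.
\<close>

definition submanifold :: "'v::euclidean_space set \<Rightarrow> ('v, 'e::euclidean_space) manifold" where
  "submanifold S =
     \<lparr>mtop = top_of_set S,
      atlas = {(U, \<phi>). openin (top_of_set S) U \<and> open (\<phi> ` U) \<and> inj_on \<phi> U \<and>
                 smooth_on U \<phi> \<and> smooth_on (\<phi> ` U) (inv_into U \<phi>)}\<rparr>"

text \<open>The velocity of a curve in \<open>S\<close>, as a vector of the ambient space.\<close>

definition ambient_vector :: "(real \<Rightarrow> 'v::euclidean_space) set \<Rightarrow> 'v" where
  "ambient_vector u = the_elem ((\<lambda>\<gamma>. vector_derivative \<gamma> (at 0)) ` u)"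

definition quotient_top :: "'a topology \<Rightarrow> ('a \<Rightarrow> 'b) \<Rightarrow> 'b topology" where
  "quotient_top X \<pi> =
     topology (\<lambda>U. U \<subseteq> \<pi> ` topspace X \<and> openin X {x \<in> topspace X. \<pi> x \<in> U})"

lemma openin_quotient_top:
  "openin (quotient_top X \<pi>) U \<longleftrightarrow>
     U \<subseteq> \<pi> ` topspace X \<and> openin X {x \<in> topspace X. \<pi> x \<in> U}"
proof -
  let ?P = "\<lambda>U. U \<subseteq> \<pi> ` topspace X \<and> openin X {x \<in> topspace X. \<pi> x \<in> U}"
  have "?P (S \<inter> T)" if "?P S" "?P T" for S T
  proof -
    have "{x \<in> topspace X. \<pi> x \<in> S \<inter> T} =
        {x \<in> topspace X. \<pi> x \<in> S} \<inter> {x \<in> topspace X. \<pi> x \<in> T}" by auto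
    with that show ?thesis by auto
  qed
  moreover have "?P (\<Union>K)" if "\<forall>S\<in>K. ?P S" for K
  proof -
    have "{x \<in> topspace X. \<pi> x \<in> \<Union>K} = (\<Union>S\<in>K. {x \<in> topspace X. \<pi> x \<in> S})" by auto
    with that show ?thesis by auto
  qed
  ultimately have "istopology ?P"
    unfolding istopology_def by blast
  then show ?thesis by (simp add: quotient_top_def)
qed

lemma topspace_quotient_top: "topspace (quotient_top X \<pi>) = \<pi> ` topspace X"
proof -
  have "{x \<in> topspace X. \<pi> x \<in> \<pi> ` topspace X} = topspace X" by auto
  then have "openin (quotient_top X \<pi>) (\<pi> ` topspace X)"
    by (simp add: openin_quotient_top)
  then show ?thesis
    by (metis openin_quotient_top openin_subset openin_topspace subset_antisym)
qed

text \<open>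
  \<open>f\<close> is a smooth submersion on the relatively open subset \<open>D\<close> of the submanifold \<open>S\<close>: its
  differential at each \<open>x\<close> in \<open>D\<close> hits every vector \<open>w\<close>, tangent vectors of \<open>S\<close> being represented
  by smooth curves.
\<close>

definition submersion_on ::
  "'v::euclidean_space set \<Rightarrow> 'v set \<Rightarrow> ('v \<Rightarrow> 'e::euclidean_space) \<Rightarrow> bool" where
  "submersion_on S D f \<longleftrightarrow>
     smooth_on D f \<and>
     (\<forall>x\<in>D. \<forall>w. \<exists>c. \<exists>\<epsilon>>0. c ` {-\<epsilon><..<\<epsilon>} \<subseteq> S \<and> smooth_on {-\<epsilon><..<\<epsilon>} c \<and> c 0 = x \<and>
        (f \<circ> c has_vector_derivative w) (at 0))"

text \<open>
  The smooth structure on a quotient is the one for which the projection \<open>\<pi>\<close> is a smooth submersion.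
\<close>

definition quotient_manifold ::
  "'v::euclidean_space set \<Rightarrow> ('v \<Rightarrow> 'b) \<Rightarrow> ('b, 'e::euclidean_space) manifold" where
  "quotient_manifold S \<pi> =
     \<lparr>mtop = quotient_top (top_of_set S) \<pi>,
      atlas = {(U, \<phi>). openin (quotient_top (top_of_set S) \<pi>) U \<and> open (\<phi> ` U) \<and>
                 homeomorphic_map (subtopology (quotient_top (top_of_set S) \<pi>) U)
                   (top_of_set (\<phi> ` U)) \<phi> \<and>
                 submersion_on S {x \<in> S. \<pi> x \<in> U} (\<phi> \<circ> \<pi>)}\<rparr>"


section \<open>The two models of the Grassmannian\<close>

text \<open>
  The finite (automatically nonempty) types \<open>'k\<close> and \<open>'l\<close> index the first \<open>k\<close> and the last \<open>n - k\<close>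
  coordinates, so \<open>k = CARD('k)\<close>, \<open>n - k = CARD('l)\<close> and \<open>n = CARD('k + 'l)\<close>; every pair \<open>0 < k < n\<close>
  arises in this way.
\<close>

type_synonym ('k, 'l) bmat = "real^('k + 'l)^('k + 'l)"

definition block ::
  "real^'k^'k \<Rightarrow> real^'l^'k \<Rightarrow> real^'k^'l \<Rightarrow> real^'l^'l \<Rightarrow> ('k::finite, 'l::finite) bmat" where
  "block A B C D =
     (\<chi> i j. case i of
        Inl p \<Rightarrow> (case j of Inl q \<Rightarrow> A $ p $ q | Inr q \<Rightarrow> B $ p $ q)
      | Inr p \<Rightarrow> (case j of Inl q \<Rightarrow> C $ p $ q | Inr q \<Rightarrow> D $ p $ q))"

definition SO :: "(real^'n::finite^'n) set" where
  "SO = {Q. rotation_matrix Q}"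

definition SOO :: "('k::finite, 'l::finite) bmat set" where
  "SOO = {block X1 0 0 X2 | X1 X2.
            orthogonal_matrix X1 \<and> orthogonal_matrix X2 \<and> det X1 * det X2 = 1}"

definition coset :: "('k::finite, 'l::finite) bmat \<Rightarrow> ('k, 'l) bmat set" where
  "coset Q = {Q ** h | h. h \<in> SOO}"

text \<open>The model space \<open>real^'l^'k\<close> is the space of matrices of size \<open>k\<close> times \<open>n - k\<close>.\<close>

definition quotient_model :: "(('k::finite, 'l::finite) bmat set, real^'l^'k) manifold" where
  "quotient_model = quotient_manifold SO coset"

definition translate ::
  "('k::finite, 'l::finite) bmat \<Rightarrow> ('k, 'l) bmat set \<Rightarrow> ('k, 'l) bmat set" where
  "translate Q c = (\<lambda>X. Q ** X) ` c"

definition Gr :: "real \<Rightarrow> real \<Rightarrow> ('k::finite, 'l::finite) bmat set" where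
  "Gr a b = {Q ** block (mat a) 0 0 (mat b) ** transpose Q | Q. Q \<in> SO}"

text \<open>
  The ambient space here is the space of all square matrices rather than its linear subspace of
  symmetric ones; this induces the same smooth structure on \<open>Gr a b\<close>.
\<close>

definition quadratic_model ::
  "real \<Rightarrow> real \<Rightarrow> (('k::finite, 'l::finite) bmat, real^'l^'k) manifold" where
  "quadratic_model a b = submanifold (Gr a b)"

definition quadratic_metric :: "('k::finite, 'l::finite) bmat metric_field" where
  "quadratic_metric X u v = trace (ambient_vector u ** ambient_vector v)"

definition mexp :: "real^'n::finite^'n \<Rightarrow> real^'n^'n" where
  "mexp B = (\<Sum>i. (1 / fact i) *\<^sub>R (((**) B ^^ i) (mat 1)))"

definition m_space :: "('k::finite, 'l::finite) bmat set" where
  "m_space = {block 0 B0 (- transpose B0) 0 | B0. True}"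

text \<open>
  \<open>g\<close> is the \<open>SO\<close>-invariant Riemannian metric on the quotient with the prescribed value at the base
  point; invariance and this value determine \<open>g\<close> on all tangent spaces.
\<close>

definition is_quotient_metric ::
  "real \<Rightarrow> real \<Rightarrow> ('k::finite, 'l::finite) bmat set metric_field \<Rightarrow> bool" where
  "is_quotient_metric a b g \<longleftrightarrow>
     riemannian_metric quotient_model g \<and>
     (\<forall>Q\<in>SO. isometric quotient_model g quotient_model g (translate Q)) \<and>
     (\<forall>B\<in>m_space. \<forall>C\<in>m_space.
        g (coset (mat 1))
          (velocity quotient_model (\<lambda>s. coset (mexp (s *\<^sub>R B))))
          (velocity quotient_model (\<lambda>s. coset (mexp (s *\<^sub>R C)))) =
        (a - b)\<^sup>2 * trace (transpose B ** C))"

text \<open>The map \<open>coset Q \<mapsto> Q diag(a I, b I) Q\<^sup>T\<close>, which does not depend on the representative.\<close>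

definition phi5_inv ::
  "real \<Rightarrow> real \<Rightarrow> ('k::finite, 'l::finite) bmat set \<Rightarrow> ('k, 'l) bmat" where
  "phi5_inv a b c = the_elem ((\<lambda>Q. Q ** block (mat a) 0 0 (mat b) ** transpose Q) ` c)"

end

theory Submission
  imports Defs
begin

text \<open>
  Write \<open>D = diag(a I, b I)\<close> and \<open>f(Q) = Q D Q\<^sup>T\<close>. Because \<open>a \<noteq> b\<close>, a matrix commutes with \<open>D\<close> iff
  it is block diagonal, so the cosets are exactly the fibres of \<open>f\<close> on the rotation group
  (\<open>coset_eq_fiber\<close>). Hence \<open>\<phi> : [[Q]] \<mapsto> f(Q)\<close> is a well defined equivariant bijection, and a
  homeomorphism because the rotation group is compact (\<open>homeomorphic_map_phi5_inv\<close>).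

  The link between the two smooth structures is a smooth local section of \<open>f\<close>. Put
  \<open>S(T) = [0, T; -T\<^sup>T, 0]\<close> and let \<open>cay\<close> be the Cayley transform, which turns skew-symmetric
  matrices into rotations and is rational. The upper right block of \<open>f(cay(S(T)))\<close> is a smooth
  function of \<open>T\<close> with derivative \<open>2 (b - a)\<close> times the identity at \<open>0\<close>, so it is invertible near
  \<open>0\<close> with smooth inverse \<open>\<tau>\<close>. Moreover a matrix \<open>X\<close> of the quadratic model that is close to \<open>D\<close>
  is determined by its upper right block \<open>X\<^sub>1\<^sub>2\<close>. Together, \<open>X \<mapsto> X\<^sub>1\<^sub>2\<close> is a chart near \<open>D\<close>, and
  \<open>X \<mapsto> cay(S(\<tau>(X\<^sub>1\<^sub>2)))\<close> is a section of \<open>f\<close>; conjugation moves both to every other point (\<open>Gr_chart_with_section\<close>).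

  With such a lift, every chart of the quadratic model becomes a chart of the quotient
  (\<open>quotient_chart_of_quadratic_chart\<close>): a curve with prescribed velocity in the model lifts to
  the rotation group, which is the submersion property. Conversely, a chart \<open>\<phi>\<^sub>1\<close> of the quotient
  becomes a chart of the quadratic model (\<open>quadratic_chart_of_quotient_chart\<close>): composed with
  the lift, \<open>\<phi>\<^sub>1\<close> is smooth, and the submersion property makes its derivative onto, so its inverse
  is smooth as well. Thus \<open>\<phi>\<close> identifies the two atlases and is a diffeomorphism.

  For the metrics, the identification of the atlases means that a tangent vector of either
  model is the same thing as the derivative of the corresponding curve of matrices. Lifting
  curves shows that every tangent vector at \<open>[[Q]]\<close> is the translate by \<open>Q\<close> of the velocity of
  \<open>[[exp(s S(h))]]\<close> for some \<open>h\<close>, and that its image is \<open>Q (S(h) D - D S(h)) Q\<^sup>T\<close>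
  (\<open>tangent_vector_from_mexp\<close>). Invariance reduces the metric of the quotient to its value at the base
  point, and the commutator identity \<open>S(h) D - D S(h) = (b - a) [0, h; h\<^sup>T, 0]\<close> shows that the
  traces agree (\<open>trace_commutators\<close>).
\<close>

section \<open>Calculus of maps of class \<open>C\<^sup>m\<close>\<close>

lemma Ck_on_subset: "Ck_on m f S \<Longrightarrow> T \<subseteq> S \<Longrightarrow> Ck_on m f T"
  by (induction m arbitrary: f) (auto intro: continuous_on_subset)

lemma Ck_on_cong:
  assumes "open S" "\<And>x. x \<in> S \<Longrightarrow> f x = g x" "Ck_on m f S"
  shows "Ck_on m (g::'a::euclidean_space \<Rightarrow> 'b::euclidean_space) S"
  using assms
proof (induction m arbitrary: f g)
  case 0
  then show ?case by (simp cong: continuous_on_cong)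
next
  case (Suc m)
  have D: "(g has_derivative frechet_derivative f (at x)) (at x)" if "x \<in> S" for x
    using has_derivative_transform_within_open[OF _ Suc.prems(1) that Suc.prems(2)]
      Suc.prems(3) that by (simp add: frechet_derivative_works)
  have "Ck_on m (\<lambda>x. frechet_derivative f (at x) v) S" for v
    using Suc.prems(3) by simp
  then have "Ck_on m (\<lambda>x. frechet_derivative g (at x) v) S" for v
    by (rule Suc.IH[OF Suc.prems(1), rotated]) (simp add: frechet_derivative_at[OF D])
  moreover have "g differentiable (at x)" if "x \<in> S" for x
    using D[OF that] differentiable_def by blast
  ultimately show ?case by simp
qed

lemma Ck_on_SucI:
  assumes "open S" "\<And>x. x \<in> S \<Longrightarrow> (f has_derivative f' x) (at x)"
    and "\<And>v. Ck_on m (\<lambda>x. f' x v) S"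
  shows "Ck_on (Suc m) (f::'a::euclidean_space \<Rightarrow> 'b::euclidean_space) S"
proof -
  have "f differentiable (at x)" if "x \<in> S" for x
    using assms(2) that differentiable_def by blast
  moreover have "Ck_on m (\<lambda>x. frechet_derivative f (at x) v) S" for v
    by (rule Ck_on_cong[OF assms(1) _ assms(3)[of v]]) (metis assms(2) frechet_derivative_at)
  ultimately show ?thesis by simp
qed

lemma Ck_on_if_Ck_on_Suc: "Ck_on (Suc m) f S \<Longrightarrow> Ck_on m f S"
proof (induction m arbitrary: f)
  case 0
  then show ?case
    by (auto intro: continuous_at_imp_continuous_on differentiable_imp_continuous_within)
next
  case (Suc m)
  then show ?case by simp
qed

lemma Ck_on_continuous: "Ck_on m f S \<Longrightarrow> continuous_on S f"
proof (induction m)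
  case (Suc m)
  show ?case by (rule Suc.IH[OF Ck_on_if_Ck_on_Suc[OF Suc.prems]])
qed simp

text \<open>The class \<open>C\<^sup>m\<close> is a local property, although the definition speaks about one fixed set: continuity
  and differentiability are pointwise and so are the values of the directional derivatives.\<close>

lemma Ck_on_local:
  assumes "\<And>x. x \<in> S \<Longrightarrow> \<exists>W. open W \<and> x \<in> W \<and> Ck_on m f W"
  shows "Ck_on m f S"
  using assms
proof (induction m arbitrary: f)
  case 0
  then show ?case
    by (auto simp: continuous_on_eq_continuous_at intro!: continuous_at_imp_continuous_on)
      (metis continuous_on_eq_continuous_at)
next
  case (Suc m)
  then show ?case by simp meson
qed

lemma Ck_on_const [simp]: "Ck_on m (\<lambda>x. c) S"
  by (induction m arbitrary: c) auto

lemma Ck_on_linear: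
  assumes "bounded_linear f" 
  shows "Ck_on m f S"
proof -
  have "frechet_derivative f (at x) = f" for x
    using assms bounded_linear_imp_has_derivative frechet_derivative_at by metis
  with assms show ?thesis
    by (cases m) (auto simp: linear_continuous_on bounded_linear_imp_differentiable)
qed

lemma Ck_on_add:
  assumes "open S" "Ck_on m f S" "Ck_on m g S"
  shows "Ck_on m (\<lambda>x. f x + g x) S"
  using assms(2,3)
proof (induction m arbitrary: f g)
  case (Suc m)
  show ?case
    by (rule Ck_on_SucI[OF assms(1), where f' = "\<lambda>x v. frechet_derivative f (at x) v + frechet_derivative g (at x) v"])
       (use Suc in \<open>auto simp: frechet_derivative_works intro!: derivative_intros\<close>)
qed (auto intro: continuous_intros)

lemma Ck_on_sum:
  assumes "open S" "\<And>i. i \<in> I \<Longrightarrow> Ck_on m (f i) S"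
  shows "Ck_on m (\<lambda>x. \<Sum>i\<in>I. f i x) S"
  using assms(2) by (induction I rule: infinite_finite_induct) (auto intro!: Ck_on_add assms(1))

lemma Ck_on_bilinear:
  assumes "bounded_bilinear h" "open S" "Ck_on m f S" "Ck_on m g S"
  shows "Ck_on m (\<lambda>x. h (f x) (g x)) S"
  using assms(3,4)
proof (induction m arbitrary: f g)
  case 0
  then show ?case by (auto intro: bounded_bilinear.continuous_on[OF assms(1)])
next
  case (Suc m)
  show ?case
    by (rule Ck_on_SucI[OF assms(2), where f' = "\<lambda>x v. h (f x) (frechet_derivative g (at x) v) + h (frechet_derivative f (at x) v) (g x)"])
       (use Suc.prems Ck_on_if_Ck_on_Suc[OF Suc.prems(1)] Ck_on_if_Ck_on_Suc[OF Suc.prems(2)] in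
        \<open>auto simp: frechet_derivative_works intro!: bounded_bilinear.FDERIV[OF assms(1)] Ck_on_add assms(2) Suc.IH\<close>)
qed

lemma linear_Basis_expansion:
  assumes "linear L"
  shows "L v = (\<Sum>i\<in>Basis. (v \<bullet> i) *\<^sub>R L i)"
proof -
  have "L v = L (\<Sum>i\<in>Basis. (v \<bullet> i) *\<^sub>R i)" by (simp add: euclidean_representation)
  also have "\<dots> = (\<Sum>i\<in>Basis. (v \<bullet> i) *\<^sub>R L i)"
    using assms by (simp add: linear_sum linear_cmul)
  finally show ?thesis .
qed

text \<open>The chain rule expresses a directional derivative of the composition as a finite sum of products
  of coordinates of the inner derivative with partial derivatives of \<open>g\<close> along basis vectors; only
  in this form do the arguments of the derivative of \<open>g\<close> stay fixed, so that the induction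
  hypothesis applies to them.\<close>

lemma Ck_on_compose:
  fixes f :: "'a::euclidean_space \<Rightarrow> 'b::euclidean_space"
    and g :: "'b \<Rightarrow> 'c::euclidean_space"
  assumes "open S" "open T" "f ` S \<subseteq> T" "Ck_on m f S" "Ck_on m g T"
  shows "Ck_on m (\<lambda>x. g (f x)) S"
  using assms(4,5)
proof (induction m arbitrary: g)
  case 0
  then show ?case using assms(3) by (auto intro: continuous_on_compose2)
next
  case (Suc m)
  let ?D = "\<lambda>x v. frechet_derivative g (at (f x)) (frechet_derivative f (at x) v)"
  have D: "((\<lambda>x. g (f x)) has_derivative ?D x) (at x)" if "x \<in> S" for x
    using diff_chain_at[of f _ x g] Suc.prems that assms(3)
    by (auto simp: frechet_derivative_works o_def image_subset_iff)
  have "Ck_on m (\<lambda>x. \<Sum>i\<in>Basis. (frechet_derivative f (at x) v \<bullet> i) *\<^sub>R frechet_derivative g (at (f x)) i) S" for v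
    using Suc.prems Ck_on_if_Ck_on_Suc[OF Suc.prems(1)]
    by (intro Ck_on_sum[OF assms(1)] Ck_on_bilinear[OF bounded_bilinear_scaleR assms(1)]
        Ck_on_bilinear[OF bounded_bilinear_inner assms(1)] Ck_on_const
        Suc.IH[where g = "\<lambda>z. frechet_derivative g (at z) _"]) auto
  then have "Ck_on m (\<lambda>x. ?D x v) S" for v
  proof (rule Ck_on_cong[OF assms(1), rotated])
    fix x assume "x \<in> S"
    then have "linear (frechet_derivative g (at (f x)))"
      using Suc.prems(2) assms(3) by (auto simp: linear_frechet_derivative)
    from linear_Basis_expansion[OF this]
    show "(\<Sum>i\<in>Basis. (frechet_derivative f (at x) v \<bullet> i) *\<^sub>R frechet_derivative g (at (f x)) i) = ?D x v"
      by metis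
  qed
  then show ?case
    by (intro Ck_on_SucI[where f' = ?D, OF assms(1) D])
qed

section \<open>Smooth inverses\<close>

text \<open>In the product rule the derivative of the second factor is multiplied by the value of the first.
  Where the first factor vanishes, continuity of the second therefore suffices. This is what
  turns continuity of an inverse into its differentiability below.\<close>

lemma has_derivative_scaleR_vanishing:
  fixes f :: "'a::euclidean_space \<Rightarrow> real" and c :: "'a \<Rightarrow> 'b::euclidean_space"
  assumes f: "(f has_derivative f') (at x)" and "f x = 0" and c: "isCont c x"
  shows "((\<lambda>y. f y *\<^sub>R c y) has_derivative (\<lambda>h. f' h *\<^sub>R c x)) (at x)"
proof -
  have 1: "((\<lambda>y. f y *\<^sub>R c x) has_derivative (\<lambda>h. f' h *\<^sub>R c x)) (at x)"
    by (intro derivative_intros f)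
  have "((\<lambda>y. f y *\<^sub>R (c y - c x)) has_derivative (\<lambda>h. 0)) (at x)"
    unfolding has_derivative_at_alt
  proof (intro conjI allI impI bounded_linear_zero)
    fix e :: real assume "e > 0"
    have "bounded_linear f'" using f by (simp add: has_derivative_bounded_linear)
    then obtain K where K: "K > 0" "\<And>h. norm (f' h) \<le> norm h * K"
      using bounded_linear.pos_bounded by blast
    have "\<exists>d>0. \<forall>y. norm (y - x) < d \<longrightarrow> norm (f y - f x - f' (y - x)) \<le> 1 * norm (y - x)"
      using f unfolding has_derivative_at_alt by (meson zero_less_one)
    then obtain d1 where d1: "d1 > 0" "\<And>y. norm (y - x) < d1 \<Longrightarrow> norm (f y - f x - f' (y - x)) \<le> norm (y - x)"
      by auto
    have "e / (1 + K) > 0" using \<open>e > 0\<close> K by simp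
    then obtain d2 where d2: "d2 > 0" "\<And>y. norm (y - x) < d2 \<Longrightarrow> norm (c y - c x) < e / (1 + K)"
      using c unfolding continuous_at_eps_delta dist_norm by metis
    have "norm (f y *\<^sub>R (c y - c x) - f x *\<^sub>R (c x - c x) - 0) \<le> e * norm (y - x)"
      if "norm (y - x) < min d1 d2" for y
    proof -
      have "\<bar>f y\<bar> \<le> (1 + K) * norm (y - x)"
        using d1(2)[of y] K(2)[of "y - x"] that assms(2) by (simp add: algebra_simps)
      moreover have "norm (c y - c x) \<le> e / (1 + K)" using d2(2)[of y] that by simp
      ultimately have "\<bar>f y\<bar> * norm (c y - c x) \<le> ((1 + K) * norm (y - x)) * (e / (1 + K))"
        using K by (intro mult_mono) auto
      also have "\<dots> = e * norm (y - x)" using K by (simp add: field_simps)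
      finally show ?thesis by simp
    qed
    then show "\<exists>d>0. \<forall>y. norm (y - x) < d \<longrightarrow> norm (f y *\<^sub>R (c y - c x) - f x *\<^sub>R (c x - c x) - 0) \<le> e * norm (y - x)"
      using d1(1) d2(1) by (intro exI[of _ "min d1 d2"]) auto
  qed
  from has_derivative_add[OF 1 this] show ?thesis by (simp add: algebra_simps)
qed

text \<open>Near \<open>x\<^sub>0\<close> the maps \<open>A x\<close> are bounded below by a uniform constant, and with \<open>u = B x\<^sub>0 v\<close> the vector
  \<open>A x (B x v - B x\<^sub>0 v) = A x\<^sub>0 u - A x u\<close> tends to \<open>0\<close>.\<close>

lemma continuous_inverse_family:
  fixes A :: "'x::euclidean_space \<Rightarrow> 'e::euclidean_space \<Rightarrow> 'e"
  assumes "open S"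
    and lin: "\<And>x. x \<in> S \<Longrightarrow> linear (A x)"
    and AB: "\<And>x v. x \<in> S \<Longrightarrow> A x (B x v) = v"
    and BA: "\<And>x v. x \<in> S \<Longrightarrow> B x (A x v) = v"
    and cont: "\<And>v. continuous_on S (\<lambda>x. A x v)"
  shows "continuous_on S (\<lambda>x. B x v)"
proof (rule continuous_at_imp_continuous_on, rule ballI)
  fix x0 assume x0: "x0 \<in> S"
  define u where "u = B x0 v"
  \<comment> \<open>\<open>E x\<close> dominates the operator norm of \<open>A x - A x0\<close> and tends to \<open>0\<close>.\<close>
  define E where "E x = (\<Sum>i\<in>Basis. norm (A x i - A x0 i))" for x
  have "inj (A x0)" using BA[OF x0] by (rule inj_on_inverseI)
  then obtain c where c: "c > 0" "\<And>w. c * norm w \<le> norm (A x0 w)"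
    using linear_inj_bounded_below_pos[OF lin[OF x0]] by blast
  have E: "norm (A x w - A x0 w) \<le> E x * norm w" if "x \<in> S" for x w
  proof -
    have "A x w - A x0 w = (\<Sum>i\<in>Basis. (w \<bullet> i) *\<^sub>R A x i) - (\<Sum>i\<in>Basis. (w \<bullet> i) *\<^sub>R A x0 i)"
      by (rule arg_cong2[where f = minus]; rule linear_Basis_expansion; rule lin) fact+
    also have "\<dots> = (\<Sum>i\<in>Basis. (w \<bullet> i) *\<^sub>R (A x i - A x0 i))"
      by (simp add: sum_subtractf scaleR_diff_right)
    also have "norm \<dots> \<le> (\<Sum>i\<in>Basis. norm w * norm (A x i - A x0 i))"
      by (intro sum_norm_le) (auto intro!: mult_right_mono Basis_le_norm)
    finally show ?thesis by (simp add: E_def sum_distrib_left mult.commute)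
  qed
  have cA: "isCont (\<lambda>x. A x w) x0" for w
    using cont x0 assms(1) by (simp add: continuous_on_eq_continuous_at)
  have "((\<lambda>x. E x) \<longlongrightarrow> (\<Sum>i\<in>(Basis::'e set). norm (A x0 i - A x0 i))) (at x0)"
    unfolding E_def by (intro tendsto_intros cA[unfolded isCont_def])
  then have E0: "(E \<longlongrightarrow> 0) (at x0)" by simp
  have ev: "\<forall>\<^sub>F x in at x0. x \<in> S \<and> E x < c / 2"
    using order_tendstoD(2)[OF E0, of "c/2"] c(1) eventually_at_in_open'[OF assms(1) x0]
    by (intro eventually_conj) simp_all
  have bound: "\<forall>\<^sub>F x in at x0. norm (B x v - B x0 v) \<le> (2 / c) * E x * norm u"
    using ev
  proof eventually_elim
    case (elim x)
    let ?d = "B x v - B x0 v"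
    have eq: "A x ?d = - (A x u - A x0 u)"
      using AB elim x0 by (simp add: linear_diff[OF lin] u_def)
    have 1: "norm (A x ?d) \<le> E x * norm u"
      using E[of x u] elim by (simp only: eq norm_minus_cancel)
    have "norm (A x0 ?d) - norm (A x ?d) \<le> norm (A x ?d - A x0 ?d)"
      by (metis norm_minus_commute norm_triangle_ineq2)
    then have "(c - E x) * norm ?d \<le> norm (A x ?d)"
      using c(2)[of ?d] E[of x ?d] elim by (simp add: algebra_simps)
    moreover have "(c / 2) * norm ?d \<le> (c - E x) * norm ?d"
      using elim by (intro mult_right_mono) auto
    ultimately have "(c / 2) * norm ?d \<le> E x * norm u" using 1 by linarith
    then have "(2 / c) * ((c / 2) * norm ?d) \<le> (2 / c) * (E x * norm u)"
      using c(1) by (intro mult_left_mono) auto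
    then show ?case using c(1) by simp
  qed
  have lim: "((\<lambda>x. (2 / c) * E x * norm u) \<longlongrightarrow> 0) (at x0)"
    by (rule tendsto_eq_rhs[OF tendsto_mult[OF tendsto_mult[OF tendsto_const E0] tendsto_const]]) simp
  show "isCont (\<lambda>x. B x v) x0"
    unfolding isCont_def by (rule LIM_zero_cancel[OF Lim_null_comparison[OF bound lim]])
qed

text \<open>Differentiating \<open>A x (B x v) = v\<close> gives \<open>- B x (DA(x) (B x v))\<close> for the derivative of \<open>B x v\<close>, which
  is a polynomial expression in \<open>B\<close> and the derivatives of \<open>A\<close>, so the order of
  differentiability can be raised step by step. The lemma serves both for matrix inverses (the
  Cayley transform) and for derivatives of inverse functions.\<close>

lemma Ck_on_inverse_family:
  fixes A :: "'x::euclidean_space \<Rightarrow> 'e::euclidean_space \<Rightarrow> 'e"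
  assumes "open S"
    and lin: "\<And>x. x \<in> S \<Longrightarrow> linear (A x)"
    and AB: "\<And>x v. x \<in> S \<Longrightarrow> A x (B x v) = v"
    and BA: "\<And>x v. x \<in> S \<Longrightarrow> B x (A x v) = v"
    and "\<And>v. Ck_on m (\<lambda>x. A x v) S"
  shows "Ck_on m (\<lambda>x. B x v) S"
  using assms(5)
proof (induction m arbitrary: v)
  case 0
  then show ?case using continuous_inverse_family[OF assms(1-4)] by simp
next
  case (Suc m)
  have linB: "linear (B x)" if "x \<in> S" for x
  proof (rule linearI)
    fix u w c
    have *: "A x (B x u + B x w) = u + w" "A x (c *\<^sub>R B x u) = c *\<^sub>R u"
      using AB[OF that] by (simp_all add: linear_add[OF lin[OF that]] linear_cmul[OF lin[OF that]])
    show "B x (u + w) = B x u + B x w" using BA[OF that, of "B x u + B x w"] by (simp only: *)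
    show "B x (c *\<^sub>R u) = c *\<^sub>R B x u" using BA[OF that, of "c *\<^sub>R B x u"] by (simp only: *)
  qed
  have B_m: "Ck_on m (\<lambda>x. B x v) S" for v
    using Suc Ck_on_if_Ck_on_Suc by blast
  then have contB: "isCont (\<lambda>x. B x v) x" if "x \<in> S" for v x
    using continuous_inverse_family[OF assms(1-4) Ck_on_continuous[OF Suc.prems]] that assms(1)
    by (auto simp: continuous_on_eq_continuous_at)
  let ?DA = "\<lambda>x i. frechet_derivative (\<lambda>y. A y i) (at x)"
  have DA: "((\<lambda>y. A y i) has_derivative ?DA x i) (at x)" if "x \<in> S" for x i
    using Suc.prems[of i] that by (simp add: frechet_derivative_works)
  \<comment> \<open>The candidate \<open>- B x (DA(x) h (B x v))\<close>, expanded in the basis.\<close>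
  define D where "D x h = - (\<Sum>j\<in>Basis. ((\<Sum>i\<in>Basis. (B x v \<bullet> i) *\<^sub>R ?DA x i h) \<bullet> j) *\<^sub>R B x j)" for x h
  have "((\<lambda>y. B y v) has_derivative D x) (at x)" if x: "x \<in> S" for x
  proof -
    define u where "u = B x v"
    let ?f = "\<lambda>y. \<Sum>i\<in>Basis. (u \<bullet> i) *\<^sub>R A y i"
    have "(?f has_derivative (\<lambda>h. \<Sum>i\<in>Basis. (u \<bullet> i) *\<^sub>R ?DA x i h)) (at x)"
      by (intro derivative_intros DA x)
    from has_derivative_inner_left[OF has_derivative_diff[OF this has_derivative_const[of v]]]
    have "((\<lambda>y. (?f y - v) \<bullet> j) has_derivative (\<lambda>h. (\<Sum>i\<in>Basis. (u \<bullet> i) *\<^sub>R ?DA x i h) \<bullet> j)) (at x)" for j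
      by simp
    moreover have "?f x = v"
      using linear_Basis_expansion[OF lin[OF x], of u] AB[OF x] by (simp add: u_def)
    ultimately have "((\<lambda>y. ((?f y - v) \<bullet> j) *\<^sub>R B y j) has_derivative
        (\<lambda>h. ((\<Sum>i\<in>Basis. (u \<bullet> i) *\<^sub>R ?DA x i h) \<bullet> j) *\<^sub>R B x j)) (at x)" for j
      by (intro has_derivative_scaleR_vanishing contB x) auto
    from has_derivative_diff[OF has_derivative_const[of u] has_derivative_sum[OF this]]
    have "((\<lambda>y. u - (\<Sum>j\<in>Basis. ((?f y - v) \<bullet> j) *\<^sub>R B y j)) has_derivative D x) (at x)"
      unfolding D_def u_def by simp
    then show ?thesis
    proof (rule has_derivative_transform_within_open[OF _ assms(1) x])
      fix y assume y: "y \<in> S"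
      have "(\<Sum>j\<in>Basis. ((?f y - v) \<bullet> j) *\<^sub>R B y j) = B y (?f y - v)"
        using linear_Basis_expansion[OF linB[OF y]] by metis
      also have "\<dots> = B y (A y u - v)"
        by (simp only: linear_Basis_expansion[OF lin[OF y], of u, symmetric])
      also have "\<dots> = B y (A y u) - B y v" by (rule linear_diff[OF linB[OF y]])
      also have "\<dots> = u - B y v" by (simp only: BA[OF y])
      finally show "u - (\<Sum>j\<in>Basis. ((?f y - v) \<bullet> j) *\<^sub>R B y j) = B y v" by simp
    qed
  qed
  moreover have "Ck_on m (\<lambda>x. D x h) S" for h
  proof -
    have "Ck_on m (\<lambda>x. (-1) *\<^sub>R (\<Sum>j\<in>Basis. ((\<Sum>i\<in>Basis. (B x v \<bullet> i) *\<^sub>R ?DA x i h) \<bullet> j) *\<^sub>R B x j)) S"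
      by (intro Ck_on_sum[OF assms(1)] Ck_on_bilinear[OF bounded_bilinear_scaleR assms(1)]
          Ck_on_bilinear[OF bounded_bilinear_inner assms(1)] B_m Ck_on_const)
         (use Suc.prems in auto)
    then show ?thesis by (simp add: D_def)
  qed
  ultimately show ?case by (rule Ck_on_SucI[OF assms(1)])
qed

text \<open>The image is open by invariance of domain. The derivative of the inverse is the inverse of the
  derivative, composed with the inverse function itself; so if the inverse is \<open>C\<^sup>m\<close>, its derivative
  is \<open>C\<^sup>m\<close> too, and the order can be raised by induction.\<close>

lemma Ck_on_inverse:
  fixes k :: "'e::euclidean_space \<Rightarrow> 'e"
  assumes "open A" "\<And>m. Ck_on m k A" "\<And>x. x \<in> A \<Longrightarrow> h (k x) = x"
    and surj: "\<And>x. x \<in> A \<Longrightarrow> surj (frechet_derivative k (at x))"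
  shows "open (k ` A)" "Ck_on m h (k ` A)"
proof -
  have cont: "continuous_on A k" using assms(2)[of 0] by simp
  have inj: "inj_on k A" using assms(3) by (metis inj_onI)
  show op: "open (k ` A)" by (rule invariance_of_domain[OF cont assms(1) inj])
  have k: "(k has_derivative frechet_derivative k (at x)) (at x)" if "x \<in> A" for x
    using assms(2)[of 1] that by (simp add: frechet_derivative_works)
  define A' where "A' x = frechet_derivative k (at x)" for x
  define B where "B x = inv (A' x)" for x
  have lin: "linear (A' x)" if "x \<in> A" for x
    using k[OF that] unfolding A'_def by (rule has_derivative_linear)
  have bij: "bij (A' x)" if "x \<in> A" for x
    using surj[OF that] linear_surjective_imp_injective[OF lin[OF that]] by (auto simp: A'_def bij_def)
  have AB: "A' x (B x v) = v" and BA: "B x (A' x v) = v" if "x \<in> A" for x v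
    using bij[OF that] by (auto simp: B_def bij_is_surj surj_f_inv_f bij_is_inj)
  have B: "Ck_on m (\<lambda>x. B x v) A" for m v
    by (rule Ck_on_inverse_family[OF assms(1) lin AB BA])
       (use assms(2)[of "Suc m"] in \<open>auto simp: A'_def\<close>)
  have h: "(h has_derivative B (h y)) (at y)" if "y \<in> k ` A" for y
  proof -
    from that obtain x where x: "x \<in> A" "y = k x" by auto
    have "A' x \<circ> B x = id" using AB[OF x(1)] by auto
    with has_derivative_inverse_strong[OF assms(1) x(1) cont assms(3) k[OF x(1)]] x assms(3)
    show ?thesis by (auto simp: A'_def)
  qed
  have hA: "h ` k ` A \<subseteq> A" using assms(3) by auto
  show "Ck_on m h (k ` A)"
  proof (induction m)
    case 0
    show ?case
      unfolding Ck_on.simps by (intro continuous_at_imp_continuous_on ballI has_derivative_continuous[OF h])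
  next
    case (Suc m)
    show ?case
      by (rule Ck_on_SucI[OF op h]) (auto intro: Ck_on_compose[OF op assms(1) hA Suc B])
  qed
qed


text \<open>The inverse function theorem, stated so that \<open>Ck_on_inverse\<close> applies on every open
  subset of the neighbourhood \<open>N\<close>; this permits shrinking \<open>N\<close> later without loss.\<close>

lemma smooth_locally_invertible:
  fixes k :: "'e::euclidean_space \<Rightarrow> 'e"
  assumes "open A" "\<And>m. Ck_on m k A" "x0 \<in> A" "surj (frechet_derivative k (at x0))"
  obtains N h where "open N" "x0 \<in> N" "N \<subseteq> A" "\<And>x. x \<in> N \<Longrightarrow> h (k x) = x"
    "\<And>x. x \<in> N \<Longrightarrow> surj (frechet_derivative k (at x))"
proof -
  have k: "(k has_derivative frechet_derivative k (at x)) (at x)" if "x \<in> A" for x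
    using assms(2)[of 1] that by (simp add: frechet_derivative_works)
  define K where "K x = Blinfun (frechet_derivative k (at x))" for x
  have K: "blinfun_apply (K x) = frechet_derivative k (at x)" if "x \<in> A" for x
    unfolding K_def by (rule bounded_linear_Blinfun_apply[OF has_derivative_bounded_linear[OF k[OF that]]])
  have cont: "continuous_on A K"
  proof (rule continuous_on_blinfun_componentwise)
    fix i :: 'e
    have "continuous_on A (\<lambda>x. frechet_derivative k (at x) i)"
      using assms(2)[of 1] by simp
    then show "continuous_on A (\<lambda>x. blinfun_apply (K x) i)"
      by (simp add: K cong: continuous_on_cong)
  qed
  have lin: "linear (frechet_derivative k (at x0))"
    by (rule has_derivative_linear[OF k[OF assms(3)]])
  obtain L where L: "linear L" "L \<circ> frechet_derivative k (at x0) = id"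
    using linear_injective_left_inverse[OF lin linear_surjective_imp_injective[OF lin assms(4)]] by blast
  have "Blinfun L o\<^sub>L K x0 = id_blinfun"
    using L by (intro blinfun_eqI)
      (simp add: K[OF assms(3)] bounded_linear_Blinfun_apply linear_conv_bounded_linear[symmetric] pointfree_idE)
  note inv = this
  have kK: "(k has_derivative blinfun_apply (K x)) (at x)" if "x \<in> A" for x
    using k[OF that] K[OF that] by simp
  show thesis
  proof (rule inverse_function_theorem[OF assms(1) kK cont assms(3) inv])
    fix U' V g g'
    assume *: "open U'" "U' \<subseteq> A" "x0 \<in> U'" "open V" "k x0 \<in> V" "homeomorphism U' V k g"
      and bij: "\<And>y. y \<in> V \<Longrightarrow> bij (blinfun_apply (K (g y)))"
    show thesis
    proof (rule that[of U' g])
      fix x assume x: "x \<in> U'"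
      show "g (k x) = x" using *(6) x by (auto simp: homeomorphism_def)
      then show "surj (frechet_derivative k (at x))"
        using bij[of "k x"] homeomorphism_image1[OF *(6)] subsetD[OF *(2) x] x K[of x]
        by (auto simp: bij_def)
    qed (use * in auto)
  qed
qed

section \<open>Smooth maps on arbitrary sets and derivatives along curves\<close>

lemma smooth_onE:
  assumes "smooth_on S f" "x \<in> S"
  obtains W F where "open W" "x \<in> W" "\<forall>m. Ck_on m F W" "\<forall>y\<in>S \<inter> W. F y = f y"
proof -
  from assms obtain W F where "open W \<and> x \<in> W \<and> (\<forall>m. Ck_on m F W) \<and> (\<forall>y\<in>S \<inter> W. F y = f y)"
    unfolding smooth_on_def by blast
  then show thesis using that by blast
qed

lemma smooth_on_if_Ck_on: "open S \<Longrightarrow> (\<And>m. Ck_on m f S) \<Longrightarrow> smooth_on S f"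
  unfolding smooth_on_def by blast

lemma Ck_on_if_smooth_on:
  assumes "open S" "smooth_on S f"
  shows "Ck_on m f S"
proof (rule Ck_on_local)
  fix x assume "x \<in> S"
  then obtain W F where W: "open W" "x \<in> W" "\<forall>m. Ck_on m F W" "\<forall>y\<in>S \<inter> W. F y = f y"
    using smooth_onE[OF assms(2)] by blast
  have "open (S \<inter> W)" using assms(1) W(1) by auto
  then have "Ck_on m f (S \<inter> W)"
    by (rule Ck_on_cong[OF _ W(4)[rule_format] Ck_on_subset[OF W(3)[rule_format]]]) auto
  with \<open>open (S \<inter> W)\<close> show "\<exists>W. open W \<and> x \<in> W \<and> Ck_on m f W"
    using \<open>x \<in> S\<close> W(2) by blast
qed

lemma smooth_on_subset:
  assumes "smooth_on S f" "T \<subseteq> S" shows "smooth_on T f"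
  unfolding smooth_on_def
proof
  fix x assume x: "x \<in> T"
  obtain W F where "open W" "x \<in> W" "\<forall>m. Ck_on m F W" "\<forall>y\<in>S \<inter> W. F y = f y"
    by (rule smooth_onE[OF assms(1) subsetD[OF assms(2) x]])
  then show "\<exists>W F. open W \<and> x \<in> W \<and> (\<forall>m. Ck_on m F W) \<and> (\<forall>y\<in>T \<inter> W. F y = f y)"
    using assms(2) by (intro exI[of _ W] exI[of _ F]) auto
qed

lemma smooth_on_cong: "smooth_on S f \<Longrightarrow> (\<And>x. x \<in> S \<Longrightarrow> f x = g x) \<Longrightarrow> smooth_on S g"
  unfolding smooth_on_def by simp

lemma smooth_on_local:
  assumes "\<And>x. x \<in> S \<Longrightarrow> \<exists>T. open T \<and> x \<in> T \<and> smooth_on (S \<inter> T) f"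
  shows "smooth_on S f"
  unfolding smooth_on_def
proof
  fix x assume x: "x \<in> S"
  obtain T where T: "open T" "x \<in> T" "smooth_on (S \<inter> T) f" using assms[OF x] by blast
  have "x \<in> S \<inter> T" using x T(2) by simp
  then obtain W F where "open W" "x \<in> W" "\<forall>m. Ck_on m F W" "\<forall>y\<in>S \<inter> T \<inter> W. F y = f y"
    by (rule smooth_onE[OF T(3)])
  then show "\<exists>W F. open W \<and> x \<in> W \<and> (\<forall>m. Ck_on m F W) \<and> (\<forall>y\<in>S \<inter> W. F y = f y)"
    using T by (intro exI[of _ "T \<inter> W"] exI[of _ F]) (auto intro: Ck_on_subset)
qed

lemma smooth_on_compose:
  assumes f: "smooth_on S f" and g: "smooth_on T g" and "f ` S \<subseteq> T"
  shows "smooth_on S (\<lambda>x. g (f x))"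
  unfolding smooth_on_def
proof
  fix x assume x: "x \<in> S"
  obtain V F where V: "open V" "x \<in> V" "\<forall>m. Ck_on m F V" "\<forall>y\<in>S \<inter> V. F y = f y"
    by (rule smooth_onE[OF f x])
  obtain W G where W: "open W" "f x \<in> W" "\<forall>m. Ck_on m G W" "\<forall>y\<in>T \<inter> W. G y = g y"
    by (rule smooth_onE[OF g subsetD[OF assms(3) imageI[OF x]]])
  have "open (V \<inter> F -` W)"
    by (rule continuous_open_preimage[OF Ck_on_continuous[OF V(3)[rule_format]] V(1) W(1)])
  moreover have "Ck_on m (\<lambda>x. G (F x)) (V \<inter> F -` W)" for m
    by (rule Ck_on_compose[OF calculation W(1) _ Ck_on_subset[OF V(3)[rule_format]] W(3)[rule_format]]) auto
  ultimately show "\<exists>W Fa. open W \<and> x \<in> W \<and> (\<forall>m. Ck_on m Fa W) \<and> (\<forall>y\<in>S \<inter> W. Fa y = g (f y))"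
    using V W x assms(3) by (intro exI[of _ "V \<inter> F -` W"] exI[of _ "\<lambda>x. G (F x)"]) auto
qed

lemma continuous_on_if_smooth_on:
  assumes "smooth_on S f" shows "continuous_on S f"
  unfolding continuous_on_eq_continuous_within
proof
  fix x assume x: "x \<in> S"
  obtain W F where W: "open W" "x \<in> W" "\<forall>m. Ck_on m F W" "\<forall>y\<in>S \<inter> W. F y = f y"
    by (rule smooth_onE[OF assms x])
  have "isCont F x"
    using Ck_on_continuous[OF W(3)[rule_format]] W(1,2) by (simp add: continuous_on_eq_continuous_at)
  then have "continuous (at x within S) F" by (rule continuous_at_imp_continuous_at_within)
  then show "continuous (at x within S) f"
    by (rule continuous_transform_within_openin[where S = "S \<inter> W"])
       (use W x in \<open>auto simp: openin_open_Int\<close>)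
qed

lemma smooth_on_if_bounded_linear: "bounded_linear f \<Longrightarrow> smooth_on S f"
  by (metis Ck_on_linear open_UNIV smooth_on_if_Ck_on smooth_on_subset subset_UNIV)

lemma smooth_on_const: "smooth_on S (\<lambda>x. c)"
  by (metis Ck_on_const open_UNIV smooth_on_if_Ck_on smooth_on_subset subset_UNIV)

lemma smooth_on_ident: "smooth_on S (\<lambda>x. x)"
  by (rule smooth_on_if_bounded_linear) (rule bounded_linear_ident)

lemma smooth_on_bilinear:
  assumes "bounded_bilinear h" "smooth_on S f" "smooth_on S g"
  shows "smooth_on S (\<lambda>x. h (f x) (g x))"
  unfolding smooth_on_def
proof
  fix x assume x: "x \<in> S"
  obtain V F where V: "open V" "x \<in> V" "\<forall>m. Ck_on m F V" "\<forall>y\<in>S \<inter> V. F y = f y"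
    by (rule smooth_onE[OF assms(2) x])
  obtain W G where W: "open W" "x \<in> W" "\<forall>m. Ck_on m G W" "\<forall>y\<in>S \<inter> W. G y = g y"
    by (rule smooth_onE[OF assms(3) x])
  have VW: "open (V \<inter> W)" using V W by auto
  have "Ck_on m (\<lambda>y. h (F y) (G y)) (V \<inter> W)" for m
    by (rule Ck_on_bilinear[OF assms(1) VW Ck_on_subset[OF V(3)[rule_format]] Ck_on_subset[OF W(3)[rule_format]]]) auto
  then show "\<exists>U H. open U \<and> x \<in> U \<and> (\<forall>m. Ck_on m H U) \<and> (\<forall>y\<in>S \<inter> U. H y = h (f y) (g y))"
    using V W VW by (intro exI[of _ "V \<inter> W"] exI[of _ "\<lambda>y. h (F y) (G y)"]) auto
qed

text \<open>A map that is smooth on an arbitrary set \<open>S\<close> has no derivative in the ambient sense, but the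
  derivative of a local extension gives a linear map that acts correctly on the velocities of
  curves that stay in \<open>S\<close>, which is all that tangent vectors need.\<close>

lemma smooth_on_curve_derivative:
  assumes "smooth_on S F" "x \<in> S"
  obtains L where "linear L"
    "\<And>c V. c 0 = x \<Longrightarrow> \<forall>\<^sub>F s in nhds (0::real). c s \<in> S \<Longrightarrow> (c has_vector_derivative V) (at 0) \<Longrightarrow>
        ((\<lambda>s. F (c s)) has_vector_derivative L V) (at 0)"
proof -
  obtain W G where W: "open W" "x \<in> W" "\<forall>m. Ck_on m G W" "\<forall>y\<in>S \<inter> W. G y = F y"
    by (rule smooth_onE[OF assms])
  define L where "L = frechet_derivative G (at x)"
  have L: "(G has_derivative L) (at x)"
    using spec[OF W(3), of 1] W(2) by (simp add: L_def frechet_derivative_works)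
  have linL: "linear L" using L by (rule has_derivative_linear)
  show thesis
  proof (rule that[OF linL])
    fix c V assume c: "c 0 = x" "\<forall>\<^sub>F s in nhds (0::real). c s \<in> S" "(c has_vector_derivative V) (at 0)"
    have "isCont c 0" using c(3) by (rule has_vector_derivative_continuous)
    then have "(c \<longlongrightarrow> c 0) (nhds 0)" by (simp add: isCont_def tendsto_at_iff_tendsto_nhds)
    then have "\<forall>\<^sub>F s in nhds 0. c s \<in> W"
      using topological_tendstoD W(1,2) c(1) by blast
    with c(2) have ev: "\<forall>\<^sub>F s in nhds 0. G (c s) = F (c s)"
      by eventually_elim (use W(4) in auto)
    have "(G \<circ> c has_derivative L \<circ> (\<lambda>s. s *\<^sub>R V)) (at 0)"
      using c(3) L c(1) unfolding has_vector_derivative_def by (intro diff_chain_at) auto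
    then have "((\<lambda>s. G (c s)) has_vector_derivative L V) (at 0)"
      using linL by (simp add: has_vector_derivative_def o_def linear_cmul)
    moreover have "\<forall>\<^sub>F s in at 0. G (c s) = F (c s)"
      using ev by (simp add: eventually_at_filter eventually_mono)
    moreover have "G (c 0) = F (c 0)" by (rule eventually_nhds_x_imp_x[OF ev])
    ultimately show "((\<lambda>s. F (c s)) has_vector_derivative L V) (at 0)"
      unfolding has_vector_derivative_def by (rule has_derivative_transform_eventually) simp
  qed
qed

lemma smooth_on_curve_has_derivative:
  assumes "smooth_on {-\<epsilon><..<\<epsilon>::real} c" "\<epsilon> > 0"
  shows "(c has_vector_derivative vector_derivative c (at 0)) (at 0)"
proof -
  have "Ck_on 1 c {-\<epsilon><..<\<epsilon>}" by (rule Ck_on_if_smooth_on[OF _ assms(1)]) simp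
  then have "c differentiable (at 0)" using assms(2) by auto
  then show ?thesis by (simp add: vector_derivative_works)
qed

lemma smooth_on_inverse:
  fixes k :: "'e::euclidean_space \<Rightarrow> 'e"
  assumes "open A" "smooth_on A k" "\<And>x. x \<in> A \<Longrightarrow> h (k x) = x"
    and "\<And>x. x \<in> A \<Longrightarrow> surj (frechet_derivative k (at x))"
  shows "open (k ` A)" "smooth_on (k ` A) h"
  using Ck_on_inverse[OF assms(1) Ck_on_if_smooth_on[OF assms(1,2)] assms(3,4)] smooth_on_if_Ck_on
  by blast+

lemma has_vector_derivative_transform_eventually:
  assumes "(c has_vector_derivative V) (at x)" "\<forall>\<^sub>F s in nhds x. c s = d s"
  shows "(d has_vector_derivative V) (at x)"
proof -
  have "\<forall>\<^sub>F s in at x. c s = d s"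
    using assms(2) by (simp add: eventually_at_filter eventually_mono)
  with assms(1) eventually_nhds_x_imp_x[OF assms(2)] show ?thesis
    unfolding has_vector_derivative_def by (intro has_derivative_transform_eventually[of c _ x UNIV d]) auto
qed

lemma curve_eventually_in:
  fixes c :: "real \<Rightarrow> 'a::euclidean_space"
  assumes "(c has_vector_derivative V) (at 0)" "\<forall>\<^sub>F s in nhds 0. c s \<in> S"
    and "openin (top_of_set S) U" "c 0 \<in> U"
  shows "\<forall>\<^sub>F s in nhds 0. c s \<in> U"
proof -
  obtain T where T: "open T" "U = S \<inter> T" using assms(3) by (auto simp: openin_open)
  have "isCont c 0" using assms(1) by (rule has_vector_derivative_continuous)
  then have "(c \<longlongrightarrow> c 0) (nhds 0)" by (simp add: isCont_def tendsto_at_iff_tendsto_nhds)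
  then have "\<forall>\<^sub>F s in nhds 0. c s \<in> T"
    using topological_tendstoD T assms(4) by blast
  with assms(2) show ?thesis by eventually_elim (simp add: T)
qed

lemma eventually_interval: "\<epsilon> > 0 \<Longrightarrow> \<forall>\<^sub>F s in nhds (0::real). s \<in> {-\<epsilon><..<\<epsilon>}"
  by (intro eventually_nhds_in_open) auto

lemma open_contains_short_segment:
  fixes y :: "'a::real_normed_vector"
  assumes "open S" "y \<in> S"
  obtains \<epsilon> where "\<epsilon> > 0" "\<And>s. s \<in> {-\<epsilon><..<\<epsilon>} \<Longrightarrow> y + s *\<^sub>R w \<in> S"
proof -
  have "open ((\<lambda>s. y + s *\<^sub>R w) -` S)"
    by (intro open_vimage assms(1) continuous_intros)
  then obtain \<epsilon> where "\<epsilon> > 0" "ball 0 \<epsilon> \<subseteq> (\<lambda>s. y + s *\<^sub>R w) -` S"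
    using assms(2) open_contains_ball[of "(\<lambda>s. y + s *\<^sub>R w) -` S"] by force
  then show thesis by (intro that[of \<epsilon>]) (auto simp: ball_def dist_norm subset_iff abs_less_iff)
qed

section \<open>Block matrices\<close>

interpretation matrix_mult: bounded_bilinear
  "(**) :: real^'n::finite^'m::finite \<Rightarrow> real^'p::finite^'n \<Rightarrow> real^'p^'m"
proof -
  have "bilinear ((**) :: real^'n^'m \<Rightarrow> real^'p^'n \<Rightarrow> real^'p^'m)"
    unfolding bilinear_def
    by (auto intro!: linearI simp: matrix_matrix_mult_def vec_eq_iff sum.distrib algebra_simps sum_distrib_left)
  then show "bounded_bilinear ((**) :: real^'n^'m \<Rightarrow> real^'p^'n \<Rightarrow> real^'p^'m)"
    by (simp add: bilinear_conv_bounded_bilinear)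
qed

lemma bounded_linear_transpose: "bounded_linear (transpose :: real^'n::finite^'m::finite \<Rightarrow> real^'m^'n)"
  by (simp add: linear_conv_bounded_linear[symmetric])
     (auto intro!: linearI simp: transpose_def vec_eq_iff)

lemma transpose_minus: "transpose (- A :: real^'n::finite^'m::finite) = - transpose A"
  and transpose_add: "transpose (A + B :: real^'n::finite^'m::finite) = transpose A + transpose B"
  and transpose_diff: "transpose (A - B :: real^'n::finite^'m::finite) = transpose A - transpose B"
  and transpose_zero: "transpose (0 :: real^'n::finite^'m::finite) = 0"
  by (simp_all add: transpose_def vec_eq_iff)

lemma mat_eq_scaleR: "(mat c :: real^'n::finite^'n) = c *\<^sub>R mat 1"
  by (simp add: mat_def vec_eq_iff)

lemma sum_UNIV_Plus:
  fixes f :: "'k::finite + 'l::finite \<Rightarrow> real"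
  shows "(\<Sum>x\<in>UNIV. f x) = (\<Sum>i\<in>UNIV. f (Inl i)) + (\<Sum>j\<in>UNIV. f (Inr j))"
  by (simp add: UNIV_Plus_UNIV[symmetric] sum.Plus del: UNIV_Plus_UNIV)

lemma block_nth [simp]:
  "block A B C D $ Inl i $ Inl j = A $ i $ j" "block A B C D $ Inl i $ Inr q = B $ i $ q"
  "block A B C D $ Inr p $ Inl j = C $ p $ j" "block A B C D $ Inr p $ Inr q = D $ p $ q"
  by (simp_all add: block_def)

lemma bmat_eq_iff:
  fixes M N :: "('k::finite, 'l::finite) bmat"
  shows "M = N \<longleftrightarrow> (\<forall>i j. M $ Inl i $ Inl j = N $ Inl i $ Inl j) \<and> (\<forall>i j. M $ Inl i $ Inr j = N $ Inl i $ Inr j) \<and>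
    (\<forall>i j. M $ Inr i $ Inl j = N $ Inr i $ Inl j) \<and> (\<forall>i j. M $ Inr i $ Inr j = N $ Inr i $ Inr j)"
proof -
  have "M = N \<longleftrightarrow> (\<forall>x y. M $ x $ y = N $ x $ y)" by (auto simp: vec_eq_iff)
  also have "\<dots> \<longleftrightarrow> (\<forall>i. (\<forall>j. M $ Inl i $ Inl j = N $ Inl i $ Inl j) \<and> (\<forall>j. M $ Inl i $ Inr j = N $ Inl i $ Inr j)) \<and>
    (\<forall>i. (\<forall>j. M $ Inr i $ Inl j = N $ Inr i $ Inl j) \<and> (\<forall>j. M $ Inr i $ Inr j = N $ Inr i $ Inr j))"
    by (simp only: split_sum_all)
  finally show ?thesis by blast
qed

lemma block_mult:
  "block A B C D ** block A' B' C' D' =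
     block (A ** A' + B ** C') (A ** B' + B ** D') (C ** A' + D ** C') (C ** B' + D ** D')"
  by (simp add: bmat_eq_iff matrix_matrix_mult_def sum_UNIV_Plus)

lemma block_transpose:
  "transpose (block A B C D) = block (transpose A) (transpose C) (transpose B) (transpose D)"
  by (simp add: bmat_eq_iff transpose_def)

lemma block_add: "block A B C D + block A' B' C' D' = block (A + A') (B + B') (C + C') (D + D')"
  and block_diff: "block A B C D - block A' B' C' D' = block (A - A') (B - B') (C - C') (D - D')"
  and block_minus: "- block A B C D = block (- A) (- B) (- C) (- D)"
  and block_scaleR: "c *\<^sub>R block A B C D = block (c *\<^sub>R A) (c *\<^sub>R B) (c *\<^sub>R C) (c *\<^sub>R D)"
  by (simp_all add: bmat_eq_iff)

lemma mat_eq_block: "mat c = block (mat c) 0 0 (mat c)"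
  by (simp add: bmat_eq_iff mat_def)

lemma block_eq_iff: "block A B C D = block A' B' C' D' \<longleftrightarrow> A = A' \<and> B = B' \<and> C = C' \<and> D = D'"
  by (simp add: bmat_eq_iff vec_eq_iff)

lemma block_exhaust: obtains A B C D where "M = block A B C D"
proof
  show "M = block (\<chi> i j. M $ Inl i $ Inl j) (\<chi> i j. M $ Inl i $ Inr j)
     (\<chi> i j. M $ Inr i $ Inl j) (\<chi> i j. M $ Inr i $ Inr j)"
    by (simp add: bmat_eq_iff)
qed

lemma trace_block: "trace (block A B C D) = trace A + trace D"
  by (simp add: trace_def sum_UNIV_Plus)

text \<open>Outside the range of \<open>f\<close> the rows of \<open>M\<close> are rows of the identity, so in the Leibniz formula only
  permutations that fix those indices survive, and these correspond to permutations of the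
  smaller index type with the same sign.\<close>

lemma det_extend_by_identity:
  fixes A :: "real^'k::finite^'k" and M :: "real^'n::finite^'n" and f :: "'k \<Rightarrow> 'n"
  assumes "inj f" and MA: "\<And>i j. M $ f i $ f j = A $ i $ j"
    and M1: "\<And>x y. x \<notin> range f \<Longrightarrow> M $ x $ y = (if x = y then 1 else 0)"
  shows "det M = det A"
proof -
  let ?term = "\<lambda>p. of_int (sign p) * (\<Prod>x\<in>UNIV. M $ x $ p x)"
  let ?m = "map_permutation UNIV f"
  have sub: "{p. p permutes range f} \<subseteq> {p. p permutes UNIV}"
    using permutes_subset by blast
  have zero: "?term p = 0" if p: "p permutes UNIV" "\<not> p permutes range f" for p
  proof -
    obtain x where "x \<notin> range f" "p x \<noteq> x"
      using p unfolding permutes_def by blast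
    then have "M $ x $ p x = 0" using M1 by auto
    then show ?thesis by (auto intro!: prod_zero)
  qed
  have "det M = sum ?term {p. p permutes UNIV}" by (simp add: det_def)
  also have "\<dots> = sum ?term {p. p permutes range f}"
    by (rule sum.mono_neutral_right) (use sub zero in auto)
  also have "\<dots> = (\<Sum>q\<in>{q. q permutes (UNIV::'k set)}. ?term (?m q))"
  proof (rule sum.reindex_bij_witness[symmetric, where i = "map_permutation (range f) (inv f)" and j = ?m])
    fix q :: "'k \<Rightarrow> 'k" assume "q \<in> {q. q permutes UNIV}"
    then have q: "q permutes UNIV" by simp
    show "map_permutation (range f) (inv f) (?m q) = q"
      using map_permutation_compose[of f UNIV "range f" "inv f" q] q assms(1)
      by (simp add: inj_on_imp_bij_betw inj_on_inv_into)
    show "?m q \<in> {p. p permutes range f}"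
      using map_permutation_permutes[OF _ q, of f "range f"] assms(1) by (simp add: inj_on_imp_bij_betw)
  next
    fix p assume "p \<in> {p. p permutes range f}"
    then have p: "p permutes range f" by simp
    have bij: "bij_betw (inv f) (range f) UNIV"
      using assms(1) by (simp add: bij_betw_inv_into inj_on_imp_bij_betw)
    show "map_permutation (range f) (inv f) p \<in> {q. q permutes UNIV}"
      using map_permutation_permutes[OF bij p] by simp
    show "?m (map_permutation (range f) (inv f) p) = p"
      using map_permutation_compose[OF bij assms(1), of p]
        map_permutation_cong_strong[where A = "range f" and B = "range f" and f = "f \<circ> inv f"
            and g = "\<lambda>x. x" and p = p and q = p] p
      by (auto simp: permutes_image f_inv_into_f inj_on_def)
  qed auto
  also have "\<dots> = (\<Sum>q\<in>{q. q permutes (UNIV::'k set)}. of_int (sign q) * (\<Prod>i\<in>UNIV. A $ i $ q i))"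
  proof (rule sum.cong)
    fix q :: "'k \<Rightarrow> 'k" assume "q \<in> {q. q permutes UNIV}"
    then have q: "q permutes UNIV" by simp
    have fix': "?m q x = x" if "x \<notin> range f" for x
      using that map_permutation_permutes[OF _ q, of f "range f"] assms(1)
      by (auto simp: inj_on_imp_bij_betw permutes_def)
    have "(\<Prod>x\<in>UNIV. M $ x $ ?m q x) = (\<Prod>x\<in>range f. M $ x $ ?m q x)"
      by (rule prod.mono_neutral_right) (auto simp: fix' M1)
    also have "\<dots> = (\<Prod>i\<in>UNIV. M $ f i $ ?m q (f i))"
      using assms(1) by (simp add: prod.reindex)
    also have "\<dots> = (\<Prod>i\<in>UNIV. A $ i $ q i)"
      using assms(1) by (simp add: map_permutation_apply MA)
    finally show "?term (?m q) = of_int (sign q) * (\<Prod>i\<in>UNIV. A $ i $ q i)"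
      using sign_map_permutation[OF assms(1) q] by simp
  qed simp
  finally show ?thesis by (simp add: det_def)
qed

lemma det_block_diagonal:
  fixes A :: "real^'k::finite^'k" and D :: "real^'l::finite^'l"
  shows "det (block A 0 0 D) = det A * det D"
proof -
  have "block A 0 0 D = block A 0 0 (mat 1) ** block (mat 1) 0 0 D"
    by (simp add: block_mult)
  moreover have "det (block A 0 0 (mat 1 :: real^'l^'l)) = det A"
  proof (rule det_extend_by_identity[of Inl])
    fix x y :: "'k + 'l" assume "x \<notin> range Inl"
    then show "block A 0 0 (mat 1 :: real^'l^'l) $ x $ y = (if x = y then 1 else 0)"
      by (cases x; cases y) (auto simp: mat_def)
  qed simp_all
  moreover have "det (block (mat 1 :: real^'k^'k) 0 0 D) = det D"
  proof (rule det_extend_by_identity[of Inr])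
    fix x y :: "'k + 'l" assume "x \<notin> range Inr"
    then show "block (mat 1 :: real^'k^'k) 0 0 D $ x $ y = (if x = y then 1 else 0)"
      by (cases x; cases y) (auto simp: mat_def)
  qed simp_all
  ultimately show ?thesis by (simp add: det_mul)
qed

section \<open>The Cayley transform and the orbit map\<close>

text \<open>The Cayley transform replaces the matrix exponential as a parametrization of rotations: it is a
  rational function, so its smooth dependence on a matrix variable only needs matrix inversion.\<close>

definition cayley :: "real^'n::finite^'n \<Rightarrow> real^'n^'n" where
  "cayley S = (mat 1 + S) ** matrix_inv (mat 1 - S)"

text \<open>The linear parametrization of \<open>m_space\<close>, the complement of the Lie algebra of the block diagonal
  rotations.\<close>

definition offdiag :: "real^'l::finite^'k::finite \<Rightarrow> ('k, 'l) bmat" where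
  "offdiag T = block 0 T (- transpose T) 0"

text \<open>The derivative of \<open>orbit_map\<close> at the identity in the direction \<open>offdiag h\<close> has \<open>(b - a) h\<close> as its upper
  right block, which is why this block is a coordinate near the base point of the quadratic model.\<close>

definition upper_right :: "('k::finite, 'l::finite) bmat \<Rightarrow> real^'l^'k" where
  "upper_right X = (\<chi> i j. X $ Inl i $ Inr j)"

abbreviation (input) two_scalars :: "real \<Rightarrow> real \<Rightarrow> ('k::finite, 'l::finite) bmat" where
  "two_scalars a b \<equiv> block (mat a) 0 0 (mat b)"

definition orbit_map :: "real \<Rightarrow> real \<Rightarrow> ('k::finite, 'l::finite) bmat \<Rightarrow> ('k, 'l) bmat" where
  "orbit_map a b Q = Q ** two_scalars a b ** transpose Q"

lemma matrix_inv_inverse: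
  fixes A :: "real^'n::finite^'n"
  assumes "invertible A"
  shows "A ** matrix_inv A = mat 1" "matrix_inv A ** A = mat 1"
  using someI_ex[OF assms[unfolded invertible_def]] by (simp_all add: matrix_inv_def)

text \<open>If \<open>S x = x\<close> then \<open>|x|\<^sup>2 = x \<bullet> S x\<close>, which vanishes for a skew-symmetric \<open>S\<close>.\<close>

lemma invertible_one_minus_skew:
  fixes S :: "real^'n::finite^'n"
  assumes "transpose S = - S"
  shows "invertible (mat 1 - S)"
proof -
  have "x = 0" if "(mat 1 - S) *v x = 0" for x
  proof -
    have x: "x = S *v x" using that by (simp add: matrix_vector_mult_diff_rdistrib)
    have "x \<bullet> (S *v x) = (transpose S *v x) \<bullet> x"
      by (metis dot_lmul_matrix transpose_matrix_vector)
    also have "\<dots> = - (x \<bullet> (S *v x))"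
      unfolding assms by (simp add: inner_commute matrix_vector_mult_def vec_eq_iff inner_vec_def sum_negf)
    finally have "x \<bullet> (S *v x) = 0" by simp
    with x show "x = 0" by (metis inner_eq_zero_iff)
  qed
  then show ?thesis
    by (simp add: invertible_left_inverse matrix_left_invertible_ker)
qed

lemma cayley_mult:
  assumes "transpose S = - S"
  shows "cayley S ** (mat 1 - S) = mat 1 + S"
  using invertible_one_minus_skew[OF assms]
  by (simp add: cayley_def matrix_mul_assoc[symmetric] matrix_inv_inverse)

text \<open>Orthogonality holds since \<open>1 + S\<close> and \<open>1 - S\<close> commute and are transposes of each other; the latter
  also makes their determinants equal, so the determinant of the quotient is \<open>1\<close>.\<close>

lemma cayley_in_SO:
  fixes S :: "real^'n::finite^'n"
  assumes "transpose S = - S"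
  shows "cayley S \<in> SO"
proof -
  let ?I = "matrix_inv (mat 1 - S)"
  have I: "(mat 1 - S) ** ?I = mat 1"
    using invertible_one_minus_skew[OF assms] by (rule matrix_inv_inverse)
  have tr: "transpose (mat 1 + S) = mat 1 - S" "transpose (mat 1 - S) = mat 1 + S"
    using assms by (simp_all add: transpose_add transpose_diff)
  have comm: "(mat 1 - S) ** (mat 1 + S) = (mat 1 + S) ** (mat 1 - S)"
    by (simp add: matrix_mult.add_left matrix_mult.add_right matrix_mult.diff_left matrix_mult.diff_right)
  have "transpose (cayley S) ** cayley S = transpose ?I ** ((mat 1 - S) ** (mat 1 + S)) ** ?I"
    by (simp add: cayley_def matrix_transpose_mul tr matrix_mul_assoc)
  also have "\<dots> = transpose ?I ** (mat 1 + S) ** ((mat 1 - S) ** ?I)"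
    unfolding comm by (simp add: matrix_mul_assoc)
  also have "\<dots> = mat 1"
    using arg_cong[OF I, of transpose] unfolding matrix_transpose_mul tr transpose_mat
    by (simp only: I matrix_mul_rid)
  finally have "orthogonal_matrix (cayley S)"
    by (simp add: orthogonal_matrix)
  moreover have "det (mat 1 + S) = det (mat 1 - S)"
    by (metis det_transpose tr(1))
  then have "det (cayley S) = 1"
    unfolding cayley_def det_mul using I by (metis det_I det_mul)
  ultimately show ?thesis by (simp add: SO_def rotation_matrix_def)
qed

lemma cayley_zero [simp]: "cayley 0 = mat 1"
  using cayley_mult[of 0] by (simp add: transpose_zero)

lemma offdiag_skew: "transpose (offdiag T) = - offdiag T"
  by (simp add: offdiag_def block_transpose block_minus transpose_minus transpose_zero)

lemma bounded_linear_offdiag: "bounded_linear offdiag"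
  by (simp add: linear_conv_bounded_linear[symmetric])
     (auto intro!: linearI simp: offdiag_def block_add block_scaleR transpose_add transpose_scalar)

lemma offdiag_zero [simp]: "offdiag 0 = 0"
  using bounded_linear.linear[OF bounded_linear_offdiag] linear_0 by blast

lemma bounded_linear_upper_right: "bounded_linear upper_right"
  by (simp add: linear_conv_bounded_linear[symmetric])
     (auto intro!: linearI simp: upper_right_def vec_eq_iff)

lemma upper_right_block [simp]: "upper_right (block A B C D) = B"
  by (simp add: upper_right_def vec_eq_iff)

lemma smooth_on_cayley_offdiag:
  "smooth_on S (\<lambda>t. cayley (offdiag t) :: ('k::finite, 'l::finite) bmat)"
proof -
  have inv: "invertible (mat 1 - offdiag t)" for t :: "real^'l^'k"
    by (rule invertible_one_minus_skew[OF offdiag_skew])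
  have lin: "linear ((**) (mat 1 - offdiag t))" for t :: "real^'l^'k"
    by (rule bounded_linear.linear[OF matrix_mult.bounded_linear_right])
  have "Ck_on m (\<lambda>t. (mat 1 - offdiag t) ** V) UNIV" for m and V :: "('k, 'l) bmat"
  proof -
    have "Ck_on m (\<lambda>t. V + (- (offdiag t ** V))) UNIV"
      by (intro Ck_on_add Ck_on_const Ck_on_linear open_UNIV bounded_linear_minus
          bounded_linear_compose[OF matrix_mult.bounded_linear_left bounded_linear_offdiag])
    then show ?thesis by (simp add: matrix_mult.diff_left)
  qed
  then have inv_smooth: "Ck_on m (\<lambda>t. matrix_inv (mat 1 - offdiag t) ** V) UNIV" for m and V :: "('k, 'l) bmat"
    by (rule Ck_on_inverse_family[OF open_UNIV lin, rotated 2])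
       (simp_all add: matrix_mul_assoc matrix_inv_inverse inv)
  from inv_smooth[of _ "mat 1"]
  have "smooth_on UNIV (\<lambda>t. matrix_inv (mat 1 - offdiag t :: ('k, 'l) bmat))"
    by (intro smooth_on_if_Ck_on) auto
  moreover have "smooth_on UNIV (\<lambda>t. mat 1 + offdiag t :: ('k, 'l) bmat)"
    by (intro smooth_on_if_Ck_on Ck_on_add Ck_on_const Ck_on_linear open_UNIV bounded_linear_offdiag)
  ultimately have "smooth_on UNIV (\<lambda>t. cayley (offdiag t :: ('k, 'l) bmat))"
    unfolding cayley_def by (intro smooth_on_bilinear[OF matrix_mult.bounded_bilinear_axioms])
  then show ?thesis by (rule smooth_on_subset) simp
qed

text \<open>Differentiate the identity \<open>cay(S) (1 - S) = 1 + S\<close> at \<open>S = 0\<close>.\<close>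

lemma cayley_offdiag_has_derivative:
  "((\<lambda>t. cayley (offdiag t) :: ('k::finite, 'l::finite) bmat) has_derivative (\<lambda>h. 2 *\<^sub>R offdiag h)) (at 0)"
proof -
  let ?C = "\<lambda>t. cayley (offdiag t :: ('k, 'l) bmat)"
  have "Ck_on 1 ?C UNIV"
    by (rule Ck_on_if_smooth_on[OF open_UNIV smooth_on_cayley_offdiag])
  then obtain C' where C': "(?C has_derivative C') (at 0)"
    by (auto simp: differentiable_def)
  have o: "(offdiag has_derivative offdiag) (at 0)"
    by (rule bounded_linear_imp_has_derivative[OF bounded_linear_offdiag])
  have "((\<lambda>t. ?C t ** (mat 1 - offdiag t)) has_derivative (\<lambda>h. ?C 0 ** (0 - offdiag h) + C' h ** (mat 1 - offdiag 0))) (at 0)"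
    by (intro matrix_mult.FDERIV C' has_derivative_diff has_derivative_const o)
  moreover have "((\<lambda>t. mat 1 + offdiag t) has_derivative (\<lambda>h. 0 + offdiag h)) (at 0)"
    by (intro has_derivative_add has_derivative_const o)
  ultimately have "(\<lambda>h. ?C 0 ** (0 - offdiag h) + C' h ** (mat 1 - offdiag 0)) = (\<lambda>h. 0 + offdiag h)"
    by (intro has_derivative_unique) (simp_all add: cayley_mult offdiag_skew)
  then have "C' h = 2 *\<^sub>R offdiag h" for h
    by (simp add: fun_eq_iff scaleR_2)
  then have "C' = (\<lambda>h. 2 *\<^sub>R offdiag h)" by blast
  then show ?thesis using C' by simp
qed


lemma orbit_map_mult: "orbit_map a b (P ** Q) = P ** orbit_map a b Q ** transpose P"
  by (simp add: orbit_map_def matrix_transpose_mul matrix_mul_assoc)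

lemma smooth_on_orbit_map: "smooth_on S (orbit_map a b)"
  unfolding orbit_map_def
  by (intro smooth_on_bilinear[OF matrix_mult.bounded_bilinear_axioms]
      smooth_on_ident smooth_on_const smooth_on_if_bounded_linear bounded_linear_transpose)

lemma orbit_map_has_derivative_at_one:
  "(orbit_map a b has_derivative (\<lambda>H. H ** two_scalars a b + two_scalars a b ** transpose H)) (at (mat 1))"
proof -
  have t: "((transpose :: ('k::finite, 'l::finite) bmat \<Rightarrow> _) has_derivative transpose) (at (mat 1))"
    by (rule bounded_linear_imp_has_derivative[OF bounded_linear_transpose])
  have "((\<lambda>Q. Q ** two_scalars a b ** transpose Q) has_derivative
    (\<lambda>H. mat 1 ** two_scalars a b ** transpose H + (mat 1 ** 0 + H ** two_scalars a b) ** transpose (mat 1))) (at (mat 1))"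
    by (intro matrix_mult.FDERIV has_derivative_ident has_derivative_const t)
  then show ?thesis by (simp add: orbit_map_def[abs_def] add.commute)
qed

lemma offdiag_commutator:
  "offdiag h ** two_scalars a b - two_scalars a b ** offdiag h = (b - a) *\<^sub>R block 0 h (transpose h) 0"
  by (simp add: offdiag_def block_mult block_diff block_scaleR mat_eq_scaleR[of a] mat_eq_scaleR[of b]
      matrix_mult.scaleR_left matrix_mult.scaleR_right algebra_simps)

lemma orbit_curve_derivative:
  assumes "c 0 = mat 1" "(c has_vector_derivative S) (at 0)" "transpose S = - S"
  shows "((\<lambda>s. orbit_map a b (Q ** c s)) has_vector_derivative
    Q ** (S ** two_scalars a b - two_scalars a b ** S) ** transpose Q) (at 0)"
proof -
  have "(orbit_map a b \<circ> c has_derivative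
      (\<lambda>H. H ** two_scalars a b + two_scalars a b ** transpose H) \<circ> (\<lambda>s. s *\<^sub>R S)) (at 0)"
    using assms(1,2) orbit_map_has_derivative_at_one[of a b]
    unfolding has_vector_derivative_def by (intro diff_chain_at) auto
  then have "((\<lambda>s. orbit_map a b (c s)) has_derivative
      (\<lambda>s. s *\<^sub>R (S ** two_scalars a b - two_scalars a b ** S))) (at 0)"
    by (simp add: o_def transpose_scalar assms(3) matrix_mult.scaleR_left matrix_mult.scaleR_right
        matrix_mult.minus_right scaleR_diff_right)
  then have "((\<lambda>s. Q ** orbit_map a b (c s) ** transpose Q) has_derivative
      (\<lambda>s. Q ** (s *\<^sub>R (S ** two_scalars a b - two_scalars a b ** S)) ** transpose Q)) (at 0)"
    by (intro bounded_linear.has_derivative[OF matrix_mult.bounded_linear_left]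
        bounded_linear.has_derivative[OF matrix_mult.bounded_linear_right])
  then show ?thesis
    by (simp add: has_vector_derivative_def orbit_map_mult matrix_mult.scaleR_left matrix_mult.scaleR_right)
qed

section \<open>Charts of the quadratic model with lifts to the rotation group\<close>

lemma SO_mult: "P \<in> SO \<Longrightarrow> Q \<in> SO \<Longrightarrow> P ** Q \<in> SO"
  by (simp add: SO_def rotation_matrix_def orthogonal_matrix_mul det_mul)

lemma SO_transpose: "Q \<in> SO \<Longrightarrow> transpose Q \<in> SO"
  by (simp add: SO_def rotation_matrix_def)

lemma SO_transpose_mult: "Q \<in> SO \<Longrightarrow> transpose Q ** Q = mat 1" "Q \<in> SO \<Longrightarrow> Q ** transpose Q = mat 1"
  by (simp_all add: SO_def rotation_matrix_def orthogonal_matrix_def)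

lemma one_in_SO: "mat 1 \<in> SO"
  by (simp add: SO_def rotation_matrix_def orthogonal_matrix_id)

lemma Gr_eq_orbit: "Gr a b = orbit_map a b ` SO"
  by (auto simp: Gr_def orbit_map_def)

lemma Gr_conj: "Q \<in> SO \<Longrightarrow> X \<in> Gr a b \<Longrightarrow> Q ** X ** transpose Q \<in> Gr a b"
  unfolding Gr_eq_orbit using SO_mult orbit_map_mult by (metis (no_types, lifting) image_iff)

lemma Gr_symmetric: "X \<in> Gr a b \<Longrightarrow> transpose X = X"
  by (auto simp: Gr_def matrix_transpose_mul block_transpose matrix_mul_assoc transpose_zero)

text \<open>The matrices in the quadratic model are conjugate to \<open>D\<close>, which is annihilated by the polynomial
  \<open>(X - a)(X - b)\<close>.\<close>

lemma Gr_square: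
  assumes "X \<in> Gr a b"
  shows "X ** X = (a + b) *\<^sub>R X - (a * b) *\<^sub>R mat 1"
proof -
  obtain Q where Q: "Q \<in> SO" "X = Q ** two_scalars a b ** transpose Q"
    using assms by (auto simp: Gr_def)
  have D: "two_scalars a b ** two_scalars a b = (a + b) *\<^sub>R two_scalars a b - (a * b) *\<^sub>R mat 1"
    by (simp add: mat_eq_block[of 1] block_mult block_scaleR block_diff mat_eq_scaleR[of a] mat_eq_scaleR[of b]
        matrix_mult.scaleR_left matrix_mult.scaleR_right algebra_simps)
  have "X ** X = Q ** two_scalars a b ** (transpose Q ** Q) ** two_scalars a b ** transpose Q"
    by (simp add: Q(2) matrix_mul_assoc)
  also have "\<dots> = Q ** (two_scalars a b ** two_scalars a b) ** transpose Q"
    by (simp add: SO_transpose_mult Q(1) matrix_mul_assoc)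
  also have "\<dots> = (a + b) *\<^sub>R X - (a * b) *\<^sub>R (Q ** transpose Q)"
    unfolding D by (simp add: Q(2) matrix_mult.diff_left matrix_mult.diff_right
        matrix_mult.scaleR_left matrix_mult.scaleR_right)
  finally show ?thesis by (simp add: SO_transpose_mult Q(1))
qed

text \<open>Let \<open>X\<close> and \<open>Y\<close> lie in the quadratic model and have the same upper right block. By symmetry
  \<open>\<Delta> = X - Y\<close> is block diagonal, and subtracting the quadratic equations of \<open>X\<close> and \<open>Y\<close> gives
  \<open>X \<Delta> + \<Delta> Y = (a + b) \<Delta>\<close>. On block diagonal matrices \<open>\<Delta> \<mapsto> D \<Delta> + \<Delta> D - (a + b) \<Delta>\<close> multiplies the
  two blocks by \<open>a - b\<close> and \<open>b - a\<close>, hence is invertible, while replacing \<open>D\<close> by \<open>X\<close> and \<open>Y\<close>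
  perturbs it only slightly. So \<open>\<Delta> = 0\<close> if both matrices are near \<open>D\<close>.\<close>

lemma Gr_determined_by_upper_right:
  assumes "a \<noteq> b"
  obtains r where "r > 0"
    "\<And>X Y. X \<in> Gr a b \<Longrightarrow> Y \<in> Gr a b \<Longrightarrow> dist X (two_scalars a b) < r \<Longrightarrow> dist Y (two_scalars a b) < r \<Longrightarrow>
       upper_right X = upper_right Y \<Longrightarrow> X = (Y :: ('k::finite, 'l::finite) bmat)"
proof -
  let ?D = "two_scalars a b :: ('k, 'l) bmat"
  \<comment> \<open>Left multiplication by \<open>J\<close> turns the factors \<open>a - b\<close> and \<open>b - a\<close> of the two blocks into one common
    factor, so that norms can be compared.\<close>
  let ?J = "block (mat 1) 0 0 (- mat 1) :: ('k, 'l) bmat"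
  obtain K where K: "K > 0" "\<And>(A :: ('k, 'l) bmat) (B :: ('k, 'l) bmat). norm (A ** B) \<le> norm A * norm B * K"
    using matrix_mult.pos_bounded by blast
  define M where "M = norm ?J * K * K + 1"
  have M: "M > 0" "norm ?J * K * K \<le> M" using K(1) by (auto simp: M_def add_nonneg_pos)
  \<comment> \<open>With \<open>M\<close> bounding the norm of \<open>J\<close> and of two matrix products, \<open>2 r M = |a - b|\<close> is exactly what the
    perturbation estimate at the end tolerates.\<close>
  define r where "r = \<bar>a - b\<bar> / (2 * M)"
  have r: "r > 0" using M assms by (simp add: r_def)
  have "X = Y" if X: "X \<in> Gr a b" and Y: "Y \<in> Gr a b" and dX: "dist X ?D < r" and dY: "dist Y ?D < r"
    and ur: "upper_right X = upper_right Y" for X Y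
  proof -
    obtain X1 B X3 X2 where Xb: "X = block X1 B X3 X2" by (rule block_exhaust)
    obtain Y1 B' Y3 Y2 where Yb: "Y = block Y1 B' Y3 Y2" by (rule block_exhaust)
    have "X3 = transpose B" "Y3 = transpose B'" "B' = B"
      using Gr_symmetric[OF X] Gr_symmetric[OF Y] ur
      by (auto simp: Xb Yb block_transpose block_eq_iff)
    then have \<Delta>: "X - Y = block (X1 - Y1) 0 0 (X2 - Y2)"
      by (simp add: Xb Yb block_diff)
    let ?\<Delta> = "X - Y"
    have "X ** ?\<Delta> + ?\<Delta> ** Y = (a + b) *\<^sub>R ?\<Delta>"
      using Gr_square[OF X] Gr_square[OF Y]
      by (simp add: matrix_mult.diff_left matrix_mult.diff_right scaleR_diff_right)
    then have "(X - ?D) ** ?\<Delta> + ?\<Delta> ** (Y - ?D) = (a + b) *\<^sub>R ?\<Delta> - ?D ** ?\<Delta> - ?\<Delta> ** ?D"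
      by (simp add: matrix_mult.diff_left matrix_mult.diff_right algebra_simps)
    then have "?J ** ((X - ?D) ** ?\<Delta> + ?\<Delta> ** (Y - ?D)) = ?J ** ((a + b) *\<^sub>R ?\<Delta> - ?D ** ?\<Delta> - ?\<Delta> ** ?D)"
      by simp
    also have "\<dots> = (b - a) *\<^sub>R ?\<Delta>"
      unfolding \<Delta> by (simp add: block_mult block_diff block_scaleR mat_eq_scaleR[of a] mat_eq_scaleR[of b]
        matrix_mult.scaleR_left matrix_mult.scaleR_right matrix_mult.minus_left algebra_simps)
    finally have "\<bar>a - b\<bar> * norm ?\<Delta> = norm (?J ** ((X - ?D) ** ?\<Delta> + ?\<Delta> ** (Y - ?D)))"
      by (simp add: abs_minus_commute)
    also have "\<dots> \<le> norm ?J * norm ((X - ?D) ** ?\<Delta> + ?\<Delta> ** (Y - ?D)) * K" by (rule K(2))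
    also have "\<dots> \<le> norm ?J * ((norm (X - ?D) + norm (Y - ?D)) * norm ?\<Delta> * K) * K"
    proof -
      have "norm ((X - ?D) ** ?\<Delta> + ?\<Delta> ** (Y - ?D)) \<le> norm ((X - ?D) ** ?\<Delta>) + norm (?\<Delta> ** (Y - ?D))"
        by (rule norm_triangle_ineq)
      also have "\<dots> \<le> (norm (X - ?D) + norm (Y - ?D)) * norm ?\<Delta> * K"
        using K(2)[of "X - ?D" ?\<Delta>] K(2)[of ?\<Delta> "Y - ?D"] by (simp add: algebra_simps)
      finally show ?thesis using K(1) by (intro mult_right_mono mult_left_mono) auto
    qed
    also have "\<dots> = (norm ?J * K * K) * ((norm (X - ?D) + norm (Y - ?D)) * norm ?\<Delta>)" by simp
    also have "\<dots> \<le> M * ((norm (X - ?D) + norm (Y - ?D)) * norm ?\<Delta>)"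
      using M by (intro mult_right_mono) auto
    finally have le: "\<bar>a - b\<bar> * norm ?\<Delta> \<le> M * ((norm (X - ?D) + norm (Y - ?D)) * norm ?\<Delta>)" .
    show "X = Y"
    proof (rule ccontr)
      assume "X \<noteq> Y"
      then have "norm ?\<Delta> > 0" by simp
      with le have "\<bar>a - b\<bar> \<le> M * (norm (X - ?D) + norm (Y - ?D))"
        by (simp add: mult.assoc[symmetric])
      also have "\<dots> < M * (r + r)"
        using dX dY M(1) by (intro mult_strict_left_mono add_strict_mono) (auto simp: dist_norm)
      also have "\<dots> = \<bar>a - b\<bar>" using M(1) by (simp add: r_def field_simps)
      finally show False by simp
    qed
  qed
  with r that show thesis by blast
qed

text \<open>The map \<open>T \<mapsto> upper_right (f(cay(S(T))))\<close> is locally invertible at \<open>0\<close> with smooth inverse \<open>\<tau>\<close>. For \<open>X\<close>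
  near the base point, \<open>X\<close> and \<open>f(cay(S(\<tau>(upper_right X))))\<close> have the same upper right block, so they
  are equal. Hence the block is a coordinate on \<open>U\<close>, and \<open>\<tau>\<close> provides a lift to rotations.\<close>

lemma Gr_base_section:
  assumes "a \<noteq> b"
  obtains U :: "('k::finite, 'l::finite) bmat set" and \<tau> where
    "openin (top_of_set (Gr a b)) U" "two_scalars a b \<in> U" "open (upper_right ` U)"
    "smooth_on (upper_right ` U) \<tau>" "\<tau> 0 = 0"
    "\<forall>X\<in>U. orbit_map a b (cayley (offdiag (\<tau> (upper_right X)))) = X"
proof -
  let ?D = "two_scalars a b :: ('k, 'l) bmat"
  let ?f = "\<lambda>t. orbit_map a b (cayley (offdiag t)) :: ('k, 'l) bmat"
  let ?k = "\<lambda>t. upper_right (?f t)"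
  obtain r where r: "r > 0"
    "\<And>X Y. X \<in> Gr a b \<Longrightarrow> Y \<in> Gr a b \<Longrightarrow> dist X ?D < r \<Longrightarrow> dist Y ?D < r \<Longrightarrow>
       upper_right X = upper_right Y \<Longrightarrow> X = Y"
    using Gr_determined_by_upper_right[OF assms] by blast
  have f0: "?f 0 = ?D" by (simp add: orbit_map_def)
  have f_Gr: "?f t \<in> Gr a b" for t
    by (simp add: Gr_eq_orbit cayley_in_SO offdiag_skew)
  have f_smooth: "smooth_on UNIV ?f"
    by (rule smooth_on_compose[OF smooth_on_cayley_offdiag smooth_on_orbit_map[of UNIV]]) simp
  have k_smooth: "smooth_on UNIV ?k"
    by (rule smooth_on_compose[OF f_smooth smooth_on_if_bounded_linear[OF bounded_linear_upper_right, of UNIV]]) simp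
  have k': "(?k has_derivative (\<lambda>h. (2 * (b - a)) *\<^sub>R h)) (at 0)"
  proof -
    have "(orbit_map a b \<circ> (\<lambda>t. cayley (offdiag t)) has_derivative
        (\<lambda>H. H ** ?D + ?D ** transpose H) \<circ> (\<lambda>h. 2 *\<^sub>R offdiag h)) (at 0)"
      using orbit_map_has_derivative_at_one[of a b] by (intro diff_chain_at cayley_offdiag_has_derivative) simp
    moreover have "(\<lambda>H. H ** ?D + ?D ** transpose H) \<circ> (\<lambda>h. 2 *\<^sub>R offdiag h)
        = (\<lambda>h. 2 *\<^sub>R (offdiag h ** ?D - ?D ** offdiag h))"
      by (simp add: o_def fun_eq_iff transpose_scalar offdiag_skew matrix_mult.scaleR_left
          matrix_mult.scaleR_right matrix_mult.minus_right scaleR_diff_right)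
    ultimately have "(?f has_derivative (\<lambda>h. (2 * (b - a)) *\<^sub>R block 0 h (transpose h) 0)) (at 0)"
      by (simp add: o_def offdiag_commutator)
    from bounded_linear.has_derivative[OF bounded_linear_upper_right this]
    show ?thesis by (simp add: linear_cmul[OF bounded_linear.linear[OF bounded_linear_upper_right]])
  qed
  have "surj (\<lambda>h :: real^'l^'k. (2 * (b - a)) *\<^sub>R h)"
    by (rule surjI[of _ "\<lambda>h. inverse (2 * (b - a)) *\<^sub>R h"]) (use assms in simp)
  then have surj: "surj (frechet_derivative ?k (at 0))"
    using frechet_derivative_at[OF k'] by simp
  obtain N h where N: "open N" "0 \<in> N" "\<And>t. t \<in> N \<Longrightarrow> h (?k t) = t"
    "\<And>t. t \<in> N \<Longrightarrow> surj (frechet_derivative ?k (at t))"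
    by (rule smooth_locally_invertible[OF open_UNIV Ck_on_if_smooth_on[OF open_UNIV k_smooth] UNIV_I surj]) blast
  \<comment> \<open>Shrink \<open>N\<close> so that the parametrized matrices stay where the upper right block determines them.\<close>
  define N' where "N' = N \<inter> ?f -` ball ?D r"
  have "open (?f -` ball ?D r)"
    using continuous_open_preimage[OF continuous_on_if_smooth_on[OF f_smooth] open_UNIV open_ball] by simp
  then have N': "open N'" "0 \<in> N'"
    using N(1,2) r(1) f0 by (auto simp: N'_def)
  have inv: "open (?k ` N')" "smooth_on (?k ` N') h"
    using smooth_on_inverse[OF N'(1) smooth_on_subset[OF k_smooth subset_UNIV], of h] N(3,4)
    by (auto simp: N'_def)
  define U where "U = {X \<in> Gr a b. X \<in> ball ?D r \<inter> upper_right -` (?k ` N')}"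
  have "open (upper_right -` (?k ` N') :: ('k, 'l) bmat set)"
    using continuous_open_preimage[OF linear_continuous_on[OF bounded_linear_upper_right] open_UNIV inv(1)] by simp
  then have "openin (top_of_set (Gr a b)) U"
    unfolding U_def by (auto simp: openin_open Int_def intro!: exI[of _ "ball ?D r \<inter> upper_right -` (?k ` N')"])
  moreover have "upper_right ` U = ?k ` N'"
  proof (intro antisym subsetI)
    fix y assume "y \<in> ?k ` N'"
    then obtain t where t: "t \<in> N'" "y = ?k t" by auto
    then have "?f t \<in> U" using f_Gr by (auto simp: U_def N'_def)
    with t(2) show "y \<in> upper_right ` U" by blast
  qed (auto simp: U_def)
  moreover have "?D \<in> U"
    using f_Gr[of 0] N'(2) r(1) f0 by (auto simp: U_def intro!: image_eqI[where x = 0])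
  moreover have "h 0 = 0"
    using N(3)[OF N(2)] by (simp only: f0 upper_right_block)
  moreover have "?f (h (upper_right X)) = X" if X: "X \<in> U" for X
  proof -
    obtain t where t: "t \<in> N'" "upper_right X = ?k t" using X by (auto simp: U_def)
    then have "h (upper_right X) = t" using N(3) by (simp add: N'_def)
    moreover have "?f t = X"
      using t X f_Gr by (intro r(2)) (auto simp: U_def N'_def dist_commute)
    ultimately show ?thesis by simp
  qed
  ultimately show thesis using that[of U h] inv by simp
qed

text \<open>Conjugation by \<open>Q\<close> carries the chart and the lift from the base point to the point \<open>f(Q)\<close>. The lift
  sends \<open>f(Q)\<close> to \<open>Q\<close> itself because \<open>\<tau>\<close> vanishes there; the freedom to choose \<open>Q\<close> within its
  coset is essential for lifting curves with a given starting point.\<close>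

lemma Gr_chart_with_section:
  fixes Q :: "('k::finite, 'l::finite) bmat"
  assumes "a \<noteq> b" and Q: "Q \<in> SO"
  obtains U \<psi> \<tau> where
    "(U, \<psi>) \<in> atlas (quadratic_model a b)" "orbit_map a b Q \<in> U"
    "smooth_on (\<psi> ` U) \<tau>" "\<tau> (\<psi> (orbit_map a b Q)) = (0 :: real^'l^'k)"
    "\<forall>X\<in>U. orbit_map a b (Q ** cayley (offdiag (\<tau> (\<psi> X)))) = X"
proof -
  let ?G = "Gr a b :: ('k, 'l) bmat set"
  obtain U0 :: "('k, 'l) bmat set" and \<tau> where U0:
    "openin (top_of_set ?G) U0" "two_scalars a b \<in> U0" "open (upper_right ` U0)"
    "smooth_on (upper_right ` U0) \<tau>" "\<tau> 0 = 0"
    "\<forall>X\<in>U0. orbit_map a b (cayley (offdiag (\<tau> (upper_right X)))) = X"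
    by (rule Gr_base_section[OF assms(1)])
  define R where "R X = transpose Q ** X ** Q" for X :: "('k, 'l) bmat"
  define U where "U = {X \<in> ?G. R X \<in> U0}"
  define \<psi> where "\<psi> X = upper_right (R X)" for X
  have R_inv: "R (Q ** X ** transpose Q) = X" "Q ** R X ** transpose Q = X" for X
    using SO_transpose_mult[OF Q] by (simp_all add: R_def matrix_mul_assoc)
       (simp_all add: matrix_mul_assoc[symmetric])
  have linR: "bounded_linear R"
    unfolding R_def
    by (rule bounded_linear_compose[OF matrix_mult.bounded_linear_left matrix_mult.bounded_linear_right])
  have RG: "R X \<in> ?G" if "X \<in> ?G" for X
    using Gr_conj[OF SO_transpose[OF Q] that] by (simp add: R_def)
  have U0G: "U0 \<subseteq> ?G" using openin_subset[OF U0(1)] by simp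
  have imU: "\<psi> ` U = upper_right ` U0"
  proof (intro antisym subsetI)
    fix y assume "y \<in> upper_right ` U0"
    then obtain X where "X \<in> U0" "y = upper_right X" by auto
    then show "y \<in> \<psi> ` U"
      using Gr_conj[OF Q, of X a b] U0G R_inv(1)[of X]
      by (intro image_eqI[of _ _ "Q ** X ** transpose Q"]) (auto simp: U_def \<psi>_def)
  qed (auto simp: U_def \<psi>_def)
  have sec: "orbit_map a b (Q ** cayley (offdiag (\<tau> (\<psi> X)))) = X" if "X \<in> U" for X
    using that U0(6) R_inv(2)[of X] by (simp add: orbit_map_mult U_def \<psi>_def)
  have inj: "inj_on \<psi> U" using sec by (metis inj_onI)
  have "openin (top_of_set ?G) U"
  proof -
    obtain T where T: "open T" "U0 = ?G \<inter> T" using U0(1) by (auto simp: openin_open)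
    then have "U = ?G \<inter> R -` T" using RG by (auto simp: U_def)
    then show ?thesis
      using continuous_openin_preimage_gen[OF linear_continuous_on[OF linR] T(1)] by simp
  qed
  moreover have "smooth_on U \<psi>"
    unfolding \<psi>_def
    by (rule smooth_on_if_bounded_linear[OF bounded_linear_compose[OF bounded_linear_upper_right linR]])
  moreover have "smooth_on (\<psi> ` U) (inv_into U \<psi>)"
  proof (rule smooth_on_cong)
    show "smooth_on (\<psi> ` U) (\<lambda>y. Q ** orbit_map a b (cayley (offdiag (\<tau> y))) ** transpose Q)"
      unfolding imU
      by (intro smooth_on_bilinear[OF matrix_mult.bounded_bilinear_axioms] smooth_on_const
          smooth_on_compose[OF _ smooth_on_orbit_map[of UNIV]]
          smooth_on_compose[OF U0(4) smooth_on_cayley_offdiag[of UNIV]]) auto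
    fix y assume "y \<in> \<psi> ` U"
    then show "Q ** orbit_map a b (cayley (offdiag (\<tau> y))) ** transpose Q = inv_into U \<psi> y"
      using sec inj by (auto simp: orbit_map_mult)
  qed
  ultimately have "(U, \<psi>) \<in> atlas (quadratic_model a b)"
    using inj U0(3) imU by (simp add: quadratic_model_def submanifold_def)
  moreover have RQ: "R (orbit_map a b Q) = two_scalars a b"
    using R_inv(1)[of "two_scalars a b"] by (simp add: orbit_map_def)
  then have "orbit_map a b Q \<in> U" "\<tau> (\<psi> (orbit_map a b Q)) = 0"
    using U0(2,5) Q by (auto simp: U_def \<psi>_def Gr_eq_orbit)
  ultimately show thesis
    using that[of U \<psi> \<tau>] sec U0(4) imU by simp
qed

section \<open>Cosets as fibres of the orbit map\<close>

lemma mat_mult_left: "mat c ** (A :: real^'m::finite^'n::finite) = c *\<^sub>R A"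
  and mat_mult_right: "(B :: real^'n::finite^'m::finite) ** mat c = c *\<^sub>R B"
  by (simp_all add: mat_eq_scaleR[of c] matrix_mult.scaleR_left matrix_mult.scaleR_right)

text \<open>A rotation fixes \<open>D = diag(a I, b I)\<close> under conjugation iff it commutes with \<open>D\<close>, that is, iff its
  off-diagonal blocks are annihilated by \<open>a - b\<close>. A stabilizer is visibly a group, which is what
  the comparison of cosets uses.\<close>

lemma SOO_eq_stabilizer:
  assumes "a \<noteq> b"
  shows "SOO = {h \<in> SO. orbit_map a b h = (two_scalars a b :: ('k::finite, 'l::finite) bmat)}"
proof (intro antisym subsetI)
  fix h :: "('k, 'l) bmat" assume "h \<in> SOO"
  then obtain X1 X2 where h: "h = block X1 0 0 X2" "orthogonal_matrix X1" "orthogonal_matrix X2" "det X1 * det X2 = 1"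
    by (auto simp: SOO_def)
  then have "X1 ** transpose X1 = mat 1" "X2 ** transpose X2 = mat 1" "transpose X1 ** X1 = mat 1" "transpose X2 ** X2 = mat 1"
    by (simp_all add: orthogonal_matrix_def)
  with h show "h \<in> {h \<in> SO. orbit_map a b h = two_scalars a b}"
    by (simp add: SO_def rotation_matrix_def orthogonal_matrix det_block_diagonal orbit_map_def
        block_transpose block_mult transpose_zero mat_eq_block[of 1] mat_mult_right
        matrix_mult.scaleR_left matrix_mult.scaleR_right mat_eq_scaleR[of a] mat_eq_scaleR[of b])
next
  fix h :: "('k, 'l) bmat" assume "h \<in> {h \<in> SO. orbit_map a b h = two_scalars a b}"
  then have h: "h \<in> SO" and o: "orbit_map a b h = two_scalars a b" by auto
  obtain A B C E where hb: "h = block A B C E" by (rule block_exhaust)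
  have "h ** two_scalars a b = orbit_map a b h ** h"
    using SO_transpose_mult(1)[OF h] by (simp add: orbit_map_def matrix_mul_assoc[symmetric])
  then have "B = 0" "C = 0"
    unfolding o using assms by (simp_all add: hb block_mult block_eq_iff mat_mult_left mat_mult_right)
  with hb have hd: "h = block A 0 0 E" by simp
  have "transpose h ** h = mat 1" by (rule SO_transpose_mult[OF h])
  then have "orthogonal_matrix A" "orthogonal_matrix E"
    by (simp_all add: hd block_transpose block_mult transpose_zero mat_eq_block[of 1] block_eq_iff orthogonal_matrix)
  moreover have "det A * det E = 1"
    using h by (simp add: SO_def rotation_matrix_def hd det_block_diagonal)
  ultimately show "h \<in> SOO" unfolding SOO_def hd by blast
qed

lemma coset_eq_fiber:
  fixes Q :: "('k::finite, 'l::finite) bmat"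
  assumes "a \<noteq> b" "Q \<in> SO"
  shows "coset Q = {P \<in> SO. orbit_map a b P = orbit_map a b Q}"
proof (intro antisym subsetI)
  fix P assume "P \<in> coset Q"
  then obtain h where h: "h \<in> SO" "orbit_map a b h = two_scalars a b" "P = Q ** h"
    by (auto simp: coset_def SOO_eq_stabilizer[OF assms(1)])
  then show "P \<in> {P \<in> SO. orbit_map a b P = orbit_map a b Q}"
    using SO_mult[OF assms(2) h(1)] by (simp add: orbit_map_mult[of _ _ Q h]) (simp add: orbit_map_def)
next
  fix P assume "P \<in> {P \<in> SO. orbit_map a b P = orbit_map a b Q}"
  then have P: "P \<in> SO" "orbit_map a b P = orbit_map a b Q" by auto
  have "orbit_map a b (transpose Q ** P) = orbit_map a b (transpose Q ** Q)"
    unfolding orbit_map_mult P(2) ..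
  then have "orbit_map a b (transpose Q ** P) = two_scalars a b"
    by (simp add: SO_transpose_mult[OF assms(2)]) (simp add: orbit_map_def)
  then have "transpose Q ** P \<in> SOO"
    using SO_mult[OF SO_transpose[OF assms(2)] P(1)] by (simp add: SOO_eq_stabilizer[OF assms(1)])
  moreover have "P = Q ** (transpose Q ** P)"
    by (simp add: matrix_mul_assoc SO_transpose_mult[OF assms(2)])
  ultimately show "P \<in> coset Q" unfolding coset_def by blast
qed

lemma coset_eq_iff:
  assumes "a \<noteq> b" "P \<in> SO" "Q \<in> SO"
  shows "coset P = coset Q \<longleftrightarrow> orbit_map a b P = orbit_map a b Q"
  unfolding coset_eq_fiber[OF assms(1,2)] coset_eq_fiber[OF assms(1,3)] using assms(2,3) by auto

lemma phi5_inv_coset: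
  assumes "a \<noteq> b" "Q \<in> SO"
  shows "phi5_inv a b (coset Q) = orbit_map a b Q"
proof -
  have "orbit_map a b ` coset Q = {orbit_map a b Q}"
    unfolding coset_eq_fiber[OF assms] using assms(2) by auto
  then show ?thesis by (simp add: phi5_inv_def orbit_map_def[abs_def])
qed

lemma mtop_quotient_model: "mtop quotient_model = quotient_top (top_of_set SO) coset"
  by (simp add: quotient_model_def quotient_manifold_def)

lemma points_quotient_model: "points quotient_model = coset ` SO"
  by (simp add: mtop_quotient_model topspace_quotient_top)

lemma points_quadratic_model: "points (quadratic_model a b) = Gr a b"
  and mtop_quadratic_model: "mtop (quadratic_model a b) = top_of_set (Gr a b)"
  by (simp_all add: quadratic_model_def submanifold_def)

lemma bij_betw_phi5_inv:
  assumes "a \<noteq> b"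
  shows "bij_betw (phi5_inv a b) (points quotient_model) (Gr a b :: ('k::finite, 'l::finite) bmat set)"
  unfolding points_quotient_model bij_betw_def Gr_eq_orbit
  using coset_eq_iff[OF assms] by (auto simp: inj_on_def phi5_inv_coset[OF assms] image_image cong: image_cong)

lemma continuous_on_det:
  fixes M :: "'a::topological_space \<Rightarrow> real^'n::finite^'n"
  assumes "continuous_on S M"
  shows "continuous_on S (\<lambda>x. det (M x))"
  unfolding det_def using assms by (auto intro!: continuous_intros)

text \<open>Closed because it is defined by the equations \<open>Q\<^sup>T Q = 1\<close> and \<open>det Q = 1\<close>, bounded because the
  rows have norm \<open>1\<close>.\<close>

lemma compact_SO: "compact (SO :: (real^'n::finite^'n) set)"
proof -
  have "norm Q \<le> real CARD('n)" if "Q \<in> SO" for Q :: "real^'n^'n"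
  proof -
    have "norm (row i Q) = 1" for i
      using that by (auto simp: SO_def rotation_matrix_def orthogonal_matrix_orthonormal_rows)
    then have "norm (Q $ i) = 1" for i by (simp add: row_def)
    then show ?thesis
      using L2_set_le_sum[of UNIV "\<lambda>i. norm (Q $ i)"] by (simp add: norm_vec_def)
  qed
  then have "bounded (SO :: (real^'n^'n) set)" by (auto simp: bounded_iff)
  moreover have "closed (SO :: (real^'n^'n) set)"
  proof -
    have "continuous_on UNIV (\<lambda>Q :: real^'n^'n. transpose Q ** Q)"
      by (intro matrix_mult.continuous_on linear_continuous_on bounded_linear_transpose continuous_on_id)
    then have c1: "closed {Q :: real^'n^'n. transpose Q ** Q = mat 1}"
      by (intro closed_Collect_eq) (simp_all)
    have c2: "closed {Q :: real^'n^'n. det Q = 1}"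
      by (intro closed_Collect_eq continuous_on_det) (simp_all)
    have "SO = {Q :: real^'n^'n. transpose Q ** Q = mat 1} \<inter> {Q. det Q = 1}"
      by (auto simp: SO_def rotation_matrix_def orthogonal_matrix)
    with closed_Int[OF c1 c2] show ?thesis by (simp only:)
  qed
  ultimately show ?thesis by (simp add: compact_eq_bounded_closed)
qed

lemma quotient_map_orbit_map:
  "quotient_map (top_of_set SO) (top_of_set (Gr a b)) (orbit_map a b :: ('k::finite, 'l::finite) bmat \<Rightarrow> _)"
proof (rule continuous_imp_quotient_map)
  show "continuous_map (top_of_set SO) (top_of_set (Gr a b)) (orbit_map a b)"
    using continuous_on_if_smooth_on[OF smooth_on_orbit_map] by (auto simp: Gr_eq_orbit)
qed (auto simp: compact_SO Gr_eq_orbit compact_space_subtopology intro: Hausdorff_space_subtopology)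

text \<open>The orbit map goes from a compact space onto a Hausdorff space, so its target carries the
  quotient topology, just as the coset space does; both maps have the same fibres.\<close>

lemma homeomorphic_map_phi5_inv:
  assumes "a \<noteq> b"
  shows "homeomorphic_map (mtop quotient_model) (top_of_set (Gr a b :: ('k::finite, 'l::finite) bmat set)) (phi5_inv a b)"
proof -
  let ?f = "phi5_inv a b :: ('k, 'l) bmat set \<Rightarrow> _"
  have "openin (mtop quotient_model) {c \<in> points quotient_model. ?f c \<in> V} \<longleftrightarrow> openin (top_of_set (Gr a b)) V"
    if "V \<subseteq> Gr a b" for V
  proof -
    have "{Q \<in> SO. coset Q \<in> {c \<in> coset ` SO. ?f c \<in> V}} = {Q \<in> SO. orbit_map a b Q \<in> V}"
      by (auto simp: phi5_inv_coset[OF assms])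
    then have "openin (mtop quotient_model) {c \<in> points quotient_model. ?f c \<in> V} \<longleftrightarrow>
        openin (top_of_set SO) {Q \<in> SO. orbit_map a b Q \<in> V}"
      unfolding points_quotient_model unfolding mtop_quotient_model openin_quotient_top by auto
    also have "\<dots> \<longleftrightarrow> openin (top_of_set (Gr a b)) V"
      using quotient_map_orbit_map[of a b, where 'k = 'k and 'l = 'l] that by (simp add: quotient_map_def)
    finally show ?thesis .
  qed
  then show ?thesis
    using bij_betw_phi5_inv[OF assms, where 'k = 'k and 'l = 'l]
    by (simp add: homeomorphic_map_def quotient_map_def bij_betw_def)
qed

section \<open>Comparison of the two atlases\<close>

lemma atlas_quadratic_model:
  "(U, \<phi>) \<in> atlas (quadratic_model a b) \<longleftrightarrow>
     openin (top_of_set (Gr a b)) U \<and> open (\<phi> ` U) \<and> inj_on \<phi> U \<and> smooth_on U \<phi> \<and>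
     smooth_on (\<phi> ` U) (inv_into U \<phi>)"
  by (simp add: quadratic_model_def submanifold_def)

lemma atlas_quotient_model:
  "(U, \<phi>) \<in> atlas quotient_model \<longleftrightarrow>
     openin (mtop quotient_model) U \<and> open (\<phi> ` U) \<and>
     homeomorphic_map (subtopology (mtop quotient_model) U) (top_of_set (\<phi> ` U)) \<phi> \<and>
     submersion_on SO {Q \<in> SO. coset Q \<in> U} (\<phi> \<circ> coset)"
  by (simp add: quotient_model_def quotient_manifold_def)

lemma chart_image_open:
  assumes "(U, \<phi>) \<in> atlas (quadratic_model a b)" "openin (top_of_set (Gr a b)) W"
  shows "open (\<phi> ` (U \<inter> W))"
proof -
  note U = assms(1)[unfolded atlas_quadratic_model]
  obtain T where T: "open T" "W = Gr a b \<inter> T" using assms(2) by (auto simp: openin_open)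
  have UG: "U \<subseteq> Gr a b" using U openin_subset[of "top_of_set (Gr a b)" U] by simp
  have "open (\<phi> ` U \<inter> inv_into U \<phi> -` T)"
    using U T(1) by (intro continuous_open_preimage continuous_on_if_smooth_on) auto
  moreover have "\<phi> ` U \<inter> inv_into U \<phi> -` T = \<phi> ` (U \<inter> W)"
    using U UG T(2) by auto
  ultimately show ?thesis by simp
qed

text \<open>Every smooth curve in the quadratic model is, near parameter \<open>0\<close>, the image of a smooth curve of
  rotations \<open>Q cay(S(t(s)))\<close> that starts at a prescribed point \<open>Q\<close> of the fibre.\<close>

lemma smooth_curve_lift:
  fixes Q :: "('k::finite, 'l::finite) bmat" and X :: "real \<Rightarrow> ('k, 'l) bmat"
  assumes "a \<noteq> b" "Q \<in> SO" and X: "smooth_on {-\<epsilon><..<\<epsilon>} X" "\<epsilon> > 0"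
    "X ` {-\<epsilon><..<\<epsilon>} \<subseteq> Gr a b" "X 0 = orbit_map a b Q"
  obtains \<delta> t where "0 < \<delta>" "\<delta> \<le> \<epsilon>" "smooth_on {-\<delta><..<\<delta>} t" "t 0 = (0 :: real^'l^'k)"
    "\<forall>s\<in>{-\<delta><..<\<delta>}. orbit_map a b (Q ** cayley (offdiag (t s))) = X s"
proof -
  obtain U \<psi> \<tau> where U: "(U, \<psi>) \<in> atlas (quadratic_model a b)" "orbit_map a b Q \<in> U"
    "smooth_on (\<psi> ` U) \<tau>" "\<tau> (\<psi> (orbit_map a b Q)) = (0 :: real^'l^'k)"
    "\<forall>X\<in>U. orbit_map a b (Q ** cayley (offdiag (\<tau> (\<psi> X)))) = X"
    by (rule Gr_chart_with_section[OF assms(1,2)])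
  have "\<forall>\<^sub>F s in nhds 0. X s \<in> Gr a b"
    using eventually_interval[OF X(2)] by eventually_elim (use X(3) in auto)
  then have "\<forall>\<^sub>F s in nhds 0. X s \<in> U"
    using curve_eventually_in[OF smooth_on_curve_has_derivative[OF X(1,2)], of "Gr a b" U] U(1,2) X(4)
    by (simp add: atlas_quadratic_model)
  then obtain d where d: "d > 0" "\<And>s. dist s 0 < d \<Longrightarrow> X s \<in> U"
    by (auto simp: eventually_nhds_metric)
  define \<delta> where "\<delta> = min d \<epsilon>"
  have \<delta>: "\<delta> > 0" "\<delta> \<le> \<epsilon>" "\<And>s. s \<in> {-\<delta><..<\<delta>} \<Longrightarrow> X s \<in> U"
    using d X(2) by (auto simp: \<delta>_def dist_norm)
  have "smooth_on {-\<delta><..<\<delta>} X" by (rule smooth_on_subset[OF X(1)]) (use \<delta>(2) in auto)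
  then have "smooth_on {-\<delta><..<\<delta>} (\<lambda>s. \<psi> (X s))"
    using U(1) \<delta>(3) by (intro smooth_on_compose[of _ X U \<psi>]) (auto simp: atlas_quadratic_model)
  then have "smooth_on {-\<delta><..<\<delta>} (\<lambda>s. \<tau> (\<psi> (X s)))"
    using \<delta>(3) by (intro smooth_on_compose[OF _ U(3)]) auto
  then show thesis
    using that[of \<delta> "\<lambda>s. \<tau> (\<psi> (X s))"] \<delta> U(4,5) X(4) by simp
qed

lemma smooth_on_mult_cayley:
  assumes "smooth_on S t"
  shows "smooth_on S (\<lambda>s. Q ** cayley (offdiag (t s)))"
  by (intro smooth_on_bilinear[OF matrix_mult.bounded_bilinear_axioms] smooth_on_const
      smooth_on_compose[OF assms smooth_on_cayley_offdiag[of UNIV]]) simp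

lemma mult_cayley_in_SO: "Q \<in> SO \<Longrightarrow> Q ** cayley (offdiag t) \<in> SO"
  by (intro SO_mult cayley_in_SO offdiag_skew)

text \<open>The topological conditions follow from the homeomorphism. For the submersion property, the
  straight line with velocity \<open>w\<close> in the chart is a curve in the quadratic model, and its lift to
  the rotation group is a curve as required.\<close>

lemma quotient_chart_of_quadratic_chart:
  fixes V :: "('k::finite, 'l::finite) bmat set" and \<psi> :: "('k, 'l) bmat \<Rightarrow> real^'l^'k"
  assumes "a \<noteq> b" and V: "(V, \<psi>) \<in> atlas (quadratic_model a b)"
  shows "({c \<in> points quotient_model. phi5_inv a b c \<in> V}, \<psi> \<circ> phi5_inv a b) \<in> atlas quotient_model"
proof -
  let ?f = "phi5_inv a b :: ('k, 'l) bmat set \<Rightarrow> _"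
  let ?U = "{c \<in> points quotient_model. ?f c \<in> V}"
  note V' = V[unfolded atlas_quadratic_model]
  have VG: "V \<subseteq> Gr a b" using V' openin_subset[of "top_of_set (Gr a b)" V] by simp
  have hom: "homeomorphic_map (mtop quotient_model) (top_of_set (Gr a b)) ?f"
    by (rule homeomorphic_map_phi5_inv[OF assms(1)])
  have fU: "?f ` ?U = V"
    using bij_betw_phi5_inv[OF assms(1), where 'k = 'k and 'l = 'l] VG by (force simp: bij_betw_def image_iff)
  have im: "(\<psi> \<circ> ?f) ` ?U = \<psi> ` V"
    unfolding image_comp[symmetric] fU ..
  have "openin (mtop quotient_model) ?U"
    using hom V' VG by (simp add: homeomorphic_map_def quotient_map_def)
  moreover have "homeomorphic_map (subtopology (mtop quotient_model) ?U) (top_of_set (\<psi> ` V)) (\<psi> \<circ> ?f)"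
  proof (rule homeomorphic_map_compose)
    have "homeomorphic_map (subtopology (mtop quotient_model) ?U) (subtopology (top_of_set (Gr a b)) V) ?f"
      by (rule homeomorphic_map_subtopologies_alt[OF hom]) auto
    then show "homeomorphic_map (subtopology (mtop quotient_model) ?U) (top_of_set V) ?f"
      using VG by (simp add: subtopology_subtopology Int_absorb1)
    show "homeomorphic_map (top_of_set V) (top_of_set (\<psi> ` V)) \<psi>"
      unfolding homeomorphic_map_maps
      using V' by (intro exI[of _ "inv_into V \<psi>"])
        (auto simp: homeomorphic_maps_def continuous_on_if_smooth_on inv_into_into)
  qed
  moreover have "submersion_on SO {Q \<in> SO. coset Q \<in> ?U} (\<psi> \<circ> ?f \<circ> coset)"
    unfolding submersion_on_def
  proof (intro conjI ballI allI)
    have dom: "{Q \<in> SO. coset Q \<in> ?U} = {Q \<in> SO. orbit_map a b Q \<in> V}"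
      by (auto simp: points_quotient_model phi5_inv_coset[OF assms(1)])
    have "smooth_on {Q \<in> SO. orbit_map a b Q \<in> V} (\<lambda>Q. \<psi> (orbit_map a b Q))"
      using V' by (intro smooth_on_compose[OF smooth_on_orbit_map, of V]) auto
    then show "smooth_on {Q \<in> SO. coset Q \<in> ?U} (\<psi> \<circ> ?f \<circ> coset)"
      unfolding dom by (rule smooth_on_cong) (simp add: phi5_inv_coset[OF assms(1)])
    fix Q and w :: "real^'l^'k" assume "Q \<in> {Q \<in> SO. coset Q \<in> ?U}"
    then have Q: "Q \<in> SO" "orbit_map a b Q \<in> V" using dom by auto
    let ?y = "\<psi> (orbit_map a b Q)"
    obtain \<epsilon> where \<epsilon>: "\<epsilon> > 0" "\<And>s. s \<in> {-\<epsilon><..<\<epsilon>} \<Longrightarrow> ?y + s *\<^sub>R w \<in> \<psi> ` V"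
      using open_contains_short_segment[of "\<psi> ` V" ?y w] V' Q(2) by blast
    let ?X = "\<lambda>s. inv_into V \<psi> (?y + s *\<^sub>R w)"
    have aff: "smooth_on {-\<epsilon><..<\<epsilon>} (\<lambda>s. ?y + s *\<^sub>R w)"
      by (intro smooth_on_if_Ck_on Ck_on_add Ck_on_const Ck_on_linear bounded_linear_scaleR_left) auto
    have "smooth_on (\<psi> ` V) (inv_into V \<psi>)" using V' by blast
    from smooth_on_compose[OF aff this] have sX: "smooth_on {-\<epsilon><..<\<epsilon>} ?X"
      using \<epsilon>(2) by blast
    have X: "?X s \<in> V" "\<psi> (?X s) = ?y + s *\<^sub>R w" if "s \<in> {-\<epsilon><..<\<epsilon>}" for s
      using \<epsilon>(2)[OF that] by (auto intro: inv_into_into f_inv_into_f)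
    have X0: "?X 0 = orbit_map a b Q" using V' Q(2) by simp
    obtain \<delta> t where t: "0 < \<delta>" "\<delta> \<le> \<epsilon>" "smooth_on {-\<delta><..<\<delta>} t" "t 0 = (0 :: real^'l^'k)"
      "\<forall>s\<in>{-\<delta><..<\<delta>}. orbit_map a b (Q ** cayley (offdiag (t s))) = ?X s"
      by (rule smooth_curve_lift[OF assms(1) Q(1) sX \<epsilon>(1) _ X0]) (use X(1) VG in auto)
    let ?c = "\<lambda>s. Q ** cayley (offdiag (t s))"
    have "((\<lambda>s. ?y + s *\<^sub>R w) has_vector_derivative w) (at 0)"
      by (auto intro!: derivative_eq_intros)
    moreover have "\<forall>\<^sub>F s in nhds 0. ?y + s *\<^sub>R w = (\<psi> \<circ> ?f \<circ> coset \<circ> ?c) s"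
      using eventually_interval[OF t(1)]
      by eventually_elim (use t(2,5) X(2) mult_cayley_in_SO[OF Q(1)] in \<open>auto simp: phi5_inv_coset[OF assms(1)]\<close>)
    ultimately have "(\<psi> \<circ> ?f \<circ> coset \<circ> ?c has_vector_derivative w) (at 0)"
      by (rule has_vector_derivative_transform_eventually)
    then show "\<exists>c. \<exists>\<epsilon>>0. c ` {-\<epsilon><..<\<epsilon>} \<subseteq> SO \<and> smooth_on {-\<epsilon><..<\<epsilon>} c \<and> c 0 = Q \<and>
        (\<psi> \<circ> ?f \<circ> coset \<circ> c has_vector_derivative w) (at 0)"
      using t(1,4) smooth_on_mult_cayley[OF t(3)] mult_cayley_in_SO[OF Q(1)]
      by (intro exI[of _ ?c] exI[of _ \<delta>]) auto
  qed
  ultimately show ?thesis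
    unfolding atlas_quotient_model im using V' by blast
qed

lemma inv_phi5_inv:
  assumes "a \<noteq> b" "c \<in> points quotient_model"
  shows "inv_into (points quotient_model) (phi5_inv a b) (phi5_inv a b c) = c"
  by (rule inv_into_f_f[OF bij_betw_imp_inj_on[OF bij_betw_phi5_inv[OF assms(1)]] assms(2)])

lemma inv_phi5_inv_orbit:
  assumes "a \<noteq> b" "Q \<in> SO"
  shows "inv_into (points quotient_model) (phi5_inv a b) (orbit_map a b Q) = coset Q"
  using inv_phi5_inv[OF assms(1), of "coset Q"] assms(2)
  by (simp add: phi5_inv_coset[OF assms] points_quotient_model)

text \<open>Near a point \<open>f(Q)\<close>, composing the projection with the lift of \<open>Gr_chart_with_section\<close> expresses the
  transported chart in the coordinates \<open>\<psi>\<^sub>1\<close> by the map \<open>k(y) = \<phi>(coset(Q cay(S(\<tau>(y)))))\<close>, which is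
  smooth since \<open>\<phi> \<circ> coset\<close> is. The submersion property of \<open>\<phi>\<close> says that any vector \<open>w\<close> is the
  derivative of \<open>\<phi> \<circ> coset\<close> along a curve of rotations; as this curve is seen by \<open>k\<close> only through
  its image under the orbit map, \<open>w\<close> lies in the range of the derivative of \<open>k\<close>. So \<open>k\<close> has a smooth
  inverse, and both the chart and its inverse are smooth.\<close>

lemma quadratic_chart_of_quotient_chart:
  fixes U :: "('k::finite, 'l::finite) bmat set set" and \<phi> :: "('k, 'l) bmat set \<Rightarrow> real^'l^'k"
  assumes "a \<noteq> b" and U: "(U, \<phi>) \<in> atlas quotient_model"
  shows "(phi5_inv a b ` U, \<phi> \<circ> inv_into (points quotient_model) (phi5_inv a b)) \<in> atlas (quadratic_model a b)"
proof -
  let ?f = "phi5_inv a b :: ('k, 'l) bmat set \<Rightarrow> _"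
  let ?V = "?f ` U"
  define \<psi> where "\<psi> = \<phi> \<circ> inv_into (points quotient_model) ?f"
  note U' = U[unfolded atlas_quotient_model]
  have Up: "U \<subseteq> points quotient_model" using U' openin_subset[of "mtop quotient_model" U] by simp
  have hom: "homeomorphic_map (mtop quotient_model) (top_of_set (Gr a b)) ?f"
    by (rule homeomorphic_map_phi5_inv[OF assms(1)])
  have \<psi>_coset: "\<psi> (orbit_map a b Q) = \<phi> (coset Q)" if "Q \<in> SO" for Q
    using inv_phi5_inv_orbit[OF assms(1) that] by (simp add: \<psi>_def)
  have \<psi>f: "\<psi> (?f c) = \<phi> c" if "c \<in> U" for c
    using inv_phi5_inv[OF assms(1), of c] that Up by (auto simp: \<psi>_def)
  have im: "\<psi> ` ?V = \<phi> ` U" using \<psi>f by (force simp: image_image)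
  have opV: "openin (top_of_set (Gr a b)) ?V"
    using homeomorphic_map_openness[OF hom Up] U' by simp
  then have VG: "?V \<subseteq> Gr a b" using openin_subset[of "top_of_set (Gr a b)" ?V] by simp
  have V_iff: "orbit_map a b Q \<in> ?V \<longleftrightarrow> coset Q \<in> U" if "Q \<in> SO" for Q
  proof
    assume "orbit_map a b Q \<in> ?V"
    then obtain c where c: "c \<in> U" "?f c = orbit_map a b Q" by auto
    then have "coset Q = c"
      using inv_phi5_inv[OF assms(1), of c] inv_phi5_inv_orbit[OF assms(1) that] Up by auto
    with c show "coset Q \<in> U" by simp
  qed (use phi5_inv_coset[OF assms(1) that] in \<open>auto intro: image_eqI[of _ _ "coset Q"]\<close>)
  have "inj_on \<phi> U"
    using U' Up by (simp add: homeomorphic_map_def Int_absorb1)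
  then have inj: "inj_on \<psi> ?V"
    using \<psi>f by (auto simp: inj_on_def)
  have sub: "smooth_on {Q \<in> SO. coset Q \<in> U} (\<lambda>Q. \<phi> (coset Q))"
    using U' by (simp add: submersion_on_def o_def)
  have local: "\<exists>T. open T \<and> X0 \<in> T \<and> smooth_on (?V \<inter> T) \<psi>" 
    "\<exists>T. open T \<and> \<psi> X0 \<in> T \<and> smooth_on (\<psi> ` ?V \<inter> T) (inv_into ?V \<psi>)"
    if X0: "X0 \<in> ?V" for X0
  proof -
    obtain Q where Q: "Q \<in> SO" "X0 = orbit_map a b Q" using X0 VG by (auto simp: Gr_eq_orbit)
    obtain U1 \<psi>1 \<tau> where U1: "(U1, \<psi>1) \<in> atlas (quadratic_model a b)" "orbit_map a b Q \<in> U1"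
      "smooth_on (\<psi>1 ` U1) \<tau>" "\<tau> (\<psi>1 (orbit_map a b Q)) = (0 :: real^'l^'k)"
      "\<forall>X\<in>U1. orbit_map a b (Q ** cayley (offdiag (\<tau> (\<psi>1 X)))) = X"
      by (rule Gr_chart_with_section[OF assms(1) Q(1)])
    note U1' = U1(1)[unfolded atlas_quadratic_model]
    have U1G: "U1 \<subseteq> Gr a b" using U1' openin_subset[of "top_of_set (Gr a b)" U1] by simp
    \<comment> \<open>The coordinate domain in which both charts are defined; \<open>h\<close> will be the inverse of \<open>k\<close>.\<close>
    define A where "A = \<psi>1 ` (U1 \<inter> ?V)"
    define k where "k y = \<phi> (coset (Q ** cayley (offdiag (\<tau> y))))" for y
    define h where "h y = \<psi>1 (inv_into ?V \<psi> y)" for y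
    have A: "open A" unfolding A_def by (rule chart_image_open[OF U1(1) opV])
    have k\<psi>1: "k (\<psi>1 X) = \<psi> X" if "X \<in> U1" for X
      using U1(5) that \<psi>_coset[OF mult_cayley_in_SO[OF Q(1)], of "\<tau> (\<psi>1 X)"] by (simp add: k_def)
    have "smooth_on A (\<lambda>y. Q ** cayley (offdiag (\<tau> y)))"
      by (rule smooth_on_mult_cayley[OF smooth_on_subset[OF U1(3)]]) (auto simp: A_def)
    moreover have "(\<lambda>y. Q ** cayley (offdiag (\<tau> y))) ` A \<subseteq> {Q \<in> SO. coset Q \<in> U}"
      using mult_cayley_in_SO[OF Q(1)] U1(5) V_iff by (auto simp: A_def)
    ultimately have k_smooth: "smooth_on A k"
      unfolding k_def by (rule smooth_on_compose[OF _ sub])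
    have hk: "h (k y) = y" if "y \<in> A" for y
      using that inj by (auto simp: A_def k\<psi>1 h_def)
    have "surj (frechet_derivative k (at y))" if y: "y \<in> A" for y
    proof -
      obtain X where X: "X \<in> U1" "X \<in> ?V" "y = \<psi>1 X" using y by (auto simp: A_def)
      obtain P where P: "P \<in> SO" "X = orbit_map a b P" using X(2) VG by (auto simp: Gr_eq_orbit)
      have Dk: "(k has_derivative frechet_derivative k (at y)) (at y)"
        using Ck_on_if_smooth_on[OF A k_smooth, of 1] y by (simp add: frechet_derivative_works)
      have "\<exists>v. frechet_derivative k (at y) v = w" for w
      proof -
        have "P \<in> {x \<in> SO. coset x \<in> U}" using P X(2) V_iff by simp
        then obtain c \<epsilon> where c: "\<epsilon> > 0" "c ` {-\<epsilon><..<\<epsilon>} \<subseteq> SO" "smooth_on {-\<epsilon><..<\<epsilon>} c" "c 0 = P"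
          "(\<phi> \<circ> coset \<circ> c has_vector_derivative w) (at 0)"
          using U' unfolding submersion_on_def by meson
        define X' where "X' s = orbit_map a b (c s)" for s
        have "smooth_on {-\<epsilon><..<\<epsilon>} X'"
          unfolding X'_def by (rule smooth_on_compose[OF c(3) smooth_on_orbit_map[of UNIV]]) simp
        then have dX: "(X' has_vector_derivative vector_derivative X' (at 0)) (at 0)"
          by (rule smooth_on_curve_has_derivative[OF _ c(1)])
        have ev: "\<forall>\<^sub>F s in nhds 0. c s \<in> SO"
          using eventually_interval[OF c(1)] by eventually_elim (use c(2) in auto)
        then have "\<forall>\<^sub>F s in nhds 0. X' s \<in> Gr a b"
          by eventually_elim (simp add: X'_def Gr_eq_orbit)
        then have evU: "\<forall>\<^sub>F s in nhds 0. X' s \<in> U1"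
          using curve_eventually_in[OF dX, of "Gr a b" U1] U1' X(1) P(2) c(4) by (simp add: X'_def)
        have X'0: "X' 0 = X" by (simp add: X'_def c(4) P(2))
        have s1: "smooth_on U1 \<psi>1" using U1' by blast
        obtain L where "linear L" and L: "\<And>c V. c 0 = X \<Longrightarrow> \<forall>\<^sub>F s in nhds (0::real). c s \<in> U1 \<Longrightarrow> (c has_vector_derivative V) (at 0) \<Longrightarrow>
            ((\<lambda>s. \<psi>1 (c s)) has_vector_derivative L V) (at 0)"
          using smooth_on_curve_derivative[OF s1 X(1)] by blast
        let ?v = "L (vector_derivative X' (at 0))"
        have "((\<lambda>s. \<psi>1 (X' s)) has_vector_derivative ?v) (at 0)"
          by (rule L[OF X'0 evU dX])
        then have "(k \<circ> (\<lambda>s. \<psi>1 (X' s)) has_derivative frechet_derivative k (at y) \<circ> (\<lambda>s. s *\<^sub>R ?v)) (at 0)"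
          unfolding has_vector_derivative_def using Dk X(3) X'0 by (intro diff_chain_at) auto
        then have 1: "((\<lambda>s. k (\<psi>1 (X' s))) has_vector_derivative frechet_derivative k (at y) ?v) (at 0)"
          using has_derivative_linear[OF Dk] by (simp add: has_vector_derivative_def o_def linear_cmul)
        have "\<forall>\<^sub>F s in nhds 0. k (\<psi>1 (X' s)) = (\<phi> \<circ> coset \<circ> c) s"
          using ev evU by eventually_elim (simp add: k\<psi>1, simp add: X'_def \<psi>_coset)
        from vector_derivative_unique_at[OF has_vector_derivative_transform_eventually[OF 1 this] c(5)]
        show ?thesis by blast
      qed
      then show ?thesis by (metis surjI)
    qed
    from smooth_on_inverse[OF A k_smooth hk this]
    have kA: "open (k ` A)" "smooth_on (k ` A) h" by auto
    have kA_eq: "k ` A = \<psi> ` (U1 \<inter> ?V)"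
      by (auto simp: A_def k\<psi>1 image_image)
    have "\<exists>T. open T \<and> U1 = Gr a b \<inter> T" using U1' by (auto simp: openin_open)
    then obtain T where T: "open T" "U1 = Gr a b \<inter> T" by blast
    have VT: "?V \<inter> T = U1 \<inter> ?V" using VG T(2) by auto
    have "smooth_on (U1 \<inter> ?V) (\<lambda>X. k (\<psi>1 X))"
      by (rule smooth_on_compose[OF smooth_on_subset k_smooth]) (use U1' in \<open>auto simp: A_def\<close>)
    then have sm: "smooth_on (?V \<inter> T) \<psi>"
      unfolding VT by (rule smooth_on_cong) (simp add: k\<psi>1)
    have "X0 \<in> U1" using U1(2) Q(2) by simp
    then have "X0 \<in> T" using T(2) by blast
    with T(1) sm show "\<exists>T. open T \<and> X0 \<in> T \<and> smooth_on (?V \<inter> T) \<psi>" by (intro exI[of _ T] conjI)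
    have im1: "\<psi> ` ?V \<inter> k ` A = k ` A" by (auto simp: kA_eq)
    have i1: "smooth_on (\<psi>1 ` U1) (inv_into U1 \<psi>1)" using U1' by blast
    have "smooth_on (k ` A) (\<lambda>y. inv_into U1 \<psi>1 (h y))"
      by (rule smooth_on_compose[OF kA(2) i1]) (auto simp: hk, auto simp: A_def)
    then have "smooth_on (\<psi> ` ?V \<inter> k ` A) (inv_into ?V \<psi>)"
      unfolding im1
    proof (rule smooth_on_cong)
      fix y assume "y \<in> k ` A"
      then obtain X where X: "X \<in> U1" "X \<in> ?V" "y = \<psi> X" unfolding kA_eq by auto
      have "inv_into ?V \<psi> y = X" using X inj by simp
      then show "inv_into U1 \<psi>1 (h y) = inv_into ?V \<psi> y"
        using U1' X(1) by (simp add: h_def)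
    qed
    moreover have "\<psi> X0 \<in> k ` A" unfolding kA_eq by (rule imageI) (rule IntI[OF \<open>X0 \<in> U1\<close> X0])
    ultimately show "\<exists>T. open T \<and> \<psi> X0 \<in> T \<and> smooth_on (\<psi> ` ?V \<inter> T) (inv_into ?V \<psi>)"
      using kA(1) by (intro exI[of _ "k ` A"] conjI)
  qed
  have "smooth_on ?V \<psi>" by (rule smooth_on_local) (rule local(1))
  moreover have "smooth_on (\<psi> ` ?V) (inv_into ?V \<psi>)"
  proof (rule smooth_on_local)
    fix y assume "y \<in> \<psi> ` ?V"
    then obtain X where "X \<in> ?V" "y = \<psi> X" by (rule imageE)
    then show "\<exists>T. open T \<and> y \<in> T \<and> smooth_on (\<psi> ` ?V \<inter> T) (inv_into ?V \<psi>)"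
      using local(2)[of X] by simp
  qed
  ultimately show ?thesis
    unfolding atlas_quadratic_model \<psi>_def[symmetric] using opV inj im U' by simp
qed

section \<open>The matrix exponential\<close>

definition mpow :: "real^'n::finite^'n \<Rightarrow> nat \<Rightarrow> real^'n^'n" where
  "mpow B i = ((**) B ^^ i) (mat 1)"

lemma mpow_0 [simp]: "mpow B 0 = mat 1"
  and mpow_Suc [simp]: "mpow B (Suc i) = B ** mpow B i"
  by (simp_all add: mpow_def)

lemma mpow_scaleR: "mpow (s *\<^sub>R B) i = s ^ i *\<^sub>R mpow B i"
  by (induction i) (simp_all add: matrix_mult.scaleR_left matrix_mult.scaleR_right)

lemma mexp_eq_power_series: "mexp (s *\<^sub>R B) = (\<Sum>i. (s ^ i / fact i) *\<^sub>R mpow B i)"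
  unfolding mexp_def mpow_def[symmetric] mpow_scaleR by simp

lemma summable_mexp:
  fixes B :: "real^'n::finite^'n"
  shows "summable (\<lambda>i. (s ^ i / fact i) *\<^sub>R mpow B i)"
proof -
  obtain K where K: "K > 0" "\<And>(A :: real^'n^'n) (X :: real^'n^'n). norm (A ** X) \<le> norm A * norm X * K"
    using matrix_mult.pos_bounded by blast
  define C where "C = norm B * K"
  have "norm (mpow B i) \<le> norm (mat 1 :: real^'n^'n) * C ^ i" for i
  proof (induction i)
    case (Suc i)
    have "norm (mpow B (Suc i)) \<le> norm B * norm (mpow B i) * K" using K(2) by simp
    also have "\<dots> = C * norm (mpow B i)" by (simp add: C_def)
    also have "\<dots> \<le> C * (norm (mat 1 :: real^'n^'n) * C ^ i)"
      using K(1) by (intro mult_left_mono Suc) (simp add: C_def)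
    finally show ?case by (simp add: algebra_simps)
  qed simp
  then have le: "norm ((s ^ i / fact i) *\<^sub>R mpow B i) \<le> norm (mat 1 :: real^'n^'n) * (inverse (fact i) * (\<bar>s\<bar> * C) ^ i)" for i
  proof -
    have "norm ((s ^ i / fact i) *\<^sub>R mpow B i) = \<bar>s\<bar> ^ i / fact i * norm (mpow B i)"
      by (simp add: power_abs)
    also have "\<dots> \<le> \<bar>s\<bar> ^ i / fact i * (norm (mat 1 :: real^'n^'n) * C ^ i)"
      by (intro mult_left_mono) (use \<open>\<And>i. norm (mpow B i) \<le> _\<close> in auto)
    finally show ?thesis by (simp add: field_simps power_mult_distrib)
  qed
  have sm: "summable (\<lambda>i. norm (mat 1 :: real^'n^'n) * (inverse (fact i) * (\<bar>s\<bar> * C) ^ i))"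
    by (intro summable_mult summable_exp)
  show ?thesis by (rule summable_comparison_test'[OF sm le])
qed

lemma bounded_linear_entry: "bounded_linear (\<lambda>A :: real^'n::finite^'m::finite. A $ x $ y)"
  by (rule bounded_linear_compose[OF bounded_linear_vec_nth bounded_linear_vec_nth])

text \<open>Each entry of \<open>exp(s B)\<close> is an everywhere convergent real power series in \<open>s\<close>, and termwise
  differentiation shifts the matrix powers by one factor \<open>B\<close>.\<close>

lemma mexp_has_vector_derivative:
  fixes B :: "real^'n::finite^'n"
  shows "((\<lambda>s. mexp (s *\<^sub>R B)) has_vector_derivative B ** mexp (s *\<^sub>R B)) (at s)"
proof -
  have entry: "((\<lambda>s. mexp (s *\<^sub>R B) $ x $ y) has_real_derivative (B ** mexp (s *\<^sub>R B)) $ x $ y) (at s)" for x y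
  proof -
    define c where "c n = mpow B n $ x $ y / fact n" for n
    have sm: "summable (\<lambda>n. c n * r ^ n)" and E: "mexp (r *\<^sub>R B) $ x $ y = (\<Sum>n. c n * r ^ n)" for r
    proof -
      have eq: "((r ^ n / fact n) *\<^sub>R mpow B n) $ x $ y = c n * r ^ n" for n by (simp add: c_def)
      show "summable (\<lambda>n. c n * r ^ n)"
        using bounded_linear.summable[OF bounded_linear_entry summable_mexp, of r B x y] by (simp only: eq)
      show "mexp (r *\<^sub>R B) $ x $ y = (\<Sum>n. c n * r ^ n)"
        unfolding mexp_eq_power_series
        using bounded_linear.suminf[OF bounded_linear_entry summable_mexp, of r B x y] by (simp only: eq)
    qed
    have "((\<lambda>s. \<Sum>n. c n * s ^ n) has_field_derivative (\<Sum>n. diffs c n * s ^ n)) (at s)"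
      by (rule termdiffs_strong_converges_everywhere[OF sm])
    moreover have "(\<Sum>n. diffs c n * s ^ n) = (B ** mexp (s *\<^sub>R B)) $ x $ y"
    proof -
      have bl: "bounded_linear (\<lambda>X :: real^'n^'n. (B ** X) $ x $ y)"
        by (rule bounded_linear_compose[OF bounded_linear_entry matrix_mult.bounded_linear_right])
      have eq: "(B ** ((s ^ n / fact n) *\<^sub>R mpow B n)) $ x $ y = diffs c n * s ^ n" for n
        by (simp add: diffs_def c_def matrix_mult.scaleR_right del: of_nat_Suc)
      show ?thesis
        unfolding mexp_eq_power_series
        using bounded_linear.suminf[OF bl summable_mexp, of s B] by (simp only: eq)
    qed
    ultimately show ?thesis by (simp add: E)
  qed
  show ?thesis
    unfolding has_vector_derivative_def
  proof (subst has_derivative_componentwise_within, rule ballI)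
    fix i :: "real^'n^'n" assume "i \<in> Basis"
    then obtain x y where "i = axis x (axis y 1)" by (auto simp: Basis_vec_def)
    then show "((\<lambda>s. mexp (s *\<^sub>R B) \<bullet> i) has_derivative (\<lambda>h. (h *\<^sub>R (B ** mexp (s *\<^sub>R B))) \<bullet> i)) (at s)"
      using entry[of x y] by (simp add: inner_axis has_field_derivative_def mult.commute[of _ "(B ** mexp (s *\<^sub>R B)) $ x $ y"])
  qed
qed

lemma mexp_zero [simp]: "mexp (0 :: real^'n::finite^'n) = mat 1"
proof -
  have "mexp ((0 :: real) *\<^sub>R (0 :: real^'n^'n)) = (\<Sum>i\<in>{0}. (0 ^ i / fact i) *\<^sub>R mpow 0 i)"
    unfolding mexp_eq_power_series by (rule suminf_finite) auto
  then show ?thesis by simp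
qed

text \<open>For skew-symmetric \<open>B\<close> the derivative of \<open>E\<^sup>T E\<close> with \<open>E = exp(s B)\<close> is \<open>E\<^sup>T (B + B\<^sup>T) E = 0\<close>, so
  \<open>E\<close> stays orthogonal; its determinant, being continuous with values \<open>1\<close> and \<open>-1\<close>, stays \<open>1\<close>.\<close>

lemma mexp_skew_in_SO:
  fixes B :: "real^'n::finite^'n"
  assumes "transpose B = - B"
  shows "mexp (s *\<^sub>R B) \<in> SO"
proof -
  let ?E = "\<lambda>s. mexp (s *\<^sub>R B)"
  have E: "(?E has_vector_derivative B ** ?E s) (at s)" for s by (rule mexp_has_vector_derivative)
  have "((\<lambda>s. transpose (?E s) ** ?E s) has_derivative (\<lambda>h. 0)) (at s)" for s
  proof -
    have t: "((\<lambda>s. transpose (?E s)) has_vector_derivative transpose (B ** ?E s)) (at s)"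
      by (rule bounded_linear.has_vector_derivative[OF bounded_linear_transpose E])
    have "((\<lambda>s. transpose (?E s) ** ?E s) has_derivative
        (\<lambda>h. transpose (?E s) ** (h *\<^sub>R (B ** ?E s)) + (h *\<^sub>R transpose (B ** ?E s)) ** ?E s)) (at s)"
      by (rule matrix_mult.FDERIV[OF t[unfolded has_vector_derivative_def] E[unfolded has_vector_derivative_def]])
    moreover have "transpose (?E s) ** (h *\<^sub>R (B ** ?E s)) + (h *\<^sub>R transpose (B ** ?E s)) ** ?E s = 0" for h
      by (simp add: matrix_transpose_mul assms matrix_mult.scaleR_left matrix_mult.scaleR_right
          matrix_mult.minus_left matrix_mult.minus_right matrix_mul_assoc)
    ultimately show ?thesis by simp
  qed
  then have const: "transpose (?E s) ** ?E s = transpose (?E 0) ** ?E 0" for s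
    by (rule has_derivative_zero_unique[of UNIV _ s 0, simplified])
  then have orth: "orthogonal_matrix (?E s)" for s
    by (simp add: orthogonal_matrix)
  have "continuous_on UNIV ?E"
    using E by (auto intro: continuous_at_imp_continuous_on has_vector_derivative_continuous)
  then have conn: "connected ((\<lambda>s. det (?E s)) ` UNIV)"
    by (intro connected_continuous_image continuous_on_det) auto
  have "det (?E s) = 1"
  proof (rule ccontr)
    assume "det (?E s) \<noteq> 1"
    then have "det (?E s) = -1" using det_orthogonal_matrix[OF orth] by blast
    moreover have "det (?E 0) = 1" by simp
    ultimately have "-1 \<in> (\<lambda>s. det (?E s)) ` UNIV" "1 \<in> (\<lambda>s. det (?E s)) ` UNIV"
      by (metis rangeI)+
    then have "0 \<in> (\<lambda>s. det (?E s)) ` UNIV"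
      by (rule connectedD_interval[OF conn]) simp_all
    then obtain r where "0 = det (?E r)" by (rule imageE)
    then show False using det_orthogonal_matrix[OF orth, of r] by auto
  qed
  with orth show ?thesis by (simp add: SO_def rotation_matrix_def)
qed

section \<open>Tangent vectors of the two models\<close>

lemma quadratic_chart_exists:
  fixes X :: "('k::finite, 'l::finite) bmat"
  assumes "a \<noteq> b" "X \<in> Gr a b"
  obtains V and \<psi> :: "('k, 'l) bmat \<Rightarrow> real^'l^'k" where "(V, \<psi>) \<in> atlas (quadratic_model a b)" "X \<in> V"
proof -
  obtain Q where Q: "Q \<in> SO" "X = orbit_map a b Q" using assms(2) by (auto simp: Gr_eq_orbit)
  show thesis
    by (rule Gr_chart_with_section[OF assms(1) Q(1)]) (use that Q(2) in blast)
qed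

lemma quadratic_chart_subset: "(V, \<psi>) \<in> atlas (quadratic_model a b) \<Longrightarrow> V \<subseteq> Gr a b"
  using openin_subset[of "top_of_set (Gr a b)" V] by (simp add: atlas_quadratic_model)

lemma smooth_curve_quadratic_model_D:
  assumes "smooth_curve (quadratic_model a b) \<eta>"
  obtains \<epsilon> where "\<epsilon> > 0" "\<eta> ` {-\<epsilon><..<\<epsilon>} \<subseteq> Gr a b" "smooth_on {-\<epsilon><..<\<epsilon>} \<eta>"
proof -
  obtain V \<psi> \<epsilon> where V: "(V, \<psi>) \<in> atlas (quadratic_model a b)" "\<epsilon> > 0" "\<eta> ` {-\<epsilon><..<\<epsilon>} \<subseteq> V"
    "smooth_on {-\<epsilon><..<\<epsilon>} (\<psi> \<circ> \<eta>)"
    using assms unfolding smooth_curve_def by blast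
  have inv: "smooth_on (\<psi> ` V) (inv_into V \<psi>)" and inj: "inj_on \<psi> V"
    using V(1) by (simp_all add: atlas_quadratic_model)
  have "smooth_on {-\<epsilon><..<\<epsilon>} (\<lambda>s. inv_into V \<psi> ((\<psi> \<circ> \<eta>) s))"
    by (rule smooth_on_compose[OF V(4) inv]) (use V(3) in auto)
  then have "smooth_on {-\<epsilon><..<\<epsilon>} \<eta>"
    by (rule smooth_on_cong) (use V(3) inj in \<open>auto simp: image_subset_iff\<close>)
  then show thesis
    using that[OF V(2)] V(3) quadratic_chart_subset[OF V(1)] by blast
qed

lemma smooth_curve_quadratic_model_derivative:
  assumes "smooth_curve (quadratic_model a b) \<eta>"
  shows "(\<eta> has_vector_derivative vector_derivative \<eta> (at 0)) (at 0)"
    "\<forall>\<^sub>F s in nhds 0. \<eta> s \<in> Gr a b"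
proof -
  obtain \<epsilon> where \<epsilon>: "\<epsilon> > 0" "\<eta> ` {-\<epsilon><..<\<epsilon>} \<subseteq> Gr a b" "smooth_on {-\<epsilon><..<\<epsilon>} \<eta>"
    by (rule smooth_curve_quadratic_model_D[OF assms])
  show "(\<eta> has_vector_derivative vector_derivative \<eta> (at 0)) (at 0)"
    by (rule smooth_on_curve_has_derivative[OF \<epsilon>(3,1)])
  show "\<forall>\<^sub>F s in nhds 0. \<eta> s \<in> Gr a b"
    using eventually_interval[OF \<epsilon>(1)] by eventually_elim (use \<epsilon>(2) in auto)
qed

lemma quadratic_chart_derivative:
  assumes V: "(V, \<psi>) \<in> atlas (quadratic_model a b)" "X \<in> V"
  obtains L where "linear L"
    "\<And>c v. c 0 = X \<Longrightarrow> \<forall>\<^sub>F s in nhds (0::real). c s \<in> Gr a b \<Longrightarrow> (c has_vector_derivative v) (at 0) \<Longrightarrow>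
        ((\<lambda>s. \<psi> (c s)) has_vector_derivative L v) (at 0)"
proof -
  have s: "smooth_on V \<psi>" and o: "openin (top_of_set (Gr a b)) V"
    using V(1) by (simp_all add: atlas_quadratic_model)
  obtain L where L: "linear L"
    "\<And>c v. c 0 = X \<Longrightarrow> \<forall>\<^sub>F s in nhds (0::real). c s \<in> V \<Longrightarrow> (c has_vector_derivative v) (at 0) \<Longrightarrow>
        ((\<lambda>s. \<psi> (c s)) has_vector_derivative L v) (at 0)"
    using smooth_on_curve_derivative[OF s V(2)] by blast
  show thesis
  proof (rule that[OF L(1)])
    fix c v assume c: "c 0 = X" "\<forall>\<^sub>F s in nhds (0::real). c s \<in> Gr a b" "(c has_vector_derivative v) (at 0)"
    have "\<forall>\<^sub>F s in nhds 0. c s \<in> V"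
      by (rule curve_eventually_in[OF c(3,2) o]) (simp add: c(1) V(2))
    with c show "((\<lambda>s. \<psi> (c s)) has_vector_derivative L v) (at 0)" by (intro L(2))
  qed
qed

text \<open>Near parameter \<open>0\<close> a curve is the composition of the inverse chart with its coordinate
  expression, so its derivative as a curve of matrices is a fixed linear image of the coordinate
  velocity.\<close>

lemma ambient_derivative_determined_by_chart:
  assumes V: "(V, \<psi>) \<in> atlas (quadratic_model a b)" "\<eta>1 0 \<in> V"
    and \<eta>: "smooth_curve (quadratic_model a b) \<eta>1" "smooth_curve (quadratic_model a b) \<eta>2" "\<eta>2 0 = \<eta>1 0"
    and eq: "vector_derivative (\<psi> \<circ> \<eta>2) (at 0) = vector_derivative (\<psi> \<circ> \<eta>1) (at 0)"
  shows "vector_derivative \<eta>2 (at 0) = vector_derivative \<eta>1 (at 0)"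
proof -
  have o: "openin (top_of_set (Gr a b)) V" and inv: "smooth_on (\<psi> ` V) (inv_into V \<psi>)" and inj: "inj_on \<psi> V"
    using V(1) by (simp_all add: atlas_quadratic_model)
  obtain L where L: "linear L"
    "\<And>c v. c 0 = \<eta>1 0 \<Longrightarrow> \<forall>\<^sub>F s in nhds (0::real). c s \<in> Gr a b \<Longrightarrow> (c has_vector_derivative v) (at 0) \<Longrightarrow>
        ((\<lambda>s. \<psi> (c s)) has_vector_derivative L v) (at 0)"
    using quadratic_chart_derivative[OF V] by blast
  obtain L' where L': "linear L'"
    "\<And>c v. c 0 = \<psi> (\<eta>1 0) \<Longrightarrow> \<forall>\<^sub>F s in nhds (0::real). c s \<in> \<psi> ` V \<Longrightarrow> (c has_vector_derivative v) (at 0) \<Longrightarrow>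
        ((\<lambda>s. inv_into V \<psi> (c s)) has_vector_derivative L' v) (at 0)"
    using smooth_on_curve_derivative[OF inv, of "\<psi> (\<eta>1 0)"] V(2) by blast
  have *: "vector_derivative \<eta> (at 0) = L' (vector_derivative (\<psi> \<circ> \<eta>) (at 0))"
    if \<eta>: "smooth_curve (quadratic_model a b) \<eta>" "\<eta> 0 = \<eta>1 0" for \<eta>
  proof -
    note d = smooth_curve_quadratic_model_derivative[OF \<eta>(1)]
    have ev: "\<forall>\<^sub>F s in nhds 0. \<eta> s \<in> V"
      by (rule curve_eventually_in[OF d o]) (simp add: \<eta>(2) V(2))
    have d\<psi>: "((\<lambda>s. \<psi> (\<eta> s)) has_vector_derivative vector_derivative (\<psi> \<circ> \<eta>) (at 0)) (at 0)"
      using L(2)[OF \<eta>(2) d(2,1)] vector_derivative_at by (fastforce simp: o_def)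
    have "\<forall>\<^sub>F s in nhds 0. \<psi> (\<eta> s) \<in> \<psi> ` V"
      using ev by eventually_elim (rule imageI)
    then have "((\<lambda>s. inv_into V \<psi> (\<psi> (\<eta> s))) has_vector_derivative L' (vector_derivative (\<psi> \<circ> \<eta>) (at 0))) (at 0)"
      by (intro L'(2) d\<psi>) (simp_all add: \<eta>(2))
    moreover have "\<forall>\<^sub>F s in nhds 0. inv_into V \<psi> (\<psi> (\<eta> s)) = \<eta> s"
      using ev by eventually_elim (simp add: inj)
    ultimately have "(\<eta> has_vector_derivative L' (vector_derivative (\<psi> \<circ> \<eta>) (at 0))) (at 0)"
      by (rule has_vector_derivative_transform_eventually)
    then show ?thesis by (rule vector_derivative_at)
  qed
  show ?thesis
    unfolding *[OF \<eta>(2,3)] *[OF \<eta>(1) refl] eq ..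
qed

lemma velocity_self: "smooth_curve M \<gamma> \<Longrightarrow> \<gamma> \<in> velocity M \<gamma>"
  by (auto simp: velocity_def)

lemma the_elem_image_const:
  assumes "x \<in> A" "\<And>y. y \<in> A \<Longrightarrow> f y = z" shows "the_elem (f ` A) = z"
proof -
  have "f ` A = {z}" using assms by force
  then show ?thesis by simp
qed

lemma velocity_cong:
  assumes "\<gamma>1 0 = \<gamma>2 0"
    and "\<And>U \<phi>. (U, \<phi>) \<in> atlas M \<Longrightarrow> \<gamma>2 0 \<in> U \<Longrightarrow>
      vector_derivative (\<phi> \<circ> \<gamma>1) (at 0) = vector_derivative (\<phi> \<circ> \<gamma>2) (at 0)"
  shows "velocity M \<gamma>1 = velocity M \<gamma>2"
  unfolding velocity_def using assms by (intro Collect_cong) auto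

text \<open>Ensures that \<open>the_elem\<close> in \<open>ambient_vector\<close> meets a singleton: equivalent curves have equal
  derivatives as curves of matrices.\<close>

lemma ambient_vector_velocity:
  fixes \<eta> :: "real \<Rightarrow> ('k::finite, 'l::finite) bmat"
  assumes "a \<noteq> b" and \<eta>: "smooth_curve (quadratic_model a b) \<eta>"
  shows "ambient_vector (velocity (quadratic_model a b) \<eta>) = vector_derivative \<eta> (at 0)"
  unfolding ambient_vector_def
proof (rule the_elem_image_const[OF velocity_self[OF \<eta>]])
  fix \<delta> assume \<delta>: "\<delta> \<in> velocity (quadratic_model a b) \<eta>"
  have "\<eta> 0 \<in> Gr a b"
    by (rule eventually_nhds_x_imp_x[OF smooth_curve_quadratic_model_derivative(2)[OF \<eta>]])
  then obtain V and \<psi> :: "('k, 'l) bmat \<Rightarrow> real^'l^'k" where V: "(V, \<psi>) \<in> atlas (quadratic_model a b)" "\<eta> 0 \<in> V"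
    by (rule quadratic_chart_exists[OF assms(1)])
  show "vector_derivative \<delta> (at 0) = vector_derivative \<eta> (at 0)"
    by (rule ambient_derivative_determined_by_chart[OF V \<eta>]) (use \<delta> V in \<open>auto simp: velocity_def\<close>)
qed

lemma velocity_quadratic_model_eq:
  fixes \<eta>1 \<eta>2 :: "real \<Rightarrow> ('k::finite, 'l::finite) bmat"
  assumes "\<eta>1 0 = \<eta>2 0" "\<forall>\<^sub>F s in nhds 0. \<eta>1 s \<in> Gr a b" "\<forall>\<^sub>F s in nhds 0. \<eta>2 s \<in> Gr a b"
    and "(\<eta>1 has_vector_derivative v) (at 0)" "(\<eta>2 has_vector_derivative v) (at 0)"
  shows "velocity (quadratic_model a b) \<eta>1 = velocity (quadratic_model a b) \<eta>2"
proof (rule velocity_cong[of \<eta>1 \<eta>2, OF assms(1)])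
  fix U and \<phi> :: "('k, 'l) bmat \<Rightarrow> real^'l^'k" assume U: "(U, \<phi>) \<in> atlas (quadratic_model a b)" "\<eta>2 0 \<in> U"
  obtain L where L: "linear L"
    "\<And>c v. c 0 = \<eta>2 0 \<Longrightarrow> \<forall>\<^sub>F s in nhds (0::real). c s \<in> Gr a b \<Longrightarrow> (c has_vector_derivative v) (at 0) \<Longrightarrow>
        ((\<lambda>s. \<phi> (c s)) has_vector_derivative L v) (at 0)"
    using quadratic_chart_derivative[OF U] by blast
  show "vector_derivative (\<phi> \<circ> \<eta>1) (at 0) = vector_derivative (\<phi> \<circ> \<eta>2) (at 0)"
    unfolding o_def vector_derivative_at[OF L(2)[OF assms(1,2,4)]] vector_derivative_at[OF L(2)[OF refl assms(3,5)]] ..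
qed

lemma smooth_curve_phi5_inv:
  fixes \<gamma> :: "real \<Rightarrow> ('k::finite, 'l::finite) bmat set"
  assumes "a \<noteq> b" "smooth_curve quotient_model \<gamma>"
  shows "smooth_curve (quadratic_model a b) (phi5_inv a b \<circ> \<gamma>)"
    "\<forall>\<^sub>F s in nhds 0. \<gamma> s \<in> points quotient_model"
proof -
  obtain U and \<phi> :: "('k, 'l) bmat set \<Rightarrow> real^'l^'k" and \<epsilon> where U: "(U, \<phi>) \<in> atlas quotient_model" "\<epsilon> > 0" "\<gamma> ` {-\<epsilon><..<\<epsilon>} \<subseteq> U"
    "smooth_on {-\<epsilon><..<\<epsilon>} (\<phi> \<circ> \<gamma>)"
    using assms(2) unfolding smooth_curve_def by blast
  have Up: "U \<subseteq> points quotient_model"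
    using U(1) openin_subset[of "mtop quotient_model" U] by (simp add: atlas_quotient_model)
  show "\<forall>\<^sub>F s in nhds 0. \<gamma> s \<in> points quotient_model"
    using eventually_interval[OF U(2)] by eventually_elim (use U(3) Up in \<open>auto simp: image_subset_iff subset_iff\<close>)
  have "smooth_on {-\<epsilon><..<\<epsilon>} ((\<phi> \<circ> inv_into (points quotient_model) (phi5_inv a b)) \<circ> (phi5_inv a b \<circ> \<gamma>))"
  proof (rule smooth_on_cong[OF U(4)])
    fix s assume "s \<in> {-\<epsilon><..<\<epsilon>}"
    then have "\<gamma> s \<in> points quotient_model" using U(3) Up by (auto simp: image_subset_iff subset_iff)
    then show "(\<phi> \<circ> \<gamma>) s = ((\<phi> \<circ> inv_into (points quotient_model) (phi5_inv a b)) \<circ> (phi5_inv a b \<circ> \<gamma>)) s"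
      by (simp add: inv_phi5_inv[OF assms(1)])
  qed
  moreover have "(phi5_inv a b \<circ> \<gamma>) ` {-\<epsilon><..<\<epsilon>} \<subseteq> phi5_inv a b ` U" using U(3) by auto
  ultimately show "smooth_curve (quadratic_model a b) (phi5_inv a b \<circ> \<gamma>)"
    unfolding smooth_curve_def
    using quadratic_chart_of_quotient_chart[OF assms(1) U(1)] U(2) by (intro bexI) auto
qed

lemma smooth_curve_coset:
  fixes a b :: real and c :: "real \<Rightarrow> ('k::finite, 'l::finite) bmat"
  assumes "a \<noteq> b" "smooth_on UNIV c" "\<And>s. c s \<in> SO"
  shows "smooth_curve quotient_model (\<lambda>s. coset (c s))"
proof -
  have X: "smooth_on UNIV (\<lambda>s. orbit_map a b (c s))"
    by (rule smooth_on_compose[OF assms(2) smooth_on_orbit_map[of UNIV]]) simp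
  have G: "orbit_map a b (c s) \<in> Gr a b" for s using assms(3) by (simp add: Gr_eq_orbit)
  obtain V and \<psi> :: "('k, 'l) bmat \<Rightarrow> real^'l^'k" where V: "(V, \<psi>) \<in> atlas (quadratic_model a b)" "orbit_map a b (c 0) \<in> V"
    by (rule quadratic_chart_exists[OF assms(1) G])
  have o: "openin (top_of_set (Gr a b)) V" and s\<psi>: "smooth_on V \<psi>"
    using V(1) by (simp_all add: atlas_quadratic_model)
  have "((\<lambda>s. orbit_map a b (c s)) has_vector_derivative vector_derivative (\<lambda>s. orbit_map a b (c s)) (at 0)) (at 0)"
    by (rule smooth_on_curve_has_derivative[OF smooth_on_subset[OF X], of 1]) auto
  then have "\<forall>\<^sub>F s in nhds 0. orbit_map a b (c s) \<in> V"
    by (rule curve_eventually_in[OF _ _ o]) (use G V(2) in auto)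
  then obtain \<epsilon> where \<epsilon>: "\<epsilon> > 0" "\<And>s. dist s 0 < \<epsilon> \<Longrightarrow> orbit_map a b (c s) \<in> V"
    by (auto simp: eventually_nhds_metric)
  have inV: "orbit_map a b (c s) \<in> V" if "s \<in> {-\<epsilon><..<\<epsilon>}" for s
    using \<epsilon>(2)[of s] that by (auto simp: dist_norm)
  have "smooth_on {-\<epsilon><..<\<epsilon>} (\<lambda>s. \<psi> (orbit_map a b (c s)))"
    by (rule smooth_on_compose[OF smooth_on_subset[OF X] s\<psi>]) (use inV in auto)
  then have "smooth_on {-\<epsilon><..<\<epsilon>} ((\<psi> \<circ> phi5_inv a b) \<circ> (\<lambda>s. coset (c s)))"
    by (simp add: o_def phi5_inv_coset[OF assms(1,3)])
  moreover have "(\<lambda>s. coset (c s)) ` {-\<epsilon><..<\<epsilon>} \<subseteq> {x \<in> points quotient_model. phi5_inv a b x \<in> V}"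
    using inV assms(3) by (auto simp: points_quotient_model phi5_inv_coset[OF assms(1,3)])
  ultimately show ?thesis
    unfolding smooth_curve_def
    using quotient_chart_of_quadratic_chart[OF assms(1) V(1)] \<epsilon>(1) by (intro bexI) auto
qed

text \<open>Since every chart of the quotient comes from a chart of the quadratic model, two curves of cosets
  are equivalent as soon as the corresponding curves of matrices have the same derivative. Asking
  only for a derivative at the parameter \<open>0\<close> makes this applicable to curves built from the
  exponential.\<close>

lemma velocity_quotient_model_eq:
  fixes \<gamma>1 \<gamma>2 :: "real \<Rightarrow> ('k::finite, 'l::finite) bmat set"
  assumes "a \<noteq> b" "\<gamma>1 0 = \<gamma>2 0"
    and ev: "\<forall>\<^sub>F s in nhds 0. \<gamma>1 s \<in> points quotient_model" "\<forall>\<^sub>F s in nhds 0. \<gamma>2 s \<in> points quotient_model"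
    and d: "((phi5_inv a b \<circ> \<gamma>1) has_vector_derivative v) (at 0)" "((phi5_inv a b \<circ> \<gamma>2) has_vector_derivative v) (at 0)"
  shows "velocity quotient_model \<gamma>1 = velocity quotient_model \<gamma>2"
proof (rule velocity_cong[of \<gamma>1 \<gamma>2, OF assms(2)])
  fix U and \<phi> :: "('k, 'l) bmat set \<Rightarrow> real^'l^'k"
  assume U: "(U, \<phi>) \<in> atlas quotient_model" "\<gamma>2 0 \<in> U"
  let ?\<psi> = "\<phi> \<circ> inv_into (points quotient_model) (phi5_inv a b)"
  have V: "(phi5_inv a b ` U, ?\<psi>) \<in> atlas (quadratic_model a b)"
    by (rule quadratic_chart_of_quotient_chart[OF assms(1) U(1)])
  have 0: "(phi5_inv a b \<circ> \<gamma>2) 0 \<in> phi5_inv a b ` U" using U(2) by simp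
  obtain L where L: "linear L"
    "\<And>c v. c 0 = (phi5_inv a b \<circ> \<gamma>2) 0 \<Longrightarrow> \<forall>\<^sub>F s in nhds (0::real). c s \<in> Gr a b \<Longrightarrow> (c has_vector_derivative v) (at 0) \<Longrightarrow>
        ((\<lambda>s. ?\<psi> (c s)) has_vector_derivative L v) (at 0)"
    using quadratic_chart_derivative[OF V 0] by blast
  have *: "vector_derivative (\<phi> \<circ> \<gamma>) (at 0) = L v"
    if \<gamma>: "\<gamma> 0 = \<gamma>2 0" "\<forall>\<^sub>F s in nhds 0. \<gamma> s \<in> points quotient_model" "((phi5_inv a b \<circ> \<gamma>) has_vector_derivative v) (at 0)" for \<gamma>
  proof -
    have "\<forall>\<^sub>F s in nhds 0. (phi5_inv a b \<circ> \<gamma>) s \<in> Gr a b"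
      using \<gamma>(2) by eventually_elim (use bij_betwE[OF bij_betw_phi5_inv[OF assms(1)]] in auto)
    then have "((\<lambda>s. ?\<psi> ((phi5_inv a b \<circ> \<gamma>) s)) has_vector_derivative L v) (at 0)"
      by (intro L(2) \<gamma>(3)) (simp add: \<gamma>(1))
    moreover have "\<forall>\<^sub>F s in nhds 0. ?\<psi> ((phi5_inv a b \<circ> \<gamma>) s) = (\<phi> \<circ> \<gamma>) s"
      using \<gamma>(2) by eventually_elim (simp add: inv_phi5_inv[OF assms(1)])
    ultimately have "((\<phi> \<circ> \<gamma>) has_vector_derivative L v) (at 0)"
      by (rule has_vector_derivative_transform_eventually)
    then show ?thesis by (rule vector_derivative_at)
  qed
  show "vector_derivative (\<phi> \<circ> \<gamma>1) (at 0) = vector_derivative (\<phi> \<circ> \<gamma>2) (at 0)"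
    unfolding *[OF assms(2) ev(1) d(1)] *[OF refl ev(2) d(2)] ..
qed

text \<open>The converse of \<open>velocity_quotient_model_eq\<close>: a chart of the quadratic model around the base
  point is also a chart of the quotient, so equivalent curves of cosets have image curves with
  equal coordinate velocities.\<close>

lemma velocity_quotient_model_derivative:
  fixes \<gamma> \<delta> :: "real \<Rightarrow> ('k::finite, 'l::finite) bmat set"
  assumes "a \<noteq> b" and \<gamma>: "smooth_curve quotient_model \<gamma>" and \<delta>: "\<delta> \<in> velocity quotient_model \<gamma>"
  shows "vector_derivative (phi5_inv a b \<circ> \<delta>) (at 0) = vector_derivative (phi5_inv a b \<circ> \<gamma>) (at 0)"
proof -
  have \<delta>': "smooth_curve quotient_model \<delta>" "\<delta> 0 = \<gamma> 0"
    using \<delta> by (auto simp: velocity_def)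
  have 0: "\<gamma> 0 \<in> points quotient_model"
    by (rule eventually_nhds_x_imp_x[OF smooth_curve_phi5_inv(2)[OF assms(1) \<gamma>]])
  then have "phi5_inv a b (\<gamma> 0) \<in> Gr a b"
    using bij_betwE[OF bij_betw_phi5_inv[OF assms(1)]] by blast
  then obtain V and \<psi> :: "('k, 'l) bmat \<Rightarrow> real^'l^'k" where V: "(V, \<psi>) \<in> atlas (quadratic_model a b)" "phi5_inv a b (\<gamma> 0) \<in> V"
    by (rule quadratic_chart_exists[OF assms(1)])
  have "({c \<in> points quotient_model. phi5_inv a b c \<in> V}, \<psi> \<circ> phi5_inv a b) \<in> atlas quotient_model"
    by (rule quotient_chart_of_quadratic_chart[OF assms(1) V(1)])
  then have "vector_derivative ((\<psi> \<circ> phi5_inv a b) \<circ> \<delta>) (at 0) = vector_derivative ((\<psi> \<circ> phi5_inv a b) \<circ> \<gamma>) (at 0)"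
    using \<delta> 0 V(2) by (fastforce simp: velocity_def)
  then show ?thesis
    using V \<delta>'(2) by (intro ambient_derivative_determined_by_chart[OF V(1) _ smooth_curve_phi5_inv(1)[OF assms(1) \<gamma>]
        smooth_curve_phi5_inv(1)[OF assms(1) \<delta>'(1)]]) (simp_all add: o_assoc)
qed


lemma differential_phi5_inv:
  fixes \<gamma> :: "real \<Rightarrow> ('k::finite, 'l::finite) bmat set"
  assumes "a \<noteq> b" and \<gamma>: "smooth_curve quotient_model \<gamma>"
  shows "differential (quadratic_model a b) (phi5_inv a b) (velocity quotient_model \<gamma>) =
    velocity (quadratic_model a b) (phi5_inv a b \<circ> \<gamma>)"
  unfolding differential_def
proof (rule the_elem_image_const[OF velocity_self[OF \<gamma>]])
  fix \<delta> assume \<delta>: "\<delta> \<in> velocity quotient_model \<gamma>"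
  then have \<delta>': "smooth_curve quotient_model \<delta>" "\<delta> 0 = \<gamma> 0"
    by (auto simp: velocity_def)
  note d = smooth_curve_quadratic_model_derivative[OF smooth_curve_phi5_inv(1)[OF assms(1) \<delta>'(1)]]
  note g = smooth_curve_quadratic_model_derivative[OF smooth_curve_phi5_inv(1)[OF assms(1) \<gamma>]]
  show "velocity (quadratic_model a b) (phi5_inv a b \<circ> \<delta>) = velocity (quadratic_model a b) (phi5_inv a b \<circ> \<gamma>)"
    by (rule velocity_quadratic_model_eq[OF _ d(2) g(2)
          d(1)[unfolded velocity_quotient_model_derivative[OF assms(1) \<gamma> \<delta>]] g(1)]) (simp add: \<delta>'(2))
qed

lemma translate_coset: "translate Q (coset P) = coset (Q ** P)"
  by (auto simp: translate_def coset_def matrix_mul_assoc image_def)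

lemma phi5_inv_translate:
  assumes "a \<noteq> b" "Q \<in> SO" "c \<in> points quotient_model"
  shows "phi5_inv a b (translate Q c) = Q ** phi5_inv a b c ** transpose Q"
proof -
  obtain P where P: "P \<in> SO" "c = coset P" using assms(3) by (auto simp: points_quotient_model)
  then show ?thesis
    by (simp add: translate_coset phi5_inv_coset[OF assms(1)] SO_mult[OF assms(2)] orbit_map_mult)
qed

lemma translate_points:
  assumes "Q \<in> SO" "c \<in> points quotient_model"
  shows "translate Q c \<in> points quotient_model"
  using assms by (auto simp: points_quotient_model translate_coset SO_mult)

text \<open>Neither side mentions \<open>a\<close> and \<open>b\<close>; the quadratic model for the values \<open>0\<close> and \<open>1\<close> (the projections
  of rank \<open>n - k\<close>) serves as an auxiliary coordinate system in which translation by \<open>Q\<close> becomes the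
  linear map \<open>X \<mapsto> Q X Q\<^sup>T\<close>.\<close>

lemma differential_translate:
  fixes \<gamma> :: "real \<Rightarrow> ('k::finite, 'l::finite) bmat set"
  assumes Q: "Q \<in> SO" and \<gamma>: "smooth_curve quotient_model \<gamma>"
  shows "differential quotient_model (translate Q) (velocity quotient_model \<gamma>) =
    velocity quotient_model (translate Q \<circ> \<gamma>)"
  unfolding differential_def
proof (rule the_elem_image_const[OF velocity_self[OF \<gamma>]])
  have ab: "(0::real) \<noteq> 1" by simp
  let ?f = "phi5_inv 0 1"
  have deriv: "((?f \<circ> (translate Q \<circ> \<delta>)) has_vector_derivative
      Q ** vector_derivative (?f \<circ> \<delta>) (at 0) ** transpose Q) (at 0)"
    "\<forall>\<^sub>F s in nhds 0. (translate Q \<circ> \<delta>) s \<in> points quotient_model"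
    if \<delta>: "smooth_curve quotient_model \<delta>" for \<delta> :: "real \<Rightarrow> ('k, 'l) bmat set"
  proof -
    note ev = smooth_curve_phi5_inv(2)[OF ab \<delta>]
    have "((?f \<circ> \<delta>) has_vector_derivative vector_derivative (?f \<circ> \<delta>) (at 0)) (at 0)"
      by (rule smooth_curve_quadratic_model_derivative(1)[OF smooth_curve_phi5_inv(1)[OF ab \<delta>]])
    then have "((\<lambda>s. Q ** (?f \<circ> \<delta>) s ** transpose Q) has_vector_derivative
        Q ** vector_derivative (?f \<circ> \<delta>) (at 0) ** transpose Q) (at 0)"
      by (rule bounded_linear.has_vector_derivative[OF matrix_mult.bounded_linear_left
            bounded_linear.has_vector_derivative[OF matrix_mult.bounded_linear_right]])
    moreover have "\<forall>\<^sub>F s in nhds 0. Q ** (?f \<circ> \<delta>) s ** transpose Q = (?f \<circ> (translate Q \<circ> \<delta>)) s"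
      using ev by eventually_elim (simp add: phi5_inv_translate[OF ab Q])
    ultimately show "((?f \<circ> (translate Q \<circ> \<delta>)) has_vector_derivative
      Q ** vector_derivative (?f \<circ> \<delta>) (at 0) ** transpose Q) (at 0)"
      by (rule has_vector_derivative_transform_eventually)
    show "\<forall>\<^sub>F s in nhds 0. (translate Q \<circ> \<delta>) s \<in> points quotient_model"
      using ev by eventually_elim (simp add: translate_points[OF Q])
  qed
  fix \<delta> assume \<delta>: "\<delta> \<in> velocity quotient_model \<gamma>"
  then have \<delta>': "smooth_curve quotient_model \<delta>" "\<delta> 0 = \<gamma> 0"
    by (auto simp: velocity_def)
  show "velocity quotient_model (translate Q \<circ> \<delta>) = velocity quotient_model (translate Q \<circ> \<gamma>)"
    by (rule velocity_quotient_model_eq[OF ab _ deriv(2)[OF \<delta>'(1)] deriv(2)[OF \<gamma>]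
          deriv(1)[OF \<delta>'(1), unfolded velocity_quotient_model_derivative[OF ab \<gamma> \<delta>]] deriv(1)[OF \<gamma>]])
      (simp add: \<delta>'(2))
qed

lemma m_space_eq_offdiag: "m_space = range offdiag"
  by (auto simp: m_space_def offdiag_def)

lemma mexp_coset_curve:
  assumes "a \<noteq> b" "Q \<in> SO"
  shows "((phi5_inv a b \<circ> (\<lambda>s. coset (Q ** mexp (s *\<^sub>R offdiag h)))) has_vector_derivative
      Q ** (offdiag h ** two_scalars a b - two_scalars a b ** offdiag h) ** transpose Q) (at 0)"
    "coset (Q ** mexp (s *\<^sub>R offdiag h)) \<in> points quotient_model"
proof -
  have SO: "Q ** mexp (s *\<^sub>R offdiag h) \<in> SO" for s
    by (intro SO_mult assms(2) mexp_skew_in_SO offdiag_skew)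
  have "((\<lambda>s. mexp (s *\<^sub>R offdiag h)) has_vector_derivative offdiag h) (at 0)"
    using mexp_has_vector_derivative[of "offdiag h" 0] by simp
  then show "((phi5_inv a b \<circ> (\<lambda>s. coset (Q ** mexp (s *\<^sub>R offdiag h)))) has_vector_derivative
      Q ** (offdiag h ** two_scalars a b - two_scalars a b ** offdiag h) ** transpose Q) (at 0)"
    unfolding o_def phi5_inv_coset[OF assms(1) SO]
    by (intro orbit_curve_derivative offdiag_skew) simp_all
  show "coset (Q ** mexp (s *\<^sub>R offdiag h)) \<in> points quotient_model"
    using SO by (simp add: points_quotient_model)
qed

lemma cayley_curve_derivative:
  assumes "(t has_vector_derivative h) (at 0)" "t 0 = 0"
  shows "((\<lambda>s. cayley (offdiag (t s))) has_vector_derivative offdiag (2 *\<^sub>R h)) (at 0)"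
proof -
  have "((\<lambda>t. cayley (offdiag t)) \<circ> t has_derivative (\<lambda>h. 2 *\<^sub>R offdiag h) \<circ> (\<lambda>s. s *\<^sub>R h)) (at 0)"
    using assms cayley_offdiag_has_derivative unfolding has_vector_derivative_def by (intro diff_chain_at) auto
  moreover have "(\<lambda>h. 2 *\<^sub>R offdiag h) \<circ> (\<lambda>s. s *\<^sub>R h) = (\<lambda>s. s *\<^sub>R offdiag (2 *\<^sub>R h))"
    by (simp add: fun_eq_iff linear_cmul[OF bounded_linear.linear[OF bounded_linear_offdiag]])
  ultimately show ?thesis by (simp add: has_vector_derivative_def o_def)
qed

text \<open>The factor \<open>1/2\<close> compensates the derivative \<open>2\<close> of the Cayley transform, so that this curve has the
  same velocity as \<open>[[Q exp(s S(h))]]\<close> while its smoothness is immediate.\<close>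

definition cayley_coset_curve :: "('k::finite, 'l::finite) bmat \<Rightarrow> real^'l^'k \<Rightarrow> real \<Rightarrow> ('k, 'l) bmat set" where
  "cayley_coset_curve Q h s = coset (Q ** cayley (offdiag ((s / 2) *\<^sub>R h)))"

lemma cayley_coset_curve:
  fixes Q :: "('k::finite, 'l::finite) bmat"
  assumes "a \<noteq> b" "Q \<in> SO"
  shows "smooth_curve quotient_model (cayley_coset_curve Q h)"
    "((phi5_inv a b \<circ> cayley_coset_curve Q h) has_vector_derivative
      Q ** (offdiag h ** two_scalars a b - two_scalars a b ** offdiag h) ** transpose Q) (at 0)"
    "cayley_coset_curve Q h s \<in> points quotient_model"
    "cayley_coset_curve Q h 0 = coset Q"
proof -
  define t where "t s = (s / 2) *\<^sub>R h" for s
  have SO: "Q ** cayley (offdiag (t s)) \<in> SO" for s by (rule mult_cayley_in_SO[OF assms(2)])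
  have curve: "cayley_coset_curve Q h = (\<lambda>s. coset (Q ** cayley (offdiag (t s))))"
    by (simp add: fun_eq_iff cayley_coset_curve_def t_def)
  have lin: "bounded_linear t"
    unfolding t_def by (intro bounded_linear_compose[OF bounded_linear_scaleR_left] bounded_linear_divide)
  show "smooth_curve quotient_model (cayley_coset_curve Q h)"
    unfolding curve
    by (rule smooth_curve_coset[OF assms(1) smooth_on_mult_cayley[OF smooth_on_if_bounded_linear[OF lin]] SO])
  have "(t has_vector_derivative (1/2) *\<^sub>R h) (at 0)"
    unfolding t_def by (auto intro!: derivative_eq_intros)
  then have "((\<lambda>s. cayley (offdiag (t s))) has_vector_derivative offdiag (2 *\<^sub>R ((1/2) *\<^sub>R h))) (at 0)"
    by (rule cayley_curve_derivative) (simp add: t_def)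
  then have "((\<lambda>s. orbit_map a b (Q ** cayley (offdiag (t s)))) has_vector_derivative
      Q ** (offdiag h ** two_scalars a b - two_scalars a b ** offdiag h) ** transpose Q) (at 0)"
    by (intro orbit_curve_derivative offdiag_skew) (simp_all add: t_def)
  then show "((phi5_inv a b \<circ> cayley_coset_curve Q h) has_vector_derivative
      Q ** (offdiag h ** two_scalars a b - two_scalars a b ** offdiag h) ** transpose Q) (at 0)"
    unfolding curve by (simp only: o_def phi5_inv_coset[OF assms(1) SO])
  show "cayley_coset_curve Q h s \<in> points quotient_model"
    unfolding curve using SO by (simp add: points_quotient_model)
  show "cayley_coset_curve Q h 0 = coset Q"
    unfolding curve by (simp add: t_def)
qed

text \<open>Velocities in the quotient do not involve \<open>a\<close> and \<open>b\<close>, so they may be compared in the quadratic model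
  for the values \<open>0\<close> and \<open>1\<close>.\<close>

lemma velocity_cayley_eq_velocity_mexp:
  "velocity quotient_model (cayley_coset_curve (mat 1) h) =
    velocity quotient_model (\<lambda>s. coset (mexp (s *\<^sub>R offdiag h)))"
proof -
  have ab: "(0::real) \<noteq> 1" by simp
  note e = mexp_coset_curve[OF ab one_in_SO, where h = h, unfolded matrix_mul_lid]
  note c = cayley_coset_curve[OF ab one_in_SO, where h = h, unfolded matrix_mul_lid]
  show ?thesis
    by (rule velocity_quotient_model_eq[OF ab _ _ _ c(2) e(1)]) (simp_all add: c(3,4) e(2))
qed

text \<open>Lift the image of \<open>\<gamma>\<close> in the quadratic model to a curve \<open>Q cay(S(t(s)))\<close> of rotations starting at \<open>Q\<close>.
  With \<open>h = 2 t'(0)\<close>, it has the same derivative at \<open>0\<close> as \<open>Q exp(s S(h))\<close>.\<close>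

lemma tangent_vector_from_mexp:
  fixes \<gamma> :: "real \<Rightarrow> ('k::finite, 'l::finite) bmat set"
  assumes "a \<noteq> b" "Q \<in> SO" and \<gamma>: "smooth_curve quotient_model \<gamma>" "\<gamma> 0 = coset Q"
  obtains h where
    "vector_derivative (phi5_inv a b \<circ> \<gamma>) (at 0) =
       Q ** (offdiag h ** two_scalars a b - two_scalars a b ** offdiag h) ** transpose Q"
    "velocity quotient_model \<gamma> =
       differential quotient_model (translate Q) (velocity quotient_model (\<lambda>s. coset (mexp (s *\<^sub>R offdiag h))))"
proof -
  let ?X = "phi5_inv a b \<circ> \<gamma>"
  have smX: "smooth_curve (quadratic_model a b) ?X"
    by (rule smooth_curve_phi5_inv(1)[OF assms(1) \<gamma>(1)])
  obtain \<epsilon> where \<epsilon>: "\<epsilon> > 0" "?X ` {-\<epsilon><..<\<epsilon>} \<subseteq> Gr a b" "smooth_on {-\<epsilon><..<\<epsilon>} ?X"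
    by (rule smooth_curve_quadratic_model_D[OF smX])
  have X0: "?X 0 = orbit_map a b Q" by (simp add: \<gamma>(2) phi5_inv_coset[OF assms(1,2)])
  obtain \<delta> t where t: "0 < \<delta>" "\<delta> \<le> \<epsilon>" "smooth_on {-\<delta><..<\<delta>} t" "t 0 = (0 :: real^'l^'k)"
    "\<forall>s\<in>{-\<delta><..<\<delta>}. orbit_map a b (Q ** cayley (offdiag (t s))) = ?X s"
    by (rule smooth_curve_lift[OF assms(1,2) \<epsilon>(3,1,2) X0])
  define h where "h = 2 *\<^sub>R vector_derivative t (at 0)"
  have "((\<lambda>s. cayley (offdiag (t s))) has_vector_derivative offdiag h) (at 0)"
    unfolding h_def by (rule cayley_curve_derivative[OF smooth_on_curve_has_derivative[OF t(3,1)] t(4)])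
  then have "((\<lambda>s. orbit_map a b (Q ** cayley (offdiag (t s)))) has_vector_derivative
      Q ** (offdiag h ** two_scalars a b - two_scalars a b ** offdiag h) ** transpose Q) (at 0)"
    by (intro orbit_curve_derivative offdiag_skew) (simp add: t(4))
  moreover have "\<forall>\<^sub>F s in nhds 0. orbit_map a b (Q ** cayley (offdiag (t s))) = ?X s"
    using eventually_interval[OF t(1)] by eventually_elim (use t(5) in blast)
  ultimately have dX: "(?X has_vector_derivative
      Q ** (offdiag h ** two_scalars a b - two_scalars a b ** offdiag h) ** transpose Q) (at 0)"
    by (rule has_vector_derivative_transform_eventually)
  have vel: "velocity quotient_model \<gamma> = velocity quotient_model (cayley_coset_curve Q h)"
    using cayley_coset_curve[OF assms(1,2), of h]
    by (intro velocity_quotient_model_eq[OF assms(1) _ smooth_curve_phi5_inv(2)[OF assms(1) \<gamma>(1)] _ dX])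
       (simp_all add: \<gamma>(2))
  have "translate Q \<circ> cayley_coset_curve (mat 1) h = cayley_coset_curve Q h"
    by (simp add: fun_eq_iff cayley_coset_curve_def translate_coset)
  then have "velocity quotient_model \<gamma> =
      differential quotient_model (translate Q) (velocity quotient_model (cayley_coset_curve (mat 1) h))"
    unfolding vel differential_translate[OF assms(2) cayley_coset_curve(1)[OF assms(1) one_in_SO]] by simp
  then show thesis
    using that[OF vector_derivative_at[OF dX]] by (simp add: velocity_cayley_eq_velocity_mexp)
qed

section \<open>The isometry\<close>

lemma trace_scaleR: "trace (c *\<^sub>R A :: real^'n::finite^'n) = c * trace A"
  by (simp add: trace_def sum_distrib_left)

text \<open>Conjugation by \<open>Q\<close> drops out of the trace, and both sides reduce to
  \<open>(a - b)\<^sup>2 (tr(h h'\<^sup>T) + tr(h\<^sup>T h'))\<close>.\<close>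

lemma trace_commutators:
  fixes h h' :: "real^'l::finite^'k::finite"
  assumes "Q \<in> SO"
  shows "trace ((Q ** (offdiag h ** two_scalars a b - two_scalars a b ** offdiag h) ** transpose Q) **
      (Q ** (offdiag h' ** two_scalars a b - two_scalars a b ** offdiag h') ** transpose Q)) =
    (a - b)\<^sup>2 * trace (transpose (offdiag h) ** offdiag h')"
proof -
  let ?W = "\<lambda>h. offdiag h ** two_scalars a b - two_scalars a b ** offdiag h :: ('k, 'l) bmat"
  have "(Q ** ?W h ** transpose Q) ** (Q ** ?W h' ** transpose Q)
      = Q ** ?W h ** (transpose Q ** Q) ** ?W h' ** transpose Q"
    by (simp only: matrix_mul_assoc)
  also have "trace \<dots> = trace (transpose Q ** Q ** (?W h ** ?W h'))"
    by (subst trace_mul_sym) (simp only: SO_transpose_mult[OF assms] matrix_mul_rid matrix_mul_assoc)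
  also have "\<dots> = trace (?W h ** ?W h')"
    by (simp add: SO_transpose_mult[OF assms])
  also have "\<dots> = (b - a)\<^sup>2 * (trace (h ** transpose h') + trace (transpose h ** h'))"
    unfolding offdiag_commutator
    by (simp add: matrix_mult.scaleR_left matrix_mult.scaleR_right block_mult trace_scaleR trace_block
        power2_eq_square)
  also have "\<dots> = (a - b)\<^sup>2 * trace (transpose (offdiag h) ** offdiag h')"
    by (simp add: offdiag_def block_transpose block_mult trace_block transpose_minus transpose_zero
        matrix_mult.minus_left matrix_mult.minus_right power2_commute)
  finally show ?thesis .
qed

text \<open>By \<open>tangent_vector_from_mexp\<close> both tangent vectors are translates of velocities of exponential
  curves at the base point, where the metric is prescribed; invariance of \<open>g\<close> carries the value
  to \<open>[[Q]]\<close>.\<close>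

lemma isometric_phi5_inv:
  fixes g :: "('k::finite, 'l::finite) bmat set metric_field"
  assumes "a \<noteq> b" and g: "is_quotient_metric a b g"
  shows "isometric quotient_model g (quadratic_model a b) quadratic_metric (phi5_inv a b)"
  unfolding isometric_def
proof (intro ballI)
  fix p :: "('k, 'l) bmat set" and u v
  assume p: "p \<in> points quotient_model" and u: "u \<in> tangent_space quotient_model p" and v: "v \<in> tangent_space quotient_model p"
  obtain Q where Q: "Q \<in> SO" "p = coset Q" using p by (auto simp: points_quotient_model)
  let ?e = "\<lambda>h. velocity quotient_model (\<lambda>s. coset (mexp (s *\<^sub>R offdiag h) :: ('k, 'l) bmat))"
  let ?W = "\<lambda>h. Q ** (offdiag h ** two_scalars a b - two_scalars a b ** offdiag h) ** transpose Q"
  have rep: "\<exists>h. ambient_vector (differential (quadratic_model a b) (phi5_inv a b) u) = ?W h \<and>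
      u = differential quotient_model (translate Q) (?e h)"
    if u: "u \<in> tangent_space quotient_model p" for u
  proof -
    obtain \<gamma> where \<gamma>: "u = velocity quotient_model \<gamma>" "smooth_curve quotient_model \<gamma>" "\<gamma> 0 = coset Q"
      using u Q(2) by (auto simp: tangent_space_def)
    obtain h where h: "vector_derivative (phi5_inv a b \<circ> \<gamma>) (at 0) = ?W h"
      "velocity quotient_model \<gamma> = differential quotient_model (translate Q) (?e h)"
      by (rule tangent_vector_from_mexp[OF assms(1) Q(1) \<gamma>(2,3)])
    show ?thesis
      using h unfolding \<gamma>(1) differential_phi5_inv[OF assms(1) \<gamma>(2)]
        ambient_vector_velocity[OF assms(1) smooth_curve_phi5_inv(1)[OF assms(1) \<gamma>(2)]] by blast
  qed
  obtain h where h: "ambient_vector (differential (quadratic_model a b) (phi5_inv a b) u) = ?W h"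
    "u = differential quotient_model (translate Q) (?e h)" using rep[OF u] by blast
  obtain h' where h': "ambient_vector (differential (quadratic_model a b) (phi5_inv a b) v) = ?W h'"
    "v = differential quotient_model (translate Q) (?e h')" using rep[OF v] by blast
  have base: "coset (mat 1) \<in> points (quotient_model :: (('k, 'l) bmat set, real^'l^'k) manifold)"
    using one_in_SO by (auto simp: points_quotient_model)
  have tangent: "?e h \<in> tangent_space quotient_model (coset (mat 1))" for h
    unfolding velocity_cayley_eq_velocity_mexp[symmetric] tangent_space_def
    using cayley_coset_curve(1,4)[OF assms(1) one_in_SO] by blast
  have "isometric quotient_model g quotient_model g (translate Q)"
    using g Q(1) by (simp add: is_quotient_metric_def)
  then have "g (translate Q (coset (mat 1))) u v = g (coset (mat 1)) (?e h) (?e h')"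
    unfolding isometric_def h(2) h'(2) using base tangent by blast
  also have "\<dots> = (a - b)\<^sup>2 * trace (transpose (offdiag h) ** offdiag h')"
    using g by (simp add: is_quotient_metric_def m_space_eq_offdiag)
  also have "\<dots> = trace (?W h ** ?W h')" by (rule trace_commutators[OF Q(1), symmetric])
  finally show "quadratic_metric (phi5_inv a b p) (differential (quadratic_model a b) (phi5_inv a b) u)
      (differential (quadratic_model a b) (phi5_inv a b) v) = g p u v"
    by (simp add: quadratic_metric_def h(1) h'(1) translate_coset Q(2))
qed

section \<open>The diffeomorphism\<close>

text \<open>If corresponding charts exist in which \<open>f\<close> is the identity of the model space, its coordinate
  expression is trivially smooth.\<close>

lemma smooth_map_same_coordinates:
  assumes "f ` points M \<subseteq> points N"
    and "\<And>p. p \<in> points M \<Longrightarrow> \<exists>U \<phi> V \<psi>. (U, \<phi>) \<in> atlas M \<and> (V, \<psi>) \<in> atlas N \<and> p \<in> U \<and> f ` U \<subseteq> V \<and>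
      (\<forall>x\<in>U. \<psi> (f x) = \<phi> x)"
  shows "smooth_map M N f"
  unfolding smooth_map_def
proof (intro conjI ballI assms(1))
  fix p assume "p \<in> points M"
  then obtain U \<phi> V \<psi> where *: "(U, \<phi>) \<in> atlas M" "(V, \<psi>) \<in> atlas N" "p \<in> U" "f ` U \<subseteq> V"
    "\<forall>x\<in>U. \<psi> (f x) = \<phi> x"
    using assms(2) by blast
  have "smooth_on (\<phi> ` U) (\<psi> \<circ> f \<circ> inv_into U \<phi>)"
    by (rule smooth_on_cong[OF smooth_on_ident]) (simp add: *(5) inv_into_into f_inv_into_f)
  with * show "\<exists>(U, \<phi>)\<in>atlas M. \<exists>(V, \<psi>)\<in>atlas N. p \<in> U \<and> f ` U \<subseteq> V \<and> smooth_on (\<phi> ` U) (\<psi> \<circ> f \<circ> inv_into U \<phi>)"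
    by blast
qed

lemma diffeomorphism_phi5_inv:
  assumes "a \<noteq> b"
  shows "diffeomorphism quotient_model (quadratic_model a b :: (('k::finite, 'l::finite) bmat, real^'l^'k) manifold)
    (phi5_inv a b)"
proof -
  let ?M = "quotient_model :: (('k, 'l) bmat set, real^'l^'k) manifold"
  let ?N = "quadratic_model a b :: (('k, 'l) bmat, real^'l^'k) manifold"
  let ?f = "phi5_inv a b :: ('k, 'l) bmat set \<Rightarrow> _"
  let ?g = "inv_into (points ?M) ?f"
  have bij: "bij_betw ?f (points ?M) (points ?N)"
    unfolding points_quadratic_model by (rule bij_betw_phi5_inv[OF assms])
  have gN: "?g X \<in> points ?M" "?f (?g X) = X" if "X \<in> points ?N" for X
    using bij that by (auto simp: bij_betw_def inv_into_into f_inv_into_f)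
  have charts: "\<exists>V \<psi>. (V, \<psi>) \<in> atlas ?N \<and> X \<in> V \<and> V \<subseteq> points ?N \<and>
      ({c \<in> points ?M. ?f c \<in> V}, \<psi> \<circ> ?f) \<in> atlas ?M" if X: "X \<in> points ?N" for X
  proof -
    obtain V and \<psi> :: "('k, 'l) bmat \<Rightarrow> real^'l^'k" where V: "(V, \<psi>) \<in> atlas (quadratic_model a b)" "X \<in> V"
      by (rule quadratic_chart_exists[OF assms X[unfolded points_quadratic_model]])
    show ?thesis
      using V quotient_chart_of_quadratic_chart[OF assms V(1)] quadratic_chart_subset[OF V(1)]
      unfolding points_quadratic_model by blast
  qed
  have "smooth_map ?M ?N ?f"
  proof (rule smooth_map_same_coordinates)
    show "?f ` points ?M \<subseteq> points ?N" using bij by (simp add: bij_betw_def)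
    fix p assume p: "p \<in> points ?M"
    then have "?f p \<in> points ?N" using bij_betwE[OF bij] by blast
    then obtain V \<psi> where V: "(V, \<psi>) \<in> atlas ?N" "?f p \<in> V"
      "({c \<in> points ?M. ?f c \<in> V}, \<psi> \<circ> ?f) \<in> atlas ?M" using charts by blast
    show "\<exists>U \<phi> V \<psi>. (U, \<phi>) \<in> atlas ?M \<and> (V, \<psi>) \<in> atlas ?N \<and> p \<in> U \<and> ?f ` U \<subseteq> V \<and> (\<forall>x\<in>U. \<psi> (?f x) = \<phi> x)"
      by (rule exI[of _ "{c \<in> points ?M. ?f c \<in> V}"], rule exI[of _ "\<psi> \<circ> ?f"], rule exI[of _ V], rule exI[of _ \<psi>])
         (use V p in auto)
  qed
  moreover have "smooth_map ?N ?M ?g"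
  proof (rule smooth_map_same_coordinates)
    show "?g ` points ?N \<subseteq> points ?M" using gN(1) by blast
    fix X assume X: "X \<in> points ?N"
    then obtain V \<psi> where V: "(V, \<psi>) \<in> atlas ?N" "X \<in> V" "V \<subseteq> points ?N"
      "({c \<in> points ?M. ?f c \<in> V}, \<psi> \<circ> ?f) \<in> atlas ?M" using charts by blast
    show "\<exists>U \<phi> W \<psi>. (U, \<phi>) \<in> atlas ?N \<and> (W, \<psi>) \<in> atlas ?M \<and> X \<in> U \<and> ?g ` U \<subseteq> W \<and> (\<forall>x\<in>U. \<psi> (?g x) = \<phi> x)"
      by (rule exI[of _ V], rule exI[of _ \<psi>], rule exI[of _ "{c \<in> points ?M. ?f c \<in> V}"], rule exI[of _ "\<psi> \<circ> ?f"])
         (use V gN in auto)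
  qed
  ultimately show ?thesis using bij by (simp add: diffeomorphism_def)
qed

theorem proposition7p2:
  fixes a b :: real
    and g :: "('k::finite, 'l::finite) bmat set metric_field"
  assumes "a \<noteq> b"
    and "is_quotient_metric a b g"
  shows "(\<forall>Q\<in>(SO :: ('k, 'l) bmat set).
            phi5_inv a b (coset Q) = Q ** block (mat a) 0 0 (mat b) ** transpose Q)
      \<and> diffeomorphism quotient_model (quadratic_model a b :: (('k, 'l) bmat, real^'l^'k) manifold)
          (phi5_inv a b)
      \<and> isometric quotient_model g (quadratic_model a b) quadratic_metric (phi5_inv a b)
      \<and> (\<forall>Q\<in>(SO :: ('k, 'l) bmat set). \<forall>c\<in>points quotient_model.
            phi5_inv a b (translate Q c) = Q ** phi5_inv a b c ** transpose Q)"
proof (intro conjI ballI)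
  fix Q :: "('k, 'l) bmat" assume Q: "Q \<in> SO"
  show "phi5_inv a b (coset Q) = Q ** block (mat a) 0 0 (mat b) ** transpose Q"
    using phi5_inv_coset[OF assms(1) Q] by (simp add: orbit_map_def)
  show "phi5_inv a b (translate Q c) = Q ** phi5_inv a b c ** transpose Q"
    if "c \<in> points quotient_model" for c
    by (rule phi5_inv_translate[OF assms(1) Q that])
qed (rule diffeomorphism_phi5_inv[OF assms(1)], rule isometric_phi5_inv[OF assms])

end
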